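(* Let $l\ge 1$ and let $\Lambda$ be a graded self-injective algebra given by a bound quiver $Q=(Q,\rho)$, where $Q$ is a stable bound quiver of Loewy length $l+1$ with Nakayama translation $\tau$. Let $\tilde{\Lambda}=\Lambda\ltimes D\Lambda$ be the trivial extension of $\Lambda$ and let $(\tilde Q,\tilde\rho)$ be a bound quiver of $\tilde\Lambda$. Then: (1) $\tilde Q$ is a stable bound quiver of Loewy length $l+2$ with trivial Nakayama translation, and $\tilde Q$ is obtained from $Q$ by adding an arrow $\alpha_i: i\longrightarrow \tau i$ for each vertex $i\in Q_0$. (2) The relation set can be taken as $\tilde\rho=\rho\cup\rho'$ with $$\rho'=\{\alpha_{\tau i}\alpha_i \mid i\in Q_0\}\cup\{\alpha_j\beta-\nu(\beta)\alpha_i \mid \beta: i\longrightarrow j \in Q_1\}.$$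
   Context: $k$ is a field and $D=\mathrm{Hom}_k(-,k)$. A graded algebra is $\Gamma=\bigoplus_{t\ge0}\Gamma_t$, generated by $\Gamma_0$ and $\Gamma_1$, with $\Gamma_0=\bigoplus_{i=1}^n ke_i$, where $1=e_1+\cdots+e_n$ is a decomposition into orthogonal primitive idempotents. Paths are composed from right to left: a path from $i$ to $j$ lies in $e_j(kQ)e_i$. A bound quiver $Q=(Q_0,Q_1,\rho)$ is a quiver with vertex set $Q_0$, arrow set $Q_1$, and a set $\rho$ of relations (linear combinations of paths of length $\ge2$); the algebra it gives is $k(Q)=kQ/(\rho)$. A bound path is a path with nonzero image in $k(Q)$. The bound quiver is homogeneous if in each element of $\rho$ all paths have the same length. A homogeneous bound quiver is stable of Loewy length $l+1$ ($l\ge1$) if: (i) a permutation $\tau$ of $Q_0$ is given (the Nakayama translation); (ii) all maximal bound paths have the same length $l$; (iii) for each vertex $i$ there is a maximal bound path from $\tau i$ to $i$ and there is no bound path of length $l$ from $\tau i$ to $j$ for any $j\ne i$; (iv) any two maximal bound paths starting at the same vertex are linearly dependent in $k(Q)$. A finite-dimensional graded algebra is graded self-injective of Loewy length $l+1$ if and only if it is given by a stable bound quiver of Loewy length $l+1$. The trivial extension $\Lambda\ltimes M$ of $\Lambda$ by a $\Lambda$-bimodule $M$ is $\Lambda\oplus M$ with multiplication $(a,x)(b,y)=(ab,ay+xb)$. Notation: for each vertex $i$ fix a maximal bound path $p_{l,i}$ from $\tau i$ to $i$ (a basis of the one-dimensional space $e_i\Lambda_l e_{\tau i}$), chosen as part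 of a basis of $\Lambda$ consisting of bound paths; $p_{l,i}^*\in D\Lambda$ is the corresponding dual basis element, and the new arrow $\alpha_i$ corresponds to $p_{l,i}^*$. Let $\eta_i: e_i\Lambda_le_{\tau i}\to k$ be the linear function with $z=\eta_i(z)p_{l,i}$. The map $\nu$ sends an arrow $\beta:i\to j$ to the element $\nu(\beta)\in e_{\tau j}\Lambda_1e_{\tau i}$ (a linear combination of arrows from $\tau i$ to $\tau j$) determined by $\eta_j(\beta q)=\eta_i(q\,\nu(\beta))$ for all $q\in e_i\Lambda_{l-1}e_{\tau j}$; it is the restriction to arrows of the Nakayama automorphism of $\Lambda$. $\tilde\Lambda$ is graded by $\tilde\Lambda_0=\Lambda_0$, $\tilde\Lambda_t=\Lambda_t+\Lambda^*_{l+1-t}$ for $1\le t\le l$, $\tilde\Lambda_{l+1}=\Lambda_0^*$, where $\Lambda_t^*$ is the span in $D\Lambda$ of the dual basis elements of a basis of bound paths of length $t$. *)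

theory Defs
  imports
    "Graph_Theory.Graph_Theory"
    "HOL-Algebra.QuotRing"
    "HOL-Algebra.Module"
    "HOL-Library.Poly_Mapping"
begin

text \<open>
  A quiver is a \<^typ>\<open>('v, 'a) pre_digraph\<close>. A path is a pair of its starting vertex and the list of
  its arrows in the order in which they are traversed; the starting vertex is needed for the
  trivial paths. Products in the path algebra are composed from right to left, so the product
  of \<open>\<pi>\<close> and \<open>\<sigma>\<close> traverses \<open>\<sigma>\<close> first.

  Algebras over the field \<^typ>\<open>'k\<close> are records of type \<^typ>\<open>('k, 'x) module\<close>; the scalars are all
  elements of the type \<^typ>\<open>'k\<close>.
\<close>

section \<open>Algebras over a field\<close>

definition alg_iso :: "('k::field, 'x) module \<Rightarrow> ('k, 'y) module \<Rightarrow> ('x \<Rightarrow> 'y) set" where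
  "alg_iso A B = {\<phi> \<in> ring_iso A B.
     \<forall>c. \<forall>x\<in>carrier A. \<phi> (c \<odot>\<^bsub>A\<^esub> x) = c \<odot>\<^bsub>B\<^esub> \<phi> x}"

definition finite_dimensional :: "('k::field, 'x) module \<Rightarrow> bool" where
  "finite_dimensional A \<longleftrightarrow> (\<exists>B. finite B \<and> B \<subseteq> carrier A \<and>
     (\<forall>z\<in>carrier A. \<exists>c :: 'x \<Rightarrow> 'k. z = (\<Oplus>\<^bsub>A\<^esub>b\<in>B. c b \<odot>\<^bsub>A\<^esub> b)))"

text \<open>
  The locale \<^locale>\<open>module\<close> requires a commutative ring of scalars; this is the same notion over an
  arbitrary ring.
\<close>

locale left_module = R?: ring R + M?: abelian_group M
  for R (structure) and M (structure) +
  assumes "a \<in> carrier R \<Longrightarrow> x \<in> carrier M \<Longrightarrow> a \<odot>\<^bsub>M\<^esub> x \<in> carrier M"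
    and "a \<in> carrier R \<Longrightarrow> b \<in> carrier R \<Longrightarrow> x \<in> carrier M \<Longrightarrow>
      (a \<oplus>\<^bsub>R\<^esub> b) \<odot>\<^bsub>M\<^esub> x = a \<odot>\<^bsub>M\<^esub> x \<oplus>\<^bsub>M\<^esub> b \<odot>\<^bsub>M\<^esub> x"
    and "a \<in> carrier R \<Longrightarrow> x \<in> carrier M \<Longrightarrow> y \<in> carrier M \<Longrightarrow>
      a \<odot>\<^bsub>M\<^esub> (x \<oplus>\<^bsub>M\<^esub> y) = a \<odot>\<^bsub>M\<^esub> x \<oplus>\<^bsub>M\<^esub> a \<odot>\<^bsub>M\<^esub> y"
    and "a \<in> carrier R \<Longrightarrow> b \<in> carrier R \<Longrightarrow> x \<in> carrier M \<Longrightarrow>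
      (a \<otimes>\<^bsub>R\<^esub> b) \<odot>\<^bsub>M\<^esub> x = a \<odot>\<^bsub>M\<^esub> (b \<odot>\<^bsub>M\<^esub> x)"
    and "x \<in> carrier M \<Longrightarrow> \<one>\<^bsub>R\<^esub> \<odot>\<^bsub>M\<^esub> x = x"

definition left_module_hom ::
    "('r, 'e) ring_scheme \<Rightarrow> ('r, 'm) module \<Rightarrow> ('r, 'n) module \<Rightarrow> ('m \<Rightarrow> 'n) set" where
  "left_module_hom R M N = {f \<in> carrier M \<rightarrow> carrier N.
     (\<forall>x\<in>carrier M. \<forall>y\<in>carrier M. f (x \<oplus>\<^bsub>M\<^esub> y) = f x \<oplus>\<^bsub>N\<^esub> f y) \<and>
     (\<forall>a\<in>carrier R. \<forall>x\<in>carrier M. f (a \<odot>\<^bsub>M\<^esub> x) = a \<odot>\<^bsub>N\<^esub> f x)}"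

text \<open>
  A definition cannot quantify over types, so the test modules \<open>M\<close> and \<open>N\<close> range over all left
  \<open>R\<close>-modules (with arbitrary carrier set and operations) on the type underlying \<open>E\<close>. For the
  regular module of a finite-dimensional algebra given by a bound quiver this type has room for
  every finite-dimensional module, in particular for the regular module and its left ideals, so
  by Baer's criterion nothing is lost.
\<close>

definition injective_left_module :: "('r, 'e) ring_scheme \<Rightarrow> ('r, 'm) module \<Rightarrow> bool" where
  "injective_left_module R E \<longleftrightarrow> left_module R E \<and>
     (\<forall>(M :: ('r, 'm) module) (N :: ('r, 'm) module) \<iota> f.
        left_module R M \<and> left_module R N \<and>
        \<iota> \<in> left_module_hom R M N \<and> inj_on \<iota> (carrier M) \<and> f \<in> left_module_hom R M E \<longrightarrow>
        (\<exists>g\<in>left_module_hom R N E. \<forall>x\<in>carrier M. g (\<iota> x) = f x))"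

definition regular_module :: "('k::field, 'x) module \<Rightarrow> ('x, 'x) module" where
  "regular_module A = \<lparr>carrier = carrier A, mult = mult A, one = one A,
     zero = zero A, add = add A, smult = mult A\<rparr>"

definition self_injective :: "('k::field, 'x) module \<Rightarrow> bool" where
  "self_injective A \<longleftrightarrow> injective_left_module A (regular_module A)"

section \<open>Trivial extensions\<close>

text \<open>
  Only the fields \<^const>\<open>carrier\<close>, \<^const>\<open>zero\<close>, \<^const>\<open>add\<close> and \<^const>\<open>smult\<close> of the underlying record are
  used; \<^const>\<open>mult\<close> and \<^const>\<open>one\<close> are inherited from the record hierarchy and carry no meaning.
\<close>

record ('x, 'k, 'm) bimodule = "('k, 'm) module" +
  lact :: "'x \<Rightarrow> 'm \<Rightarrow> 'm"
  ract :: "'m \<Rightarrow> 'x \<Rightarrow> 'm"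

definition trivial_extension ::
    "('k::field, 'x) module \<Rightarrow> ('x, 'k, 'm) bimodule \<Rightarrow> ('k, 'x \<times> 'm) module" where
  "trivial_extension A M =
    \<lparr>carrier = carrier A \<times> carrier M,
     mult = (\<lambda>(a, x) (b, y). (a \<otimes>\<^bsub>A\<^esub> b, lact M a y \<oplus>\<^bsub>M\<^esub> ract M x b)),
     one = (\<one>\<^bsub>A\<^esub>, \<zero>\<^bsub>M\<^esub>),
     zero = (\<zero>\<^bsub>A\<^esub>, \<zero>\<^bsub>M\<^esub>),
     add = (\<lambda>(a, x) (b, y). (a \<oplus>\<^bsub>A\<^esub> b, x \<oplus>\<^bsub>M\<^esub> y)),
     smult = (\<lambda>c (a, x). (c \<odot>\<^bsub>A\<^esub> a, c \<odot>\<^bsub>M\<^esub> x))\<rparr>"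

text \<open>The functionals are \<^const>\<open>undefined\<close> outside the carrier, so that equality is pointwise.\<close>

definition dual_bimodule :: "('k::field, 'x) module \<Rightarrow> ('x, 'k, 'x \<Rightarrow> 'k) bimodule" where
  "dual_bimodule A =
    \<lparr>carrier = {f \<in> carrier A \<rightarrow>\<^sub>E UNIV.
       (\<forall>x\<in>carrier A. \<forall>y\<in>carrier A. f (x \<oplus>\<^bsub>A\<^esub> y) = f x + f y) \<and>
       (\<forall>c. \<forall>x\<in>carrier A. f (c \<odot>\<^bsub>A\<^esub> x) = c * f x)},
     mult = undefined,
     one = undefined,
     zero = (\<lambda>z\<in>carrier A. 0),
     add = (\<lambda>f g. \<lambda>z\<in>carrier A. f z + g z),
     smult = (\<lambda>c f. \<lambda>z\<in>carrier A. c * f z),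
     lact = (\<lambda>a f. \<lambda>z\<in>carrier A. f (z \<otimes>\<^bsub>A\<^esub> a)),
     ract = (\<lambda>f a. \<lambda>z\<in>carrier A. f (a \<otimes>\<^bsub>A\<^esub> z))\<rparr>"

abbreviation dual_extension :: "('k::field, 'x) module \<Rightarrow> ('k, 'x \<times> ('x \<Rightarrow> 'k)) module" where
  "dual_extension A \<equiv> trivial_extension A (dual_bimodule A)"

section \<open>Path algebras and bound quivers\<close>

type_synonym ('v, 'a) path = "'v \<times> 'a list"

definition path_from_to :: "('v, 'a) pre_digraph \<Rightarrow> 'v \<Rightarrow> 'v \<Rightarrow> ('v, 'a) path \<Rightarrow> bool" where
  "path_from_to Q i j \<pi> \<longleftrightarrow> fst \<pi> = i \<and> pre_digraph.awalk Q i (snd \<pi>) j"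

definition paths :: "('v, 'a) pre_digraph \<Rightarrow> ('v, 'a) path set" where
  "paths Q = {\<pi>. \<exists>i j. path_from_to Q i j \<pi>}"

abbreviation path_end :: "('v, 'a) pre_digraph \<Rightarrow> ('v, 'a) path \<Rightarrow> 'v" where
  "path_end Q \<pi> \<equiv> pre_digraph.awlast Q (fst \<pi>) (snd \<pi>)"

abbreviation path_length :: "('v, 'a) path \<Rightarrow> nat" where
  "path_length \<pi> \<equiv> length (snd \<pi>)"

abbreviation path_elem :: "('v, 'a) path \<Rightarrow> ('v, 'a) path \<Rightarrow>\<^sub>0 'k::field" where
  "path_elem \<pi> \<equiv> Poly_Mapping.single \<pi> 1"

abbreviation vertex_elem :: "'v \<Rightarrow> ('v, 'a) path \<Rightarrow>\<^sub>0 'k::field" where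
  "vertex_elem i \<equiv> path_elem (i, [])"

abbreviation arrow_elem :: "('v, 'a) pre_digraph \<Rightarrow> 'a \<Rightarrow> ('v, 'a) path \<Rightarrow>\<^sub>0 'k::field" where
  "arrow_elem Q a \<equiv> path_elem (tail Q a, [a])"

definition path_algebra ::
    "('v, 'a) pre_digraph \<Rightarrow> ('k::field, ('v, 'a) path \<Rightarrow>\<^sub>0 'k) module" where
  "path_algebra Q =
    \<lparr>carrier = {x. Poly_Mapping.keys x \<subseteq> paths Q},
     mult = (\<lambda>x y. \<Sum>\<pi>\<in>Poly_Mapping.keys x. \<Sum>\<sigma>\<in>Poly_Mapping.keys y.
       if path_end Q \<sigma> = fst \<pi>
       then Poly_Mapping.single (fst \<sigma>, snd \<sigma> @ snd \<pi>)
              (Poly_Mapping.lookup x \<pi> * Poly_Mapping.lookup y \<sigma>)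
       else 0),
     one = (\<Sum>i\<in>verts Q. vertex_elem i),
     zero = 0,
     add = (+),
     smult = (\<lambda>c. Poly_Mapping.map ((*) c))\<rparr>"

definition bound_quiver ::
    "('v, 'a) pre_digraph \<Rightarrow> (('v, 'a) path \<Rightarrow>\<^sub>0 'k::field) set \<Rightarrow> bool" where
  "bound_quiver Q \<rho> \<longleftrightarrow> fin_digraph Q \<and>
     (\<forall>r\<in>\<rho>. \<forall>\<pi>\<in>Poly_Mapping.keys r. \<pi> \<in> paths Q \<and> 2 \<le> path_length \<pi>)"

definition homogeneous_bound_quiver ::
    "('v, 'a) pre_digraph \<Rightarrow> (('v, 'a) path \<Rightarrow>\<^sub>0 'k::field) set \<Rightarrow> bool" where
  "homogeneous_bound_quiver Q \<rho> \<longleftrightarrow> bound_quiver Q \<rho> \<and>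
     (\<forall>r\<in>\<rho>. \<forall>\<pi>\<in>Poly_Mapping.keys r. \<forall>\<sigma>\<in>Poly_Mapping.keys r. path_length \<pi> = path_length \<sigma>)"

definition path_class ::
    "('v, 'a) pre_digraph \<Rightarrow> (('v, 'a) path \<Rightarrow>\<^sub>0 'k::field) set \<Rightarrow>
     (('v, 'a) path \<Rightarrow>\<^sub>0 'k) \<Rightarrow> (('v, 'a) path \<Rightarrow>\<^sub>0 'k) set" where
  "path_class Q \<rho> x = (Idl\<^bsub>path_algebra Q\<^esub> \<rho>) +>\<^bsub>path_algebra Q\<^esub> x"

definition bound_algebra ::
    "('v, 'a) pre_digraph \<Rightarrow> (('v, 'a) path \<Rightarrow>\<^sub>0 'k::field) set \<Rightarrow>
     ('k, (('v, 'a) path \<Rightarrow>\<^sub>0 'k) set) module" where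
  "bound_algebra Q \<rho> =
     ring.extend (path_algebra Q Quot (Idl\<^bsub>path_algebra Q\<^esub> \<rho>))
       (module.fields (\<lambda>c X. \<Union>x\<in>X. path_class Q \<rho> (c \<odot>\<^bsub>path_algebra Q\<^esub> x)))"

definition bound_quiver_of ::
    "('v, 'a) pre_digraph \<Rightarrow> (('v, 'a) path \<Rightarrow>\<^sub>0 'k::field) set \<Rightarrow> ('k, 'x) module \<Rightarrow> bool" where
  "bound_quiver_of Q \<rho> A \<longleftrightarrow>
     homogeneous_bound_quiver Q \<rho> \<and> alg_iso (bound_algebra Q \<rho>) A \<noteq> {}"

section \<open>Stable bound quivers\<close>

definition bound_path ::
    "('v, 'a) pre_digraph \<Rightarrow> (('v, 'a) path \<Rightarrow>\<^sub>0 'k::field) set \<Rightarrow> ('v, 'a) path \<Rightarrow> bool" where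
  "bound_path Q \<rho> \<pi> \<longleftrightarrow>
     \<pi> \<in> paths Q \<and> path_class Q \<rho> (path_elem \<pi>) \<noteq> \<zero>\<^bsub>bound_algebra Q \<rho>\<^esub>"

definition maximal_bound_path ::
    "('v, 'a) pre_digraph \<Rightarrow> (('v, 'a) path \<Rightarrow>\<^sub>0 'k::field) set \<Rightarrow> ('v, 'a) path \<Rightarrow> bool" where
  "maximal_bound_path Q \<rho> \<pi> \<longleftrightarrow> bound_path Q \<rho> \<pi> \<and>
     (\<forall>u p q. path_end Q (u, p) = fst \<pi> \<and> bound_path Q \<rho> (u, p @ snd \<pi> @ q) \<longrightarrow>
        p = [] \<and> q = [])"

definition stable_bound_quiver ::
    "nat \<Rightarrow> ('v, 'a) pre_digraph \<Rightarrow> (('v, 'a) path \<Rightarrow>\<^sub>0 'k::field) set \<Rightarrow> ('v \<Rightarrow> 'v) \<Rightarrow> bool" where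
  \<comment> \<open>the first argument is the Loewy length\<close>
  "stable_bound_quiver L Q \<rho> \<tau> \<longleftrightarrow> homogeneous_bound_quiver Q \<rho> \<and>
     (\<exists>l\<ge>1. L = l + 1 \<and>
       bij_betw \<tau> (verts Q) (verts Q) \<and>
       (\<forall>\<pi>. maximal_bound_path Q \<rho> \<pi> \<longrightarrow> path_length \<pi> = l) \<and>
       (\<forall>i\<in>verts Q.
          (\<exists>\<pi>. maximal_bound_path Q \<rho> \<pi> \<and> path_from_to Q (\<tau> i) i \<pi>) \<and>
          \<not> (\<exists>\<pi> j. j \<noteq> i \<and> bound_path Q \<rho> \<pi> \<and> path_length \<pi> = l \<and>
                path_from_to Q (\<tau> i) j \<pi>)) \<and>
       (\<forall>\<pi> \<sigma>. maximal_bound_path Q \<rho> \<pi> \<and> maximal_bound_path Q \<rho> \<sigma> \<and> fst \<pi> = fst \<sigma> \<longrightarrow>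
          (\<exists>c d :: 'k. (c, d) \<noteq> (0, 0) \<and>
             c \<odot>\<^bsub>bound_algebra Q \<rho>\<^esub> path_class Q \<rho> (path_elem \<pi>)
             \<oplus>\<^bsub>bound_algebra Q \<rho>\<^esub> d \<odot>\<^bsub>bound_algebra Q \<rho>\<^esub> path_class Q \<rho> (path_elem \<sigma>)
             = \<zero>\<^bsub>bound_algebra Q \<rho>\<^esub>)))"

section \<open>The map \<open>\<nu>\<close>, dual basis elements and the returning arrows\<close>

text \<open>The space $e_j \Lambda_t e_i$.\<close>

definition graded_piece ::
    "('v, 'a) pre_digraph \<Rightarrow> (('v, 'a) path \<Rightarrow>\<^sub>0 'k::field) set \<Rightarrow> nat \<Rightarrow> 'v \<Rightarrow> 'v \<Rightarrow>
     (('v, 'a) path \<Rightarrow>\<^sub>0 'k) set set" where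
  "graded_piece Q \<rho> t i j =
     path_class Q \<rho> ` {x. \<forall>\<pi>\<in>Poly_Mapping.keys x. path_from_to Q i j \<pi> \<and> path_length \<pi> = t}"

text \<open>
  In the remaining definitions \<open>p\<close> is the chosen family of maximal bound paths, \<open>p i\<close> from \<open>\<tau> i\<close>
  to \<open>i\<close>; \<open>eta\<close> is meaningful on $e_i \Lambda_l e_{\tau i}$.
\<close>

definition eta ::
    "('v, 'a) pre_digraph \<Rightarrow> (('v, 'a) path \<Rightarrow>\<^sub>0 'k::field) set \<Rightarrow> ('v \<Rightarrow> ('v, 'a) path) \<Rightarrow>
     'v \<Rightarrow> (('v, 'a) path \<Rightarrow>\<^sub>0 'k) set \<Rightarrow> 'k" where
  "eta Q \<rho> p i z = (THE c. z = c \<odot>\<^bsub>bound_algebra Q \<rho>\<^esub> path_class Q \<rho> (path_elem (p i)))"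

text \<open>
  As relations have length at least two, $\Lambda_1$ is identified with the span of the arrows in
  the path algebra, and \<open>\<nu>\<close> takes its values there.
\<close>

definition nakayama_map ::
    "('v, 'a) pre_digraph \<Rightarrow> (('v, 'a) path \<Rightarrow>\<^sub>0 'k::field) set \<Rightarrow> ('v \<Rightarrow> 'v) \<Rightarrow> nat \<Rightarrow>
     ('v \<Rightarrow> ('v, 'a) path) \<Rightarrow> 'a \<Rightarrow> (('v, 'a) path \<Rightarrow>\<^sub>0 'k)" where
  "nakayama_map Q \<rho> \<tau> l p \<beta> =
     (let i = tail Q \<beta>; j = head Q \<beta> in
      THE y. (\<forall>\<pi>\<in>Poly_Mapping.keys y. path_from_to Q (\<tau> i) (\<tau> j) \<pi> \<and> path_length \<pi> = 1) \<and>
        (\<forall>q\<in>graded_piece Q \<rho> (l - 1) (\<tau> j) i.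
           eta Q \<rho> p j (path_class Q \<rho> (arrow_elem Q \<beta>) \<otimes>\<^bsub>bound_algebra Q \<rho>\<^esub> q)
           = eta Q \<rho> p i (q \<otimes>\<^bsub>bound_algebra Q \<rho>\<^esub> path_class Q \<rho> y)))"

definition basis_expansion ::
    "('v, 'a) pre_digraph \<Rightarrow> (('v, 'a) path \<Rightarrow>\<^sub>0 'k::field) set \<Rightarrow> ('v, 'a) path set \<Rightarrow>
     (('v, 'a) path \<Rightarrow>\<^sub>0 'k) set \<Rightarrow> (('v, 'a) path \<Rightarrow> 'k) \<Rightarrow> bool" where
  "basis_expansion Q \<rho> B z c \<longleftrightarrow> c \<in> B \<rightarrow>\<^sub>E UNIV \<and>
     z = (\<Oplus>\<^bsub>bound_algebra Q \<rho>\<^esub>b\<in>B. c b \<odot>\<^bsub>bound_algebra Q \<rho>\<^esub> path_class Q \<rho> (path_elem b))"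

definition bound_path_basis ::
    "('v, 'a) pre_digraph \<Rightarrow> (('v, 'a) path \<Rightarrow>\<^sub>0 'k::field) set \<Rightarrow> ('v, 'a) path set \<Rightarrow> bool" where
  "bound_path_basis Q \<rho> B \<longleftrightarrow> finite B \<and> (\<forall>b\<in>B. bound_path Q \<rho> b) \<and>
     (\<forall>z\<in>carrier (bound_algebra Q \<rho>). \<exists>!c. basis_expansion Q \<rho> B z c)"

definition dual_basis_elem ::
    "('v, 'a) pre_digraph \<Rightarrow> (('v, 'a) path \<Rightarrow>\<^sub>0 'k::field) set \<Rightarrow> ('v, 'a) path set \<Rightarrow>
     ('v, 'a) path \<Rightarrow> (('v, 'a) path \<Rightarrow>\<^sub>0 'k) set \<Rightarrow> 'k" where
  "dual_basis_elem Q \<rho> B b =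
     (\<lambda>z\<in>carrier (bound_algebra Q \<rho>). (THE c. basis_expansion Q \<rho> B z c) b)"

text \<open>
  The old arrows are tagged with \<^const>\<open>Inl\<close>; the new arrow $\alpha_i$ from \<open>i\<close> to \<open>\<tau> i\<close> is \<^term>\<open>Inr i\<close>.
\<close>

definition returning_quiver ::
    "('v, 'a) pre_digraph \<Rightarrow> ('v \<Rightarrow> 'v) \<Rightarrow> ('v, 'a + 'v) pre_digraph" where
  "returning_quiver Q \<tau> = \<lparr>verts = verts Q, arcs = Inl ` arcs Q \<union> Inr ` verts Q,
     tail = case_sum (tail Q) (\<lambda>i. i), head = case_sum (head Q) \<tau>\<rparr>"

definition embed_elem :: "(('v, 'a) path \<Rightarrow>\<^sub>0 'k::field) \<Rightarrow> (('v, 'a + 'v) path \<Rightarrow>\<^sub>0 'k)" where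
  "embed_elem x = (\<Sum>\<pi>\<in>Poly_Mapping.keys x.
     Poly_Mapping.single (fst \<pi>, map Inl (snd \<pi>)) (Poly_Mapping.lookup x \<pi>))"

definition returning_relations ::
    "('v, 'a) pre_digraph \<Rightarrow> (('v, 'a) path \<Rightarrow>\<^sub>0 'k::field) set \<Rightarrow> ('v \<Rightarrow> 'v) \<Rightarrow> nat \<Rightarrow>
     ('v \<Rightarrow> ('v, 'a) path) \<Rightarrow> (('v, 'a + 'v) path \<Rightarrow>\<^sub>0 'k) set" where
  "returning_relations Q \<rho> \<tau> l p =
     (let Q' = returning_quiver Q \<tau>; kQ' = path_algebra Q' in
      embed_elem ` \<rho>
      \<union> {arrow_elem Q' (Inr (\<tau> i)) \<otimes>\<^bsub>kQ'\<^esub> arrow_elem Q' (Inr i) | i. i \<in> verts Q}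
      \<union> {arrow_elem Q' (Inr (head Q \<beta>)) \<otimes>\<^bsub>kQ'\<^esub> arrow_elem Q' (Inl \<beta>)
          - embed_elem (nakayama_map Q \<rho> \<tau> l p \<beta>) \<otimes>\<^bsub>kQ'\<^esub> arrow_elem Q' (Inr (tail Q \<beta>))
         | \<beta>. \<beta> \<in> arcs Q})"

end

theory Submission
  imports Defs
begin

text \<open>
  Let \<open>\<theta>\<close> be the sum of the functionals \<open>\<eta>\<^sub>i\<close>. Injectivity of the regular module forces the left
  socle of \<open>\<Lambda>\<close> to be \<open>\<Lambda>\<^sub>l\<close>, so the pairing \<open>\<theta> (x y)\<close> is nondegenerate, \<open>D\<Lambda> = \<Lambda> \<theta>\<close>, and \<open>\<nu>\<close> exists.
  With \<open>\<alpha>\<close> the sum of the new arrows, the relations move every \<open>\<alpha>\<close> to the right and kill \<open>\<alpha> \<alpha>\<close>, so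
  each element of the new path algebra is congruent to some \<open>a + b \<alpha>\<close>; its image in \<open>\<Lambda> \<ltimes> D\<Lambda>\<close> is
  \<open>(a, b \<theta>)\<close>, which vanishes only if \<open>a\<close> and \<open>b\<close> vanish in \<open>\<Lambda>\<close>. This gives the presentation.

  An isomorphism between the algebras of two homogeneous bound quivers need not respect the
  gradings, but it respects the filtrations by powers of the radical. The vertices are the
  characters of the algebra, the arrows are counted in the radical modulo its square, and the
  socle together with the action on it determines stability.
\<close>

section \<open>Linear algebra\<close>

text \<open>The stability conditions speak about single paths, and so leave a gap: for two loops
  \<open>x\<close>, \<open>y\<close> at one vertex with all four products equal and nonzero, and all
  longer paths zero, they hold with \<open>l = 2\<close>, yet \<open>x - y\<close> is a socle
  element of degree one. Injectivity closes this gap, tested on a single inclusion, that of the line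
  spanned by \<open>p i\<close>. Likewise the conditions restrict only maximal bound paths; finite
  dimension excludes bound paths that can be prolonged for ever. Computations take place in the path
  algebra modulo the ideal. As relations are homogeneous of degree at least two, degrees pass to the
  quotient, and the coefficients at vertices and arrows do not depend on representatives. These
  coefficients are what is followed through an arbitrary isomorphism: at a vertex they form a
  character, at an arrow they obey a Leibniz rule for two characters. The translation becomes
  trivial because \<alpha> leads from \<open>i\<close> to \<open>\<tau> i\<close> and
  \<open>p i\<close> leads back, which makes the new top degree \<open>l + 1\<close> consist of
  cycles.\<close>

lemma nontrivial_solution:
  fixes M :: "'x \<Rightarrow> 'y \<Rightarrow> 'k::field"
  assumes "finite Y" "finite X" "card Y < card X"
  shows "\<exists>c. (\<exists>x\<in>X. c x \<noteq> 0) \<and> (\<forall>y\<in>Y. (\<Sum>x\<in>X. c x * M x y) = 0)"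
  using assms
proof (induction Y arbitrary: X M rule: finite_induct)
  case empty
  then obtain x where "x \<in> X" by (metis card.empty card_gt_0_iff ex_in_conv)
  then show ?case by (intro exI[of _ "\<lambda>_. 1"]) auto
next
  case (insert y Y)
  show ?case
  proof (cases "\<forall>x\<in>X. M x y = 0")
    case True
    have "card Y < card X" using insert by simp
    then obtain c where "\<exists>x\<in>X. c x \<noteq> 0" "\<forall>y\<in>Y. (\<Sum>x\<in>X. c x * M x y) = 0"
      using insert.IH[of X M] insert.prems by blast
    then show ?thesis using True by (intro exI[of _ c]) auto
  next
    case False
    then obtain x0 where x0: "x0 \<in> X" "M x0 y \<noteq> 0" by auto
    define X' where "X' = X - {x0}"
    have X': "finite X'" "X = insert x0 X'" "x0 \<notin> X'" "card Y < card X'"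
      using insert x0 by (auto simp: X'_def)
    \<comment> \<open>Subtracting multiples of the pivot row \<open>x0\<close> clears column
      \<open>y\<close>, so the remaining rows face one equation less.\<close>
    define M' where "M' = (\<lambda>x z. M x z - M x y / M x0 y * M x0 z)"
    from insert.IH[OF X'(1,4), of M'] obtain c where
      c: "\<exists>x\<in>X'. c x \<noteq> 0" "\<forall>z\<in>Y. (\<Sum>x\<in>X'. c x * M' x z) = 0" by blast
    \<comment> \<open>The coefficient of the pivot row absorbs the subtracted multiples, so that
      \<open>d\<close> combines the rows of \<open>M\<close> to the same value as \<open>c\<close>
      does those of \<open>M'\<close>.\<close>
    define d where "d = c(x0 := - (\<Sum>x\<in>X'. c x * M x y) / M x0 y)"
    have d: "(\<Sum>x\<in>X. d x * M x z) = (\<Sum>x\<in>X'. c x * M' x z)" for z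
    proof -
      have "(\<Sum>x\<in>X'. d x * M x z) = (\<Sum>x\<in>X'. c x * M x z)"
        using X'(3) by (intro sum.cong) (auto simp: d_def)
      then have "(\<Sum>x\<in>X. d x * M x z)
          = - (\<Sum>x\<in>X'. c x * M x y) / M x0 y * M x0 z + (\<Sum>x\<in>X'. c x * M x z)"
        using X' by (simp add: d_def)
      also have "\<dots> = (\<Sum>x\<in>X'. c x * M' x z)"
        by (simp add: M'_def right_diff_distrib sum_subtractf sum_distrib_right
            sum_divide_distrib sum_negf mult.assoc)
      finally show ?thesis .
    qed
    have "M' x y = 0" for x using x0 by (simp add: M'_def)
    then have "\<forall>z\<in>insert y Y. (\<Sum>x\<in>X. d x * M x z) = 0" using c(2) d by simp
    moreover have "\<exists>x\<in>X. d x \<noteq> 0" using c(1) X' by (auto simp: d_def)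
    ultimately show ?thesis by blast
  qed
qed

text \<open>The right-hand side is adjoined as one more row. Rows then outnumber columns, and in the
  resulting dependency the coefficient of the new row cannot vanish, since the old rows are
  independent.\<close>

lemma solvable_if_rows_independent:
  fixes M :: "'x \<Rightarrow> 'x \<Rightarrow> 'k::field"
  assumes fin: "finite B"
    and ker: "\<And>c. (\<forall>y\<in>B. (\<Sum>x\<in>B. c x * M x y) = 0) \<Longrightarrow> \<forall>x\<in>B. c x = 0"
  shows "\<exists>c. \<forall>y\<in>B. (\<Sum>x\<in>B. c x * M x y) = f y"
proof -
  define X where "X = insert None (Some ` B)"
  define N where "N = case_option f M"
  have cX: "card B < card X" "finite X" using fin
    by (simp_all add: X_def card_image)
  from nontrivial_solution[OF fin cX(2,1), of N] obtain c where
    c: "\<exists>x\<in>X. c x \<noteq> 0" "\<forall>y\<in>B. (\<Sum>x\<in>X. c x * N x y) = 0" by blast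
  have s: "(\<Sum>x\<in>X. c x * N x y) = c None * f y + (\<Sum>x\<in>B. c (Some x) * M x y)" for y
    using fin by (simp add: X_def N_def sum.reindex)
  have "c None \<noteq> 0"
  proof
    assume "c None = 0"
    then have "\<forall>x\<in>B. c (Some x) = 0" using ker[of "\<lambda>x. c (Some x)"] c(2) s by simp
    with \<open>c None = 0\<close> c(1) show False by (auto simp: X_def)
  qed
  moreover from this have "(\<Sum>x\<in>B. - c (Some x) / c None * M x y)
      = - (\<Sum>x\<in>B. c (Some x) * M x y) / c None" for y
    by (simp add: sum_negf sum_divide_distrib)
  moreover have "(\<Sum>x\<in>B. c (Some x) * M x y) = - (c None * f y)" if "y \<in> B" for y
    using c(2)[rule_format, OF that] s[of y] by (simp add: eq_neg_iff_add_eq_0 add.commute)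
  ultimately show ?thesis by (intro exI[of _ "\<lambda>x. - c (Some x) / c None"]) simp
qed

section \<open>Path algebras\<close>

notation Poly_Mapping.lookup (infixl "$$" 95)

abbreviation scl :: "'k::field \<Rightarrow> ('b \<Rightarrow>\<^sub>0 'k) \<Rightarrow> ('b \<Rightarrow>\<^sub>0 'k)" (infixr "\<bullet>" 75) where
  "c \<bullet> x \<equiv> Poly_Mapping.map ((*) c) x"

section \<open>Formal linear combinations: scalars, linear extension and coordinate
  projections\<close>

lemma lookup_scl [simp]: "(c \<bullet> x) $$ \<pi> = c * x $$ \<pi>"
  by transfer (auto simp: when_def)

lemma scl_simps [simp]:
  "0 \<bullet> x = 0" "1 \<bullet> x = x" "c \<bullet> 0 = 0" "c \<bullet> d \<bullet> x = (c * d) \<bullet> x"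
  by (auto intro!: poly_mapping_eqI)

lemma scl_distrib:
  "c \<bullet> (x + y) = c \<bullet> x + c \<bullet> y" "(c + d) \<bullet> x = c \<bullet> x + d \<bullet> x"
  "c \<bullet> (x - y) = c \<bullet> x - c \<bullet> y" "(c - d) \<bullet> x = c \<bullet> x - d \<bullet> x"
  "c \<bullet> (- x) = - (c \<bullet> x)" "(- c) \<bullet> x = - (c \<bullet> x)"
  by (auto intro!: poly_mapping_eqI simp: lookup_add lookup_minus algebra_simps)

lemma scl_sum: "c \<bullet> (\<Sum>i\<in>A. f i) = (\<Sum>i\<in>A. c \<bullet> f i)"
  by (auto intro!: poly_mapping_eqI simp: lookup_sum sum_distrib_left)

lemma scl_single [simp]: "c \<bullet> Poly_Mapping.single \<pi> d = Poly_Mapping.single \<pi> (c * d)"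
  by simp

lemma keys_scl: "Poly_Mapping.keys (c \<bullet> x) \<subseteq> Poly_Mapping.keys x"
  by (auto simp: in_keys_iff)

lemma keys_diff_subset: "Poly_Mapping.keys (x - y :: 'b \<Rightarrow>\<^sub>0 'k::field) \<subseteq> Poly_Mapping.keys x \<union> Poly_Mapping.keys y"
  by (auto simp: in_keys_iff lookup_minus)

lemma sum_keys_superset:
  assumes "finite A" "Poly_Mapping.keys x \<subseteq> A" "\<And>\<pi>. x $$ \<pi> = 0 \<Longrightarrow> f \<pi> = 0"
  shows "(\<Sum>\<pi>\<in>Poly_Mapping.keys x. f \<pi>) = (\<Sum>\<pi>\<in>A. f \<pi>)"
  using assms by (intro sum.mono_neutral_left) (auto simp: in_keys_iff)

lemma sum_single_keys: "(\<Sum>\<pi>\<in>Poly_Mapping.keys x. Poly_Mapping.single \<pi> (x $$ \<pi>)) = x"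
  by (rule poly_mapping_eqI)
    (auto simp: lookup_sum lookup_single when_def sum.delta' in_keys_iff)

text \<open>The addition case keeps track of the supports. This matters when \<open>A\<close> is a
  set of paths with prescribed ends or length: the summands are then known to be homogeneous or to
  lie in the path algebra.\<close>

lemma keys_span_induct [consumes 1, case_names zero single add]:
  fixes x :: "'b \<Rightarrow>\<^sub>0 'k::field"
  assumes "Poly_Mapping.keys x \<subseteq> A"
    and "P 0" and "\<And>\<pi> c. \<pi> \<in> A \<Longrightarrow> P (Poly_Mapping.single \<pi> c)"
    and "\<And>x y. Poly_Mapping.keys x \<subseteq> A \<Longrightarrow> Poly_Mapping.keys y \<subseteq> A \<Longrightarrow> P x \<Longrightarrow> P y \<Longrightarrow> P (x + y)"
  shows "P x"
proof -
  have "P (\<Sum>\<pi>\<in>S. Poly_Mapping.single \<pi> (x $$ \<pi>))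
      \<and> Poly_Mapping.keys (\<Sum>\<pi>\<in>S. Poly_Mapping.single \<pi> (x $$ \<pi>)) \<subseteq> A" if "finite S" "S \<subseteq> A" for S
    using that
  proof (induction S)
    case (insert \<pi> S)
    have k: "Poly_Mapping.keys (Poly_Mapping.single \<pi> (x $$ \<pi>)) \<subseteq> A" using insert by auto
    moreover have "Poly_Mapping.keys (u + v) \<subseteq> A" if "Poly_Mapping.keys u \<subseteq> A" "Poly_Mapping.keys v \<subseteq> A"
      for u v :: "'b \<Rightarrow>\<^sub>0 'k" using that keys_add[of u v] by blast
    ultimately show ?case using insert assms(3)[of \<pi>] assms(4) by simp
  qed (use assms(2) in auto)
  from this[of "Poly_Mapping.keys x"] assms(1) show ?thesis by (simp add: sum_single_keys)
qed

lemmas poly_mapping_lin_induct = keys_span_induct[OF subset_UNIV, case_names zero single add]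

definition lin :: "('b \<Rightarrow> 'c \<Rightarrow>\<^sub>0 'k::field) \<Rightarrow> ('b \<Rightarrow>\<^sub>0 'k) \<Rightarrow> ('c \<Rightarrow>\<^sub>0 'k)" where
  "lin f x = (\<Sum>\<pi>\<in>Poly_Mapping.keys x. x $$ \<pi> \<bullet> f \<pi>)"

definition linf :: "('b \<Rightarrow> 'k::field) \<Rightarrow> ('b \<Rightarrow>\<^sub>0 'k) \<Rightarrow> 'k" where
  "linf f x = (\<Sum>\<pi>\<in>Poly_Mapping.keys x. x $$ \<pi> * f \<pi>)"

lemma lin_superset: "finite A \<Longrightarrow> Poly_Mapping.keys x \<subseteq> A \<Longrightarrow> lin f x = (\<Sum>\<pi>\<in>A. x $$ \<pi> \<bullet> f \<pi>)"
  unfolding lin_def by (rule sum_keys_superset) auto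

lemma linf_superset: "finite A \<Longrightarrow> Poly_Mapping.keys x \<subseteq> A \<Longrightarrow> linf f x = (\<Sum>\<pi>\<in>A. x $$ \<pi> * f \<pi>)"
  unfolding linf_def by (rule sum_keys_superset) auto

lemma lin_0 [simp]: "lin f 0 = 0" and linf_0 [simp]: "linf g 0 = 0"
  by (auto simp: lin_def linf_def)

lemma lin_single [simp]: "lin f (Poly_Mapping.single \<pi> c) = c \<bullet> f \<pi>"
  by (subst lin_superset[of "{\<pi>}"]) auto

lemma linf_single [simp]: "linf f (Poly_Mapping.single \<pi> c) = c * f \<pi>"
  by (subst linf_superset[of "{\<pi>}"]) auto

lemma lin_add: "lin f (x + y) = lin f x + lin f y"
proof -
  let ?A = "Poly_Mapping.keys x \<union> Poly_Mapping.keys y"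
  have "finite ?A" "Poly_Mapping.keys (x + y) \<subseteq> ?A" using keys_add[of x y] by auto
  then show ?thesis
    by (simp add: lin_superset[of ?A] lookup_add scl_distrib sum.distrib)
qed

lemma linf_add: "linf f (x + y) = linf f x + linf f y"
proof -
  let ?A = "Poly_Mapping.keys x \<union> Poly_Mapping.keys y"
  have "finite ?A" "Poly_Mapping.keys (x + y) \<subseteq> ?A" using keys_add[of x y] by auto
  then show ?thesis
    by (simp add: linf_superset[of ?A] lookup_add distrib_right sum.distrib)
qed

lemma lin_scl: "lin f (c \<bullet> x) = c \<bullet> lin f x"
  unfolding lin_superset[OF finite_keys keys_scl] by (simp add: lin_def scl_sum)

lemma linf_scl: "linf f (c \<bullet> x) = c * linf f x"
  unfolding linf_superset[OF finite_keys keys_scl]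
  by (simp add: linf_def sum_distrib_left mult.assoc)

lemma lin_diff: "lin f (x - y) = lin f x - lin f y"
  using lin_add[of f x "- y"] lin_scl[of f "-1" y] by (simp add: scl_distrib)

lemma linf_diff: "linf f (x - y) = linf f x - linf f y"
  using linf_add[of f x "- y"] linf_scl[of f "-1" y] by (simp add: scl_distrib)

lemma lin_sum: "lin f (\<Sum>i\<in>A. g i) = (\<Sum>i\<in>A. lin f (g i))"
  by (induction A rule: infinite_finite_induct) (auto simp: lin_add)

lemma linf_sum: "linf f (\<Sum>i\<in>A. g i) = (\<Sum>i\<in>A. linf f (g i))"
  by (induction A rule: infinite_finite_induct) (auto simp: linf_add)

text \<open>One coordinate projection serves two purposes: with a condition on the length it is a
  graded component, with a condition on an end of the path it is multiplication by a vertex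
  idempotent.\<close>

definition restr :: "('b \<Rightarrow> bool) \<Rightarrow> ('b \<Rightarrow>\<^sub>0 'k::field) \<Rightarrow> ('b \<Rightarrow>\<^sub>0 'k)" where
  "restr P x = Poly_Mapping.mapp (\<lambda>\<pi> c. if P \<pi> then c else 0) x"

lemma lookup_restr [simp]: "restr P x $$ \<pi> = (if P \<pi> then x $$ \<pi> else 0)"
  by (auto simp: restr_def lookup_mapp when_def in_keys_iff)

lemma keys_restr: "Poly_Mapping.keys (restr P x) = {\<pi>\<in>Poly_Mapping.keys x. P \<pi>}"
  by (auto simp: in_keys_iff split: if_splits)

lemma restr_simps [simp]:
  "restr P 0 = 0" "restr P (Poly_Mapping.single \<pi> c) = (if P \<pi> then Poly_Mapping.single \<pi> c else 0)"
  by (auto intro!: poly_mapping_eqI simp: lookup_single when_def)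

lemma restr_add: "restr P (x + y) = restr P x + restr P y"
  and restr_diff: "restr P (x - y) = restr P x - restr P y"
  and restr_scl: "restr P (c \<bullet> x) = c \<bullet> restr P x"
  by (auto intro!: poly_mapping_eqI simp: lookup_add lookup_minus)

lemma restr_sum: "restr P (\<Sum>i\<in>A. f i) = (\<Sum>i\<in>A. restr P (f i))"
  by (induction A rule: infinite_finite_induct) (auto simp: restr_add)

lemma restr_id: "(\<And>\<pi>. \<pi> \<in> Poly_Mapping.keys x \<Longrightarrow> P \<pi>) \<Longrightarrow> restr P x = x"
  by (rule poly_mapping_eqI) (metis in_keys_iff lookup_restr)

lemma restr_eq_0: "(\<And>\<pi>. \<pi> \<in> Poly_Mapping.keys x \<Longrightarrow> \<not> P \<pi>) \<Longrightarrow> restr P x = 0"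
  by (rule poly_mapping_eqI) (metis in_keys_iff lookup_restr lookup_zero)

abbreviation hcomp :: "nat \<Rightarrow> (('v, 'a) path \<Rightarrow>\<^sub>0 'k::field) \<Rightarrow> (('v, 'a) path \<Rightarrow>\<^sub>0 'k)" where
  "hcomp t \<equiv> restr (\<lambda>\<pi>. path_length \<pi> = t)"

text \<open>A name for the record operation that hides the double sum, so that rewriting uses
  bilinearity and \<open>pcomp\<close>, the structure constants on paths.\<close>

definition pmul :: "('v, 'a) pre_digraph \<Rightarrow> (('v, 'a) path \<Rightarrow>\<^sub>0 'k::field) \<Rightarrow> (('v, 'a) path \<Rightarrow>\<^sub>0 'k) \<Rightarrow>
    (('v, 'a) path \<Rightarrow>\<^sub>0 'k)" where
  "pmul Q x y = x \<otimes>\<^bsub>path_algebra Q\<^esub> y"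

definition kpaths :: "('v, 'a) pre_digraph \<Rightarrow> (('v, 'a) path \<Rightarrow>\<^sub>0 'k::field) set" where
  "kpaths Q = carrier (path_algebra Q)"

definition pone :: "('v, 'a) pre_digraph \<Rightarrow> (('v, 'a) path \<Rightarrow>\<^sub>0 'k::field)" where
  "pone Q = \<one>\<^bsub>path_algebra Q\<^esub>"

lemma kpaths_iff: "x \<in> kpaths Q \<longleftrightarrow> Poly_Mapping.keys x \<subseteq> paths Q"
  by (simp add: kpaths_def path_algebra_def)

definition pcomp :: "('v, 'a) pre_digraph \<Rightarrow> ('v, 'a) path \<Rightarrow> ('v, 'a) path \<Rightarrow> (('v, 'a) path \<Rightarrow>\<^sub>0 'k::field)" where
  "pcomp Q \<pi> \<sigma> = (if path_end Q \<sigma> = fst \<pi> then path_elem (fst \<sigma>, snd \<sigma> @ snd \<pi>) else 0)"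

lemma pmul_lin: "pmul Q x y = lin (\<lambda>\<pi>. lin (\<lambda>\<sigma>. pcomp Q \<pi> \<sigma>) y) x"
  unfolding pmul_def path_algebra_def lin_def pcomp_def
  by (auto simp: scl_sum intro!: sum.cong)

lemma pmul_single:
  "pmul Q (Poly_Mapping.single \<pi> c) (Poly_Mapping.single \<sigma> d) = (c * d) \<bullet> pcomp Q \<pi> \<sigma>"
  by (simp add: pmul_lin)

lemma lin_add_fun: "lin (\<lambda>\<pi>. f \<pi> + g \<pi>) x = lin f x + lin g x"
  by (simp add: lin_def scl_distrib sum.distrib)

lemma lin_scl_fun: "lin (\<lambda>\<pi>. c \<bullet> f \<pi>) x = c \<bullet> lin f x"
  by (simp add: lin_def scl_sum mult.commute)

lemma lin_diff_fun: "lin (\<lambda>\<pi>. f \<pi> - g \<pi>) x = lin f x - lin g x"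
  by (simp add: lin_def scl_distrib sum_subtractf)

lemma lin_zero_fun [simp]: "lin (\<lambda>\<pi>. 0) x = 0"
  by (simp add: lin_def)

lemma pmul_add_left: "pmul Q (x + y) z = pmul Q x z + pmul Q y z"
  and pmul_add_right: "pmul Q z (x + y) = pmul Q z x + pmul Q z y"
  and pmul_diff_left: "pmul Q (x - y) z = pmul Q x z - pmul Q y z"
  and pmul_diff_right: "pmul Q z (x - y) = pmul Q z x - pmul Q z y"
  and pmul_scl_left: "pmul Q (c \<bullet> x) z = c \<bullet> pmul Q x z"
  and pmul_scl_right: "pmul Q z (c \<bullet> x) = c \<bullet> pmul Q z x"
  and pmul_0_left [simp]: "pmul Q 0 z = 0"
  and pmul_0_right [simp]: "pmul Q z 0 = 0"
  by (simp_all add: pmul_lin lin_add lin_diff lin_scl lin_add_fun lin_scl_fun lin_diff_fun)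

lemma pmul_sum_left: "pmul Q (\<Sum>i\<in>A. f i) z = (\<Sum>i\<in>A. pmul Q (f i) z)"
  by (simp add: pmul_lin lin_sum)

lemma pmul_sum_right: "pmul Q z (\<Sum>i\<in>A. f i) = (\<Sum>i\<in>A. pmul Q z (f i))"
  by (induction A rule: infinite_finite_induct) (auto simp: pmul_add_right)

lemmas pmul_distribs = pmul_add_left pmul_add_right pmul_diff_left pmul_diff_right
  pmul_scl_left pmul_scl_right

lemma path_end_append: "pre_digraph.awlast Q u (p @ q) = pre_digraph.awlast Q (pre_digraph.awlast Q u p) q"
  by (simp add: pre_digraph.awalk_verts_conv)

lemma path_end_snoc [simp]: "pre_digraph.awlast Q u (p @ [a]) = head Q a"
  by (simp add: pre_digraph.awalk_verts_conv)

lemma path_end_Nil [simp]: "pre_digraph.awlast Q u [] = u"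
  by (simp add: pre_digraph.awalk_verts.simps)

lemma path_end_Cons [simp]: "pre_digraph.awlast Q u (a # p) = pre_digraph.awlast Q (head Q a) p"
  by (simp add: pre_digraph.awalk_verts_conv)

lemma pmul_assoc: "pmul Q (pmul Q x y) z = pmul Q x (pmul Q y z)"
proof (induction x rule: poly_mapping_lin_induct)
  case (single \<pi> c)
  show ?case
  proof (induction y rule: poly_mapping_lin_induct)
    case (single \<sigma> d)
    show ?case
    proof (induction z rule: poly_mapping_lin_induct)
      case (single \<tau> e)
      show ?case
        by (auto simp: pmul_single pcomp_def path_end_append pmul_scl_left pmul_scl_right
            mult_ac)
    qed (auto simp: pmul_add_right)
  qed (auto simp: pmul_add_right pmul_add_left)
qed (auto simp: pmul_add_left)

lemma kpaths_closed [simp, intro]: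
  "0 \<in> kpaths Q"
  "x \<in> kpaths Q \<Longrightarrow> y \<in> kpaths Q \<Longrightarrow> x + y \<in> kpaths Q"
  "x \<in> kpaths Q \<Longrightarrow> y \<in> kpaths Q \<Longrightarrow> x - y \<in> kpaths Q"
  "x \<in> kpaths Q \<Longrightarrow> - x \<in> kpaths Q"
  "x \<in> kpaths Q \<Longrightarrow> c \<bullet> x \<in> kpaths Q"
  "x \<in> kpaths Q \<Longrightarrow> restr P x \<in> kpaths Q"
  "\<pi> \<in> paths Q \<Longrightarrow> Poly_Mapping.single \<pi> c \<in> kpaths Q"
  unfolding kpaths_iff
  using keys_add[of x y] keys_diff_subset[of x y] keys_scl[of c x]
  by (auto simp: keys_restr in_keys_iff lookup_add lookup_minus)

lemma kpaths_lookup: "x \<in> kpaths Q \<Longrightarrow> x $$ \<pi> \<noteq> 0 \<Longrightarrow> \<pi> \<in> paths Q"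
  by (auto simp: kpaths_iff in_keys_iff)

lemma kpaths_sum [intro]: "(\<And>i. i \<in> A \<Longrightarrow> f i \<in> kpaths Q) \<Longrightarrow> (\<Sum>i\<in>A. f i) \<in> kpaths Q"
  by (induction A rule: infinite_finite_induct) auto

lemma kpaths_induct [consumes 1, case_names zero single add]:
  assumes "x \<in> kpaths Q"
    and "P 0" and "\<And>\<pi> c. \<pi> \<in> paths Q \<Longrightarrow> P (Poly_Mapping.single \<pi> c)"
    and "\<And>x y. x \<in> kpaths Q \<Longrightarrow> y \<in> kpaths Q \<Longrightarrow> P x \<Longrightarrow> P y \<Longrightarrow> P (x + y)"
  shows "P x"
  using assms unfolding kpaths_iff by (rule keys_span_induct)

lemma lin_kpaths: "(\<And>\<pi>. \<pi> \<in> Poly_Mapping.keys x \<Longrightarrow> f \<pi> \<in> kpaths Q) \<Longrightarrow> lin f x \<in> kpaths Q"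
  by (auto simp: lin_def)

section \<open>Paths of a finite quiver and the unital path algebra\<close>

locale quiver = fin_digraph Q for Q :: "('v, 'a) pre_digraph"
begin

lemma path_from_to_iff: "path_from_to Q i j \<pi> \<longleftrightarrow> \<pi> \<in> paths Q \<and> fst \<pi> = i \<and> path_end Q \<pi> = j"
  unfolding paths_def path_from_to_def using awalkE by blast

lemma paths_Nil [simp]: "(u, []) \<in> paths Q \<longleftrightarrow> u \<in> verts Q"
  by (auto simp: paths_def path_from_to_def awalk_Nil_iff)

lemma paths_iff: "(u, p) \<in> paths Q \<longleftrightarrow> u \<in> verts Q \<and> set p \<subseteq> arcs Q \<and> cas u p (awlast u p)"
  unfolding paths_def path_from_to_def by (auto simp: awalk_def awlast_if_cas)

lemma paths_Cons: "(u, a # p) \<in> paths Q \<longleftrightarrow> a \<in> arcs Q \<and> u = tail Q a \<and> (head Q a, p) \<in> paths Q"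
  by (auto simp: paths_iff)

lemma paths_append: "(u, p @ q) \<in> paths Q \<longleftrightarrow> (u, p) \<in> paths Q \<and> (awlast u p, q) \<in> paths Q"
  by (induction p arbitrary: u) (auto simp: paths_Cons, auto simp: paths_iff)

lemma paths_single [simp]: "(u, [a]) \<in> paths Q \<longleftrightarrow> a \<in> arcs Q \<and> u = tail Q a"
  by (auto simp: paths_Cons)

lemma paths_snoc: "(u, p @ [a]) \<in> paths Q \<longleftrightarrow> (u, p) \<in> paths Q \<and> a \<in> arcs Q \<and> awlast u p = tail Q a"
  by (auto simp: paths_append)

lemma paths_verts: "\<pi> \<in> paths Q \<Longrightarrow> fst \<pi> \<in> verts Q" "\<pi> \<in> paths Q \<Longrightarrow> path_end Q \<pi> \<in> verts Q"
proof -
  assume a: "\<pi> \<in> paths Q"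
  obtain u p where \<pi>: "\<pi> = (u, p)" by fastforce
  show "fst \<pi> \<in> verts Q" using a \<pi> by (simp add: paths_iff)
  show "path_end Q \<pi> \<in> verts Q" using a \<pi> awlast_in_verts[of u p] by (simp add: paths_iff)
qed

lemma pcomp_kpaths: "\<pi> \<in> paths Q \<Longrightarrow> \<sigma> \<in> paths Q \<Longrightarrow> pcomp Q \<pi> \<sigma> \<in> kpaths Q"
  by (auto simp: pcomp_def paths_append intro!: kpaths_closed)

lemma pmul_closed [simp, intro]: "x \<in> kpaths Q \<Longrightarrow> y \<in> kpaths Q \<Longrightarrow> pmul Q x y \<in> kpaths Q"
  unfolding pmul_lin by (intro lin_kpaths pcomp_kpaths) (auto simp: kpaths_iff)

lemma pone_sum: "pone Q = (\<Sum>i\<in>verts Q. vertex_elem i)"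
  by (simp add: pone_def path_algebra_def)

lemma pone_closed [simp, intro]: "pone Q \<in> kpaths Q"
  unfolding pone_sum by auto

lemma vertex_mul: "x \<in> kpaths Q \<Longrightarrow> pmul Q (vertex_elem i) x = restr (\<lambda>\<pi>. path_end Q \<pi> = i) x"
  by (induction rule: kpaths_induct) (auto simp: pmul_single pcomp_def pmul_distribs restr_add)

lemma mul_vertex: "x \<in> kpaths Q \<Longrightarrow> pmul Q x (vertex_elem i) = restr (\<lambda>\<pi>. fst \<pi> = i) x"
  by (induction rule: kpaths_induct) (auto simp: pmul_single pcomp_def pmul_distribs restr_add)

lemma pone_mul [simp]: "x \<in> kpaths Q \<Longrightarrow> pmul Q (pone Q) x = x"
  unfolding pone_sum pmul_sum_left
  by (rule poly_mapping_eqI) (use kpaths_lookup paths_verts(2) in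
      \<open>force simp: vertex_mul lookup_sum sum.delta'\<close>)

lemma mul_pone [simp]: "x \<in> kpaths Q \<Longrightarrow> pmul Q x (pone Q) = x"
  unfolding pone_sum pmul_sum_right
  by (rule poly_mapping_eqI) (use kpaths_lookup paths_verts(1) in
      \<open>force simp: mul_vertex lookup_sum sum.delta'\<close>)

lemma path_snoc_mul:
  "(u, p @ [a]) \<in> paths Q \<Longrightarrow> path_elem (u, p @ [a]) = pmul Q (arrow_elem Q a) (path_elem (u, p))"
  by (auto simp: pmul_single pcomp_def paths_snoc)

lemma ring_path_algebra: "ring (path_algebra Q :: ('k::field, _) module)"
proof -
  have a: "add (path_algebra Q) = ((+) :: _ \<Rightarrow> (('v, 'a) path \<Rightarrow>\<^sub>0 'k) \<Rightarrow> _)"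
    "zero (path_algebra Q) = (0 :: ('v, 'a) path \<Rightarrow>\<^sub>0 'k)"
    by (auto simp: path_algebra_def)
  note [simp] = a kpaths_def[symmetric] pmul_def[symmetric] pone_def[symmetric]
  show ?thesis
  proof (rule ringI)
    show "abelian_group (path_algebra Q :: ('k, _) module)"
    proof (rule abelian_groupI)
      show "\<exists>y\<in>carrier (path_algebra Q). y \<oplus>\<^bsub>path_algebra Q\<^esub> x = \<zero>\<^bsub>path_algebra Q\<^esub>"
        if "x \<in> carrier (path_algebra Q :: ('k, _) module)" for x
        using that by (intro bexI[of _ "- x"]) auto
    qed (auto simp: ac_simps)
    show "Group.monoid (path_algebra Q :: ('k, _) module)"
      by (rule monoidI) (auto simp: pmul_assoc)
  qed (auto simp: pmul_distribs)
qed

end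

section \<open>Bound quiver algebras\<close>

lemma keys_pmul:
  assumes "\<kappa> \<in> Poly_Mapping.keys (pmul Q x y)"
  shows "\<exists>\<pi>\<in>Poly_Mapping.keys x. \<exists>\<sigma>\<in>Poly_Mapping.keys y.
    path_end Q \<sigma> = fst \<pi> \<and> \<kappa> = (fst \<sigma>, snd \<sigma> @ snd \<pi>)"
proof -
  have "(\<Sum>\<pi>\<in>Poly_Mapping.keys x. (x $$ \<pi> \<bullet> lin (\<lambda>\<sigma>. pcomp Q \<pi> \<sigma>) y) $$ \<kappa>) \<noteq> 0"
    using assms unfolding pmul_lin lin_def[of _ x] by (simp add: in_keys_iff lookup_sum)
  then obtain \<pi> where \<pi>: "\<pi> \<in> Poly_Mapping.keys x" "lin (\<lambda>\<sigma>. pcomp Q \<pi> \<sigma>) y $$ \<kappa> \<noteq> 0"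
    by (metis (no_types, lifting) lookup_scl mult_zero_right sum.not_neutral_contains_not_neutral)
  then have "(\<Sum>\<sigma>\<in>Poly_Mapping.keys y. (y $$ \<sigma> \<bullet> pcomp Q \<pi> \<sigma>) $$ \<kappa>) \<noteq> 0"
    unfolding lin_def by (simp add: lookup_sum)
  then obtain \<sigma> where "\<sigma> \<in> Poly_Mapping.keys y" "(pcomp Q \<pi> \<sigma> :: _ \<Rightarrow>\<^sub>0 'c) $$ \<kappa> \<noteq> 0"
    by (metis (no_types, lifting) lookup_scl mult_zero_right sum.not_neutral_contains_not_neutral)
  with \<pi> show ?thesis
    by (auto simp: pcomp_def lookup_single when_def split: if_splits)
qed

lemma hcomp_pmul_single_left:
  "hcomp t (pmul Q (Poly_Mapping.single \<pi> c) x) =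
    (if path_length \<pi> \<le> t then pmul Q (Poly_Mapping.single \<pi> c) (hcomp (t - path_length \<pi>) x) else 0)"
  by (induction x rule: poly_mapping_lin_induct)
    (auto simp: pmul_single pcomp_def pmul_distribs restr_add)

lemma hcomp_pmul_single_right:
  "hcomp t (pmul Q x (Poly_Mapping.single \<pi> c)) =
    (if path_length \<pi> \<le> t then pmul Q (hcomp (t - path_length \<pi>) x) (Poly_Mapping.single \<pi> c) else 0)"
  by (induction x rule: poly_mapping_lin_induct)
    (auto simp: pmul_single pcomp_def pmul_distribs restr_add)

section \<open>Relation ideals, homogeneous elements and the length filtration\<close>

definition rel_ideal :: "('v, 'a) pre_digraph \<Rightarrow> (('v, 'a) path \<Rightarrow>\<^sub>0 'k::field) set \<Rightarrow> (('v, 'a) path \<Rightarrow>\<^sub>0 'k) set" where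
  "rel_ideal Q \<rho> = Idl\<^bsub>path_algebra Q\<^esub> \<rho>"

definition homog :: "nat \<Rightarrow> (('v, 'a) path \<Rightarrow>\<^sub>0 'k::field) \<Rightarrow> bool" where
  "homog t x \<longleftrightarrow> (\<forall>\<pi>\<in>Poly_Mapping.keys x. path_length \<pi> = t)"

text \<open>In the path algebra, the power \<open>t\<close> of the arrow ideal. Once long paths
  vanish it represents the powers of the radical, the part of the grading that ungraded isomorphisms
  keep.\<close>

definition fil :: "nat \<Rightarrow> (('v, 'a) path \<Rightarrow>\<^sub>0 'k::field) \<Rightarrow> bool" where
  "fil t x \<longleftrightarrow> (\<forall>\<pi>\<in>Poly_Mapping.keys x. t \<le> path_length \<pi>)"

lemma homog_simps [simp, intro]:
  "homog t 0" "homog t x \<Longrightarrow> homog t y \<Longrightarrow> homog t (x + y)"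
  "homog t x \<Longrightarrow> homog t y \<Longrightarrow> homog t (x - y)"
  "homog t x \<Longrightarrow> homog t (c \<bullet> x)" "homog t x \<Longrightarrow> homog t (restr P x)" "homog t (hcomp t x)"
  unfolding homog_def using keys_add[of x y] keys_diff_subset[of x y] keys_scl[of c x]
  by (auto simp: keys_restr)

lemma homog_single: "homog (path_length \<pi>) (Poly_Mapping.single \<pi> c)"
  by (simp add: homog_def)

lemma homog_pmul: "homog s x \<Longrightarrow> homog t y \<Longrightarrow> homog (s + t) (pmul Q x y)"
  unfolding homog_def
proof
  fix \<kappa> assume x: "\<forall>\<pi>\<in>Poly_Mapping.keys x. path_length \<pi> = s"
    and y: "\<forall>\<pi>\<in>Poly_Mapping.keys y. path_length \<pi> = t"
    and "\<kappa> \<in> Poly_Mapping.keys (pmul Q x y)"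
  then obtain \<pi> \<sigma> where "\<pi> \<in> Poly_Mapping.keys x" "\<sigma> \<in> Poly_Mapping.keys y"
    "\<kappa> = (fst \<sigma>, snd \<sigma> @ snd \<pi>)" using keys_pmul by blast
  with x y show "path_length \<kappa> = s + t" by simp
qed

lemma fil_simps [simp, intro]:
  "fil t 0" "fil t x \<Longrightarrow> fil t y \<Longrightarrow> fil t (x + y)"
  "fil t x \<Longrightarrow> fil t y \<Longrightarrow> fil t (x - y)"
  "fil t x \<Longrightarrow> fil t (c \<bullet> x)" "fil t x \<Longrightarrow> fil t (restr P x)" "fil 0 x"
  unfolding fil_def using keys_add[of x y] keys_diff_subset[of x y] keys_scl[of c x]
  by (auto simp: keys_restr)

lemma fil_pmul: "fil s x \<Longrightarrow> fil t y \<Longrightarrow> fil (s + t) (pmul Q x y)"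
  unfolding fil_def
proof
  fix \<kappa> assume x: "\<forall>\<pi>\<in>Poly_Mapping.keys x. s \<le> path_length \<pi>"
    and y: "\<forall>\<pi>\<in>Poly_Mapping.keys y. t \<le> path_length \<pi>"
    and "\<kappa> \<in> Poly_Mapping.keys (pmul Q x y)"
  then obtain \<pi> \<sigma> where *: "\<pi> \<in> Poly_Mapping.keys x" "\<sigma> \<in> Poly_Mapping.keys y"
    "\<kappa> = (fst \<sigma>, snd \<sigma> @ snd \<pi>)" using keys_pmul by blast
  have "s \<le> path_length \<pi>" "t \<le> path_length \<sigma>" using x y * by auto
  with * show "s + t \<le> path_length \<kappa>" by simp
qed

lemma homog_fil: "homog t x \<Longrightarrow> s \<le> t \<Longrightarrow> fil s x"
  by (auto simp: homog_def fil_def)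

lemma fil_sum [intro]: "(\<And>i. i \<in> A \<Longrightarrow> fil t (f i)) \<Longrightarrow> fil t (\<Sum>i\<in>A. f i)"
  by (induction A rule: infinite_finite_induct) auto

lemma hcomp_homog: "homog t x \<Longrightarrow> hcomp t x = x"
  by (auto simp: homog_def intro!: restr_id)

lemma hcomp_homog_other: "homog t x \<Longrightarrow> s \<noteq> t \<Longrightarrow> hcomp s x = 0"
  by (auto simp: homog_def intro!: restr_eq_0)

lemma hcomp_fil: "fil t x \<Longrightarrow> s < t \<Longrightarrow> hcomp s x = 0"
  by (auto simp: fil_def intro!: restr_eq_0)

section \<open>The quotient by the relations, computed with representatives\<close>

locale bq = quiver Q for Q :: "('v, 'a) pre_digraph" +
  fixes \<rho> :: "(('v, 'a) path \<Rightarrow>\<^sub>0 'k::field) set"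
  assumes hbq: "homogeneous_bound_quiver Q \<rho>"
begin

abbreviation "I \<equiv> rel_ideal Q \<rho>"
abbreviation "K \<equiv> (kpaths Q :: (('v, 'a) path \<Rightarrow>\<^sub>0 'k) set)"
abbreviation mul (infixl "\<star>" 78) where "mul \<equiv> (pmul Q :: (('v, 'a) path \<Rightarrow>\<^sub>0 'k) \<Rightarrow> _)"
abbreviation eqv (infix "\<approx>" 50) where "x \<approx> y \<equiv> x - y \<in> I"
abbreviation cls where "cls \<equiv> path_class Q \<rho>"
abbreviation "BA \<equiv> bound_algebra Q \<rho>"
abbreviation ve :: "'v \<Rightarrow> ('v, 'a) path \<Rightarrow>\<^sub>0 'k" where "ve i \<equiv> vertex_elem i"
abbreviation pe :: "('v, 'a) path \<Rightarrow> _ \<Rightarrow>\<^sub>0 'k" where "pe \<pi> \<equiv> path_elem \<pi>"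

lemma rho_K: "\<rho> \<subseteq> K"
  and rho_fil: "r \<in> \<rho> \<Longrightarrow> fil 2 r"
  and rho_homog: "r \<in> \<rho> \<Longrightarrow> \<exists>t. homog t r"
proof -
  have 1: "\<forall>r\<in>\<rho>. \<forall>\<pi>\<in>Poly_Mapping.keys r. \<pi> \<in> paths Q \<and> 2 \<le> path_length \<pi>"
    and 2: "\<forall>r\<in>\<rho>. \<forall>\<pi>\<in>Poly_Mapping.keys r. \<forall>\<sigma>\<in>Poly_Mapping.keys r. path_length \<pi> = path_length \<sigma>"
    using hbq[unfolded homogeneous_bound_quiver_def bound_quiver_def] by blast+
  show "\<rho> \<subseteq> K" using 1 by (meson kpaths_iff subsetI)
  show "fil 2 r" if "r \<in> \<rho>" using 1 that by (meson fil_def)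
  show "\<exists>t. homog t r" if "r \<in> \<rho>" using 2 that unfolding homog_def by metis
qed

lemma ideal_I: "ideal I (path_algebra Q)"
  unfolding rel_ideal_def by (rule ring.genideal_ideal[OF ring_path_algebra])
    (use rho_K in \<open>simp add: kpaths_def\<close>)

lemma pa_simps [simp]:
  "carrier (path_algebra Q) = K" "\<zero>\<^bsub>path_algebra Q\<^esub> = (0 :: _ \<Rightarrow>\<^sub>0 'k)" "\<one>\<^bsub>path_algebra Q\<^esub> = (pone Q :: _ \<Rightarrow>\<^sub>0 'k)"
  "(x :: _ \<Rightarrow>\<^sub>0 'k) \<oplus>\<^bsub>path_algebra Q\<^esub> y = x + y" "x \<otimes>\<^bsub>path_algebra Q\<^esub> y = x \<star> y"
  "c \<odot>\<^bsub>path_algebra Q\<^esub> x = c \<bullet> x"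
  by (simp_all add: kpaths_def pone_def pmul_def) (simp_all add: path_algebra_def)

lemma I_left: "a \<in> K \<Longrightarrow> x \<in> I \<Longrightarrow> a \<star> x \<in> I"
  and I_right: "a \<in> K \<Longrightarrow> x \<in> I \<Longrightarrow> x \<star> a \<in> I"
  using ideal.I_l_closed[OF ideal_I, of x a] ideal.I_r_closed[OF ideal_I, of x a] by auto

lemma I_sub: "x \<in> I \<Longrightarrow> x \<in> K"
  using ideal.Icarr[OF ideal_I, of x] by simp

lemma I_0 [simp, intro]: "0 \<in> I"
  using additive_subgroup.zero_closed[OF ideal.axioms(1)[OF ideal_I]] by simp

lemma I_add [intro]: "x \<in> I \<Longrightarrow> y \<in> I \<Longrightarrow> x + y \<in> I"
  using additive_subgroup.a_closed[OF ideal.axioms(1)[OF ideal_I], of x y] by simp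

lemma I_scl [intro]: "x \<in> I \<Longrightarrow> c \<bullet> x \<in> I"
  using I_left[of "c \<bullet> pone Q" x] by (simp add: pmul_scl_left I_sub)

lemma I_neg [intro]: "x \<in> I \<Longrightarrow> - x \<in> I"
  using I_scl[of x "-1"] by (simp add: scl_distrib)

lemma I_diff [intro]: "x \<in> I \<Longrightarrow> y \<in> I \<Longrightarrow> x - y \<in> I"
  using I_add[of x "- y"] I_neg by simp

lemma I_sum [intro]: "(\<And>i. i \<in> A \<Longrightarrow> f i \<in> I) \<Longrightarrow> (\<Sum>i\<in>A. f i) \<in> I"
  by (induction A rule: infinite_finite_induct) auto

lemma I_gen: "r \<in> \<rho> \<Longrightarrow> r \<in> I"
  using ring.genideal_self[OF ring_path_algebra, of \<rho>] rho_K by (auto simp: rel_ideal_def)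

text \<open>Left multiplication by \<open>(-1) \<bullet> pone Q\<close> provides negatives, so the
  elements of \<open>K\<close> with the property form a two-sided ideal containing the generators,
  and the generated ideal is the least such.\<close>

lemma I_induct [consumes 1, case_names gen zero add left right]:
  assumes "x \<in> I" and gen: "\<And>r. r \<in> \<rho> \<Longrightarrow> P r" and z: "P 0"
    and add: "\<And>x y. x \<in> K \<Longrightarrow> y \<in> K \<Longrightarrow> P x \<Longrightarrow> P y \<Longrightarrow> P (x + y)"
    and left: "\<And>a x. a \<in> K \<Longrightarrow> x \<in> K \<Longrightarrow> P x \<Longrightarrow> P (a \<star> x)"
    and right: "\<And>a x. a \<in> K \<Longrightarrow> x \<in> K \<Longrightarrow> P x \<Longrightarrow> P (x \<star> a)"
  shows "P x"
proof -
  let ?J = "{x \<in> K. P x}"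
  have inv: "P (- x)" if "x \<in> K" "P x" for x
    using left[of "(-1) \<bullet> pone Q" x] that unfolding pmul_scl_left by (simp add: scl_distrib)
  have "ideal ?J (path_algebra Q)"
  proof (rule idealI[OF ring_path_algebra])
    show "subgroup ?J (add_monoid (path_algebra Q))"
    proof (rule group.subgroupI)
      show "Group.group (add_monoid (path_algebra Q :: ('k, _) module))"
        by (rule abelian_group.a_group[OF ring.is_abelian_group[OF ring_path_algebra]])
      fix a assume a: "a \<in> ?J"
      have "inv\<^bsub>add_monoid (path_algebra Q)\<^esub> a = - a"
        using abelian_group.minus_equality[OF ring.is_abelian_group[OF ring_path_algebra], of "- a" a] a
        by (simp add: a_inv_def)
      then show "inv\<^bsub>add_monoid (path_algebra Q)\<^esub> a \<in> ?J" using a inv by auto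
    qed (use z add in auto)
  qed (use left right in auto)
  then have "I \<subseteq> ?J"
    unfolding rel_ideal_def using gen rho_K
    by (intro ring.genideal_minimal[OF ring_path_algebra]) auto
  with assms(1) show ?thesis by auto
qed

text \<open>Multiplication by a single path only shifts degrees, so the condition that every
  component lies in the ideal passes to products; it holds for the generators as they are
  homogeneous. Hence the quotient is graded.\<close>

lemma I_hcomp [intro]: "x \<in> I \<Longrightarrow> hcomp t x \<in> I"
proof -
  assume "x \<in> I"
  then have "\<forall>t. hcomp t x \<in> I"
  proof (induction rule: I_induct)
    case (gen r)
    show ?case
    proof
      fix t
      obtain s where "homog s r" using rho_homog[OF gen] by auto
      then show "hcomp t r \<in> I"
        using I_gen[OF gen] by (cases "t = s") (simp_all add: hcomp_homog hcomp_homog_other)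
    qed
  next
    case (left a x)
    from left(1) show ?case
    proof (induction rule: kpaths_induct)
      case (single \<pi> c)
      then show ?case using left I_left by (auto simp: hcomp_pmul_single_left)
    qed (auto simp: pmul_distribs restr_add)
  next
    case (right a x)
    from right(1) show ?case
    proof (induction rule: kpaths_induct)
      case (single \<pi> c)
      then show ?case using right I_right by (auto simp: hcomp_pmul_single_right)
    qed (auto simp: pmul_distribs restr_add)
  qed (auto simp: restr_add)
  then show ?thesis by auto
qed

lemma I_fil: "x \<in> I \<Longrightarrow> fil 2 x"
proof (induction rule: I_induct)
  case (gen r)
  then show ?case by (rule rho_fil)
next
  case (left a x)
  have "fil (0 + 2) (a \<star> x)" using left by (intro fil_pmul) auto
  then show ?case by (simp only: add_0)
next
  case (right a x)
  have "fil (2 + 0) (x \<star> a)" using right by (intro fil_pmul) auto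
  then show ?case by (simp only: add_0_right)
qed auto

text \<open>Relations start in degree two, so the coefficients at vertices and arrows are constant
  on classes. Characters of the quotient and the count of its arrows are read from them.\<close>

lemma I_lookup: "x \<in> I \<Longrightarrow> path_length \<pi> \<le> 1 \<Longrightarrow> x $$ \<pi> = 0"
  using I_fil[of x] by (force simp: fil_def in_keys_iff)

lemma eqv_refl [simp]: "x \<approx> x" by simp
lemma eqv_sym: "x \<approx> y \<Longrightarrow> y \<approx> x" using I_neg[of "x - y"] by simp
lemma eqv_trans [trans]: "x \<approx> y \<Longrightarrow> y \<approx> z \<Longrightarrow> x \<approx> z" using I_add[of "x - y" "y - z"] by simp
lemma eqv_eq_trans [trans]: "x \<approx> y \<Longrightarrow> y = z \<Longrightarrow> x \<approx> z" "x = y \<Longrightarrow> y \<approx> z \<Longrightarrow> x \<approx> z" by auto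
lemma eqv_add: "x \<approx> y \<Longrightarrow> x' \<approx> y' \<Longrightarrow> x + x' \<approx> y + y'"
  using I_add[of "x - y" "x' - y'"] by (simp add: algebra_simps)
lemma eqv_scl: "x \<approx> y \<Longrightarrow> c \<bullet> x \<approx> c \<bullet> y"
  using I_scl[of "x - y" c] by (simp add: scl_distrib)
lemma eqv_sum: "(\<And>i. i \<in> A \<Longrightarrow> f i \<approx> g i) \<Longrightarrow> (\<Sum>i\<in>A. f i) \<approx> (\<Sum>i\<in>A. g i)"
  using I_sum[of A "\<lambda>i. f i - g i"] by (simp add: sum_subtractf)
lemma eqv_left: "a \<in> K \<Longrightarrow> x \<approx> y \<Longrightarrow> a \<star> x \<approx> a \<star> y"
  using I_left[of a "x - y"] by (simp add: pmul_distribs)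
lemma eqv_right: "a \<in> K \<Longrightarrow> x \<approx> y \<Longrightarrow> x \<star> a \<approx> y \<star> a"
  using I_right[of a "x - y"] by (simp add: pmul_distribs)
lemma eqv_I: "x \<approx> y \<Longrightarrow> x \<in> I \<longleftrightarrow> y \<in> I"
  using I_add[of "x - y" y] I_diff[of x "x - y"] by auto
lemma eqv_lookup: "x \<approx> y \<Longrightarrow> path_length \<pi> \<le> 1 \<Longrightarrow> x $$ \<pi> = y $$ \<pi>"
  using I_lookup[of "x - y" \<pi>] by (simp add: lookup_minus)
lemma eqv_hcomp: "x \<approx> y \<Longrightarrow> hcomp t x \<approx> hcomp t y"
  using I_hcomp[of "x - y" t] by (simp add: restr_diff)

lemma cls_def: "cls x = {y. y \<approx> x}"
  unfolding path_class_def rel_ideal_def[symmetric] a_r_coset_def'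
  by (auto simp: image_iff)

lemma cls_eq_iff: "cls x = cls y \<longleftrightarrow> x \<approx> y"
proof
  assume "cls x = cls y"
  then have "x \<in> {z. z \<approx> y}" using cls_def[of x] cls_def[of y] by auto
  then show "x \<approx> y" by simp
qed (auto simp: cls_def intro: eqv_trans eqv_sym)

lemma BA_simps:
  "carrier BA = cls ` K" "\<zero>\<^bsub>BA\<^esub> = cls 0" "\<one>\<^bsub>BA\<^esub> = cls (pone Q)"
proof -
  show "carrier BA = cls ` K"
    by (auto simp: bound_algebra_def ring.extend_def module.fields_def FactRing_def A_RCOSETS_def'
        path_class_def)
  show "\<zero>\<^bsub>BA\<^esub> = cls 0"
    by (auto simp: bound_algebra_def ring.extend_def module.fields_def FactRing_def cls_def
        rel_ideal_def[symmetric])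
  show "\<one>\<^bsub>BA\<^esub> = cls (pone Q)"
    by (auto simp: bound_algebra_def ring.extend_def module.fields_def FactRing_def path_class_def)
qed

lemma BA_add: "x \<in> K \<Longrightarrow> y \<in> K \<Longrightarrow> cls x \<oplus>\<^bsub>BA\<^esub> cls y = cls (x + y)"
  using abelian_subgroup.a_rcos_sum[OF abelian_subgroupI3[OF ideal.axioms(1)[OF ideal_I]
      ring.is_abelian_group[OF ring_path_algebra]], of x y]
  by (simp add: bound_algebra_def ring.extend_def module.fields_def FactRing_def path_class_def
      rel_ideal_def[symmetric])

lemma BA_mult: "x \<in> K \<Longrightarrow> y \<in> K \<Longrightarrow> cls x \<otimes>\<^bsub>BA\<^esub> cls y = cls (x \<star> y)"
  using ideal.rcoset_mult_add[OF ideal_I, of x y]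
  by (simp add: bound_algebra_def ring.extend_def module.fields_def FactRing_def path_class_def
      rel_ideal_def[symmetric])

lemma BA_smult: "x \<in> K \<Longrightarrow> c \<odot>\<^bsub>BA\<^esub> cls x = cls (c \<bullet> x)"
proof -
  have "c \<odot>\<^bsub>BA\<^esub> cls x = (\<Union>y\<in>cls x. cls (c \<bullet> y))"
    by (simp add: bound_algebra_def ring.extend_def module.fields_def)
  also have "\<dots> = (\<Union>y\<in>cls x. cls (c \<bullet> x))"
    by (intro SUP_cong) (auto simp: cls_eq_iff cls_def[of x] intro: eqv_scl)
  also have "\<dots> = cls (c \<bullet> x)"
  proof -
    have "x \<in> cls x" by (simp add: cls_def)
    then show ?thesis by auto
  qed
  finally show ?thesis .
qed

lemma cls_closed [simp, intro]: "x \<in> K \<Longrightarrow> cls x \<in> carrier BA"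
  by (simp add: BA_simps)

lemma cls_cases: assumes "z \<in> carrier BA" obtains x where "x \<in> K" "z = cls x"
  using assms by (auto simp: BA_simps)

lemma ring_BA: "ring BA"
proof (rule ringI)
  show "abelian_group BA"
  proof (rule abelian_groupI)
    fix x assume "x \<in> carrier BA"
    then obtain x' where "x' \<in> K" "x = cls x'" by (rule cls_cases)
    then show "\<exists>y\<in>carrier BA. y \<oplus>\<^bsub>BA\<^esub> x = \<zero>\<^bsub>BA\<^esub>"
      by (intro bexI[of _ "cls (- x')"]) (auto simp: BA_add BA_simps)
  qed (auto simp: BA_simps BA_add ac_simps)
  show "Group.monoid BA"
    by (rule monoidI) (auto simp: BA_simps BA_mult pmul_assoc)
qed (auto simp: BA_simps BA_mult BA_add pmul_distribs)

lemma BA_finsum: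
  assumes "finite B" "\<And>b. b \<in> B \<Longrightarrow> f b \<in> K"
  shows "(\<Oplus>\<^bsub>BA\<^esub>b\<in>B. c b \<odot>\<^bsub>BA\<^esub> cls (f b)) = cls (\<Sum>b\<in>B. c b \<bullet> f b)"
proof -
  interpret ring BA by (rule ring_BA)
  show ?thesis using assms
  proof (induction B)
    case empty
    then show ?case by (simp add: BA_simps)
  next
    case (insert b B)
    then have "(\<lambda>b. c b \<odot>\<^bsub>BA\<^esub> cls (f b)) \<in> B \<rightarrow> carrier BA" "c b \<odot>\<^bsub>BA\<^esub> cls (f b) \<in> carrier BA"
      by (auto simp: BA_smult)
    then have "(\<Oplus>\<^bsub>BA\<^esub>b\<in>insert b B. c b \<odot>\<^bsub>BA\<^esub> cls (f b))
        = c b \<odot>\<^bsub>BA\<^esub> cls (f b) \<oplus>\<^bsub>BA\<^esub> (\<Oplus>\<^bsub>BA\<^esub>b\<in>B. c b \<odot>\<^bsub>BA\<^esub> cls (f b))"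
      using insert by (intro finsum_insert) auto
    also have "\<dots> = cls (c b \<bullet> f b + (\<Sum>b\<in>B. c b \<bullet> f b))"
      using insert by (simp add: BA_smult BA_add kpaths_sum)
    finally show ?case using insert by simp
  qed
qed

lemma bound_path_iff: "bound_path Q \<rho> \<pi> \<longleftrightarrow> \<pi> \<in> paths Q \<and> pe \<pi> \<notin> I"
  by (simp add: bound_path_def BA_simps cls_eq_iff)

text \<open>As the ideal is homogeneous, bound paths of different lengths are linearly independent.\<close>

lemma bounded_lengths:
  fixes M :: "('v, 'a) path \<Rightarrow> 'y \<Rightarrow> 'k"
  assumes "finite Y"
    and dep: "\<And>X c. finite X \<Longrightarrow> X \<subseteq> paths Q \<Longrightarrow> \<forall>y\<in>Y. (\<Sum>\<pi>\<in>X. c \<pi> * M \<pi> y) = 0 \<Longrightarrow>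
      (\<Sum>\<pi>\<in>X. c \<pi> \<bullet> pe \<pi>) \<in> I"
  shows "\<exists>N. \<forall>\<pi>\<in>paths Q. N \<le> path_length \<pi> \<longrightarrow> pe \<pi> \<in> I"
proof (rule ccontr)
  assume "\<not> ?thesis"
  then have ex: "\<forall>N. \<exists>\<pi>\<in>paths Q. N \<le> path_length \<pi> \<and> pe \<pi> \<notin> I" by blast
  let ?L = "path_length ` {\<pi>\<in>paths Q. pe \<pi> \<notin> I}"
  have "infinite ?L"
    unfolding infinite_nat_iff_unbounded_le using ex by blast
  \<comment> \<open>One more length than there are columns, so that a dependency exists whatever the
    matrix is.\<close>
  then obtain T where T: "finite T" "card T = Suc (card Y)" "T \<subseteq> ?L"
    using infinite_arbitrarily_large by blast
  define g where "g = (\<lambda>t. SOME \<pi>. \<pi> \<in> paths Q \<and> pe \<pi> \<notin> I \<and> path_length \<pi> = t)"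
  have g: "g t \<in> paths Q \<and> pe (g t) \<notin> I \<and> path_length (g t) = t" if "t \<in> T" for t
    unfolding g_def by (rule someI_ex) (use T that in force)
  have inj: "inj_on g T" by (rule inj_onI) (metis g)
  have "card Y < card (g ` T)" using T inj by (simp add: card_image)
  from nontrivial_solution[OF assms(1) finite_imageI[OF T(1)] this, of M] obtain c where
    c: "\<exists>x\<in>g ` T. c x \<noteq> 0" "\<forall>y\<in>Y. (\<Sum>x\<in>g ` T. c x * M x y) = 0" by blast
  have "(\<Sum>\<pi>\<in>g ` T. c \<pi> \<bullet> pe \<pi>) \<in> I"
    using c(2) T g by (intro dep) auto
  then have s: "(\<Sum>t\<in>T. c (g t) \<bullet> pe (g t)) \<in> I" using inj by (simp add: sum.reindex)
  obtain t where t: "t \<in> T" "c (g t) \<noteq> 0" using c(1) by auto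
  have "hcomp t (\<Sum>t\<in>T. c (g t) \<bullet> pe (g t)) = (\<Sum>s\<in>T. if s = t then c (g t) \<bullet> pe (g t) else 0)"
    unfolding restr_sum restr_scl using g by (intro sum.cong) auto
  also have "\<dots> = c (g t) \<bullet> pe (g t)" using t T by simp
  finally have "c (g t) \<bullet> pe (g t) \<in> I" using I_hcomp[OF s, of t] by simp
  then have "pe (g t) \<in> I" using I_scl[of "c (g t) \<bullet> pe (g t)" "1 / c (g t)"] t by simp
  then show False using g t by auto
qed

text \<open>The matrix is formed by the coordinates of paths with respect to a finite spanning set;
  a dependency among its rows is a dependency in the quotient.\<close>

lemma finite_dimensional_bounded:
  assumes "finite_dimensional BA"
  shows "\<exists>N. \<forall>\<pi>\<in>paths Q. N \<le> path_length \<pi> \<longrightarrow> pe \<pi> \<in> I"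
proof -
  obtain B where B: "finite B" "B \<subseteq> carrier BA"
    "\<And>z. z \<in> carrier BA \<Longrightarrow> \<exists>c :: _ \<Rightarrow> 'k. z = (\<Oplus>\<^bsub>BA\<^esub>b\<in>B. c b \<odot>\<^bsub>BA\<^esub> b)"
    using assms unfolding finite_dimensional_def by auto
  define g where "g = (\<lambda>b. SOME x. x \<in> K \<and> b = cls x)"
  have g: "g b \<in> K \<and> b = cls (g b)" if "b \<in> B" for b
    unfolding g_def by (rule someI_ex) (use B that in \<open>auto simp: BA_simps\<close>)
  have ex: "\<exists>c. x \<approx> (\<Sum>b\<in>B. c b \<bullet> g b)" if x: "x \<in> K" for x
  proof -
    obtain c where c: "cls x = (\<Oplus>\<^bsub>BA\<^esub>b\<in>B. c b \<odot>\<^bsub>BA\<^esub> b)" using B(3)[OF cls_closed[OF x]] by auto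
    interpret ring BA by (rule ring_BA)
    have cl: "c b \<odot>\<^bsub>BA\<^esub> cls (g b) \<in> carrier BA" if "b \<in> B" for b
      using BA_smult[of "g b" "c b"] g[OF that] cls_closed[of "c b \<bullet> g b"] kpaths_closed(5)[of "g b" Q "c b"]
      by metis
    have "(\<Oplus>\<^bsub>BA\<^esub>b\<in>B. c b \<odot>\<^bsub>BA\<^esub> b) = (\<Oplus>\<^bsub>BA\<^esub>b\<in>B. c b \<odot>\<^bsub>BA\<^esub> cls (g b))"
    proof (intro finsum_cong' refl)
      show "(\<lambda>b. c b \<odot>\<^bsub>BA\<^esub> cls (g b)) \<in> B \<rightarrow> carrier BA" using cl by auto
      show "c b \<odot>\<^bsub>BA\<^esub> b = c b \<odot>\<^bsub>BA\<^esub> cls (g b)" if "b \<in> B" for b using g[OF that] by metis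
    qed
    then have "cls x = cls (\<Sum>b\<in>B. c b \<bullet> g b)" using c g B(1) by (simp add: BA_finsum)
    then show ?thesis by (auto simp: cls_eq_iff)
  qed
  define M where "M = (\<lambda>\<pi>. SOME c. pe \<pi> \<approx> (\<Sum>b\<in>B. c b \<bullet> g b))"
  have M: "pe \<pi> \<approx> (\<Sum>b\<in>B. M \<pi> b \<bullet> g b)" if "\<pi> \<in> paths Q" for \<pi>
    unfolding M_def using someI_ex[OF ex[of "pe \<pi>"]] that by auto
  show ?thesis
  proof (rule bounded_lengths[OF B(1), of M])
    fix X and c :: "_ \<Rightarrow> 'k"
    assume X: "finite X" "X \<subseteq> paths Q" "\<forall>y\<in>B. (\<Sum>\<pi>\<in>X. c \<pi> * M \<pi> y) = 0"
    have "(\<Sum>\<pi>\<in>X. c \<pi> \<bullet> pe \<pi>) \<approx> (\<Sum>\<pi>\<in>X. c \<pi> \<bullet> (\<Sum>b\<in>B. M \<pi> b \<bullet> g b))"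
      using X M by (intro eqv_sum eqv_scl) auto
    also have "(\<Sum>\<pi>\<in>X. c \<pi> \<bullet> (\<Sum>b\<in>B. M \<pi> b \<bullet> g b)) = (\<Sum>b\<in>B. \<Sum>\<pi>\<in>X. (c \<pi> * M \<pi> b) \<bullet> g b)"
      by (subst sum.swap) (simp add: scl_sum)
    also have "\<dots> = (\<Sum>b\<in>B. (\<Sum>\<pi>\<in>X. c \<pi> * M \<pi> b) \<bullet> g b)"
      by (intro sum.cong refl poly_mapping_eqI) (simp add: lookup_sum sum_distrib_right)
    also have "\<dots> = 0" using X(3) by simp
    finally show "(\<Sum>\<pi>\<in>X. c \<pi> \<bullet> pe \<pi>) \<in> I" by simp
  qed
qed

end

lemma bqI: "homogeneous_bound_quiver Q \<rho> \<Longrightarrow> bq Q \<rho>"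
  by (simp add: bq_def quiver_def bq_axioms_def)
    (unfold homogeneous_bound_quiver_def bound_quiver_def, blast)

section \<open>Stable bound quivers\<close>

lemma map_zero_id [simp]: "Poly_Mapping.map (\<lambda>a. 0) x = 0" "Poly_Mapping.map (\<lambda>a. a) x = x"
  by (transfer, force simp: when_def)+

context bq
begin

lemma long_paths_vanish:
  assumes "\<And>\<pi>. \<pi> \<in> paths Q \<Longrightarrow> m < path_length \<pi> \<Longrightarrow> pe \<pi> \<in> I"
  shows "x \<in> K \<Longrightarrow> fil (Suc m) x \<Longrightarrow> x \<in> I"
    and "x \<in> K \<Longrightarrow> fil m x \<Longrightarrow> x \<approx> hcomp m x"
proof -
  show 1: "x \<in> I" if x: "x \<in> K" "fil (Suc m) x" for x
  proof -
    have "x $$ \<pi> \<bullet> pe \<pi> \<in> I" if "\<pi> \<in> Poly_Mapping.keys x" for \<pi>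
    proof -
      have "\<pi> \<in> paths Q" "m < path_length \<pi>" using x that by (auto simp: fil_def kpaths_iff Suc_le_eq)
      then show ?thesis by (intro I_scl assms)
    qed
    then have "(\<Sum>\<pi>\<in>Poly_Mapping.keys x. x $$ \<pi> \<bullet> pe \<pi>) \<in> I" by (rule I_sum)
    then show ?thesis by (simp add: sum_single_keys)
  qed
  show "x \<approx> hcomp m x" if "x \<in> K" "fil m x"
  proof (rule 1)
    have "Suc m \<le> path_length \<pi>" if k: "\<pi> \<in> Poly_Mapping.keys (x - hcomp m x)" for \<pi>
    proof -
      have *: "\<pi> \<in> Poly_Mapping.keys x" "path_length \<pi> \<noteq> m"
        using k by (auto simp: in_keys_iff lookup_minus split: if_splits)
      then have "m \<le> path_length \<pi>" using \<open>fil m x\<close> by (auto simp: fil_def)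
      with * show ?thesis by simp
    qed
    then show "fil (Suc m) (x - hcomp m x)" by (simp add: fil_def)
  qed (use that in auto)
qed

lemma path_Cons_mul:
  assumes "(u, a # q) \<in> paths Q"
  shows "pe (u, a # q) = pe (head Q a, q) \<star> arrow_elem Q a"
  using assms by (auto simp: pmul_single pcomp_def paths_Cons)

text \<open>A nontrivial path acts through its first arrow, which already kills \<open>s\<close>;
  among the trivial paths only the one at \<open>i\<close> fixes it. So the algebra acts on the line
  of \<open>s\<close> by the character at \<open>i\<close>.\<close>

lemma simple_action:
  assumes s: "s \<in> K" "i \<in> verts Q" "ve i \<star> s \<approx> s" "\<And>a. a \<in> arcs Q \<Longrightarrow> arrow_elem Q a \<star> s \<in> I"
    and "x \<in> K"
  shows "x \<star> s \<approx> x $$ (i, []) \<bullet> s"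
  using assms(5)
proof (induction rule: kpaths_induct)
  case (single \<pi> c)
  obtain u q where \<pi>: "\<pi> = (u, q)" by fastforce
  have "pe \<pi> \<star> s \<approx> (if \<pi> = (i, []) then s else 0)"
  proof (cases q)
    case Nil
    show ?thesis
    proof (cases "u = i")
      case True
      then show ?thesis using s \<pi> Nil by simp
    next
      case False
      have "ve u \<star> s \<approx> ve u \<star> (ve i \<star> s)"
        using single \<pi> Nil s by (intro eqv_left eqv_sym[OF s(3)]) auto
      also have "ve u \<star> (ve i \<star> s) = 0"
        using False by (simp add: pmul_assoc[symmetric] pmul_single pcomp_def)
      finally show ?thesis using \<pi> Nil False by simp
    qed
  next
    case (Cons a r)
    then have "pe \<pi> \<star> s = pe (head Q a, r) \<star> (arrow_elem Q a \<star> s)"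
      using path_Cons_mul[of u a r] single \<pi> by (simp add: pmul_assoc)
    then show ?thesis using s(4)[of a] single \<pi> Cons
      by (auto simp: paths_Cons intro!: I_left)
  qed
  then have "c \<bullet> (pe \<pi> \<star> s) \<approx> c \<bullet> (if \<pi> = (i, []) then s else 0)" by (rule eqv_scl)
  then show ?case
    using pmul_scl_left[of Q c "pe \<pi>" s] by (auto simp: lookup_single when_def split: if_splits)
next
  case (add x y)
  then show ?case using eqv_add[of "x \<star> s" "x $$ (i, []) \<bullet> s" "y \<star> s" "y $$ (i, []) \<bullet> s"]
    by (simp add: pmul_distribs lookup_add scl_distrib)
qed auto

text \<open>These are test modules for injectivity: only the carrier of the regular module is
  changed, so that the inclusion is visibly a homomorphism. Negatives come from multiplication by
  minus one.\<close>

lemma left_module_left_ideal: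
  assumes N: "N \<subseteq> carrier BA" "\<zero>\<^bsub>BA\<^esub> \<in> N"
    and add: "\<And>x y. x \<in> N \<Longrightarrow> y \<in> N \<Longrightarrow> x \<oplus>\<^bsub>BA\<^esub> y \<in> N"
    and mult: "\<And>a x. a \<in> carrier BA \<Longrightarrow> x \<in> N \<Longrightarrow> a \<otimes>\<^bsub>BA\<^esub> x \<in> N"
  shows "left_module BA (regular_module BA\<lparr>carrier := N\<rparr>)"
proof -
  interpret R: ring BA by (rule ring_BA)
  have Nc: "x \<in> carrier BA" if "x \<in> N" for x using N that by auto
  have "abelian_group (regular_module BA\<lparr>carrier := N\<rparr>)"
  proof (rule abelian_groupI)
    fix x assume "x \<in> carrier (regular_module BA\<lparr>carrier := N\<rparr>)"
    then have x: "x \<in> N" by simp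
    have "(\<ominus>\<^bsub>BA\<^esub> \<one>\<^bsub>BA\<^esub>) \<otimes>\<^bsub>BA\<^esub> x \<in> N" using x by (intro mult) auto
    moreover have "(\<ominus>\<^bsub>BA\<^esub> \<one>\<^bsub>BA\<^esub>) \<otimes>\<^bsub>BA\<^esub> x \<oplus>\<^bsub>BA\<^esub> x = \<zero>\<^bsub>BA\<^esub>"
      using Nc[OF x] by (simp add: R.l_minus R.l_neg)
    ultimately show "\<exists>y\<in>carrier (regular_module BA\<lparr>carrier := N\<rparr>).
        y \<oplus>\<^bsub>regular_module BA\<lparr>carrier := N\<rparr>\<^esub> x = \<zero>\<^bsub>regular_module BA\<lparr>carrier := N\<rparr>\<^esub>"
      by (auto simp: regular_module_def)
  qed (simp_all add: regular_module_def R.a_ac Nc add N(2))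
  then show ?thesis
    unfolding left_module_def left_module_axioms_def
    using ring_BA mult Nc by (auto simp: regular_module_def R.l_distr R.r_distr R.m_assoc)
qed

end

section \<open>Top degree and socle of a stable bound quiver algebra\<close>

locale stable_bq = bq Q \<rho> for Q :: "('v, 'a) pre_digraph" and \<rho> :: "(('v, 'a) path \<Rightarrow>\<^sub>0 'k::field) set" +
  fixes \<tau> :: "'v \<Rightarrow> 'v" and l :: nat and p :: "'v \<Rightarrow> ('v, 'a) path"
  assumes l_pos: "1 \<le> l"
    and stable: "stable_bound_quiver (l + 1) Q \<rho> \<tau>"
    and fd: "finite_dimensional (bound_algebra Q \<rho>)"
    and si: "self_injective (bound_algebra Q \<rho>)"
    and p: "\<And>i. i \<in> verts Q \<Longrightarrow> maximal_bound_path Q \<rho> (p i) \<and> path_from_to Q (\<tau> i) i (p i)"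
begin

lemma stable':
  "bij_betw \<tau> (verts Q) (verts Q)"
  "maximal_bound_path Q \<rho> \<pi> \<Longrightarrow> path_length \<pi> = l"
  "i \<in> verts Q \<Longrightarrow> bound_path Q \<rho> \<pi> \<Longrightarrow> path_length \<pi> = l \<Longrightarrow> fst \<pi> = \<tau> i \<Longrightarrow> path_end Q \<pi> = i"
  "maximal_bound_path Q \<rho> \<pi> \<Longrightarrow> maximal_bound_path Q \<rho> \<sigma> \<Longrightarrow> fst \<pi> = fst \<sigma> \<Longrightarrow>
    \<exists>c d :: 'k. (c, d) \<noteq> (0, 0) \<and> c \<bullet> pe \<pi> + d \<bullet> pe \<sigma> \<in> I"
proof -
  from stable[unfolded stable_bound_quiver_def]
  have 1: "bij_betw \<tau> (verts Q) (verts Q)"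
    and 2: "\<forall>\<pi>. maximal_bound_path Q \<rho> \<pi> \<longrightarrow> path_length \<pi> = l"
    and 3: "\<forall>i\<in>verts Q. \<not> (\<exists>\<pi> j. j \<noteq> i \<and> bound_path Q \<rho> \<pi> \<and> path_length \<pi> = l \<and> path_from_to Q (\<tau> i) j \<pi>)"
    and 4: "\<forall>\<pi> \<sigma>. maximal_bound_path Q \<rho> \<pi> \<and> maximal_bound_path Q \<rho> \<sigma> \<and> fst \<pi> = fst \<sigma> \<longrightarrow>
          (\<exists>c d :: 'k. (c, d) \<noteq> (0, 0) \<and>
             c \<odot>\<^bsub>BA\<^esub> cls (pe \<pi>) \<oplus>\<^bsub>BA\<^esub> d \<odot>\<^bsub>BA\<^esub> cls (pe \<sigma>) = \<zero>\<^bsub>BA\<^esub>)"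
    by auto
  show "bij_betw \<tau> (verts Q) (verts Q)" by (rule 1)
  show "maximal_bound_path Q \<rho> \<pi> \<Longrightarrow> path_length \<pi> = l" using 2 by blast
  show "i \<in> verts Q \<Longrightarrow> bound_path Q \<rho> \<pi> \<Longrightarrow> path_length \<pi> = l \<Longrightarrow> fst \<pi> = \<tau> i \<Longrightarrow> path_end Q \<pi> = i"
    using 3 unfolding path_from_to_iff bound_path_iff by metis
  assume m: "maximal_bound_path Q \<rho> \<pi>" "maximal_bound_path Q \<rho> \<sigma>" "fst \<pi> = fst \<sigma>"
  then obtain c d :: 'k where cd: "(c, d) \<noteq> (0, 0)"
    "c \<odot>\<^bsub>BA\<^esub> cls (pe \<pi>) \<oplus>\<^bsub>BA\<^esub> d \<odot>\<^bsub>BA\<^esub> cls (pe \<sigma>) = \<zero>\<^bsub>BA\<^esub>"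
    using 4 by blast
  have "\<pi> \<in> paths Q" "\<sigma> \<in> paths Q" using m by (auto simp: maximal_bound_path_def bound_path_iff)
  then have "c \<odot>\<^bsub>BA\<^esub> cls (pe \<pi>) \<oplus>\<^bsub>BA\<^esub> d \<odot>\<^bsub>BA\<^esub> cls (pe \<sigma>) = cls (c \<bullet> pe \<pi> + d \<bullet> pe \<sigma>)"
    by (simp add: BA_smult BA_add del: scl_single map_single)
  with cd(2) have "cls (c \<bullet> pe \<pi> + d \<bullet> pe \<sigma>) = cls 0" by (simp only: BA_simps)
  then have "c \<bullet> pe \<pi> + d \<bullet> pe \<sigma> \<in> I" by (simp only: cls_eq_iff diff_0_right)
  with cd(1) show "\<exists>c d :: 'k. (c, d) \<noteq> (0, 0) \<and> c \<bullet> pe \<pi> + d \<bullet> pe \<sigma> \<in> I" by blast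
qed

lemma tau_verts [simp]: "i \<in> verts Q \<Longrightarrow> \<tau> i \<in> verts Q"
  using stable'(1) by (auto simp: bij_betw_def)

lemma tau_inj: "i \<in> verts Q \<Longrightarrow> j \<in> verts Q \<Longrightarrow> \<tau> i = \<tau> j \<longleftrightarrow> i = j"
  using stable'(1) by (auto simp: bij_betw_def inj_on_eq_iff)

lemma tau_surj: "j \<in> verts Q \<Longrightarrow> \<exists>i\<in>verts Q. \<tau> i = j"
  using stable'(1) by (metis bij_betw_def imageE)

text \<open>A longest bound path among those longer than \<open>l\<close> would be maximal, against
  the common length of maximal bound paths. That a longest one exists is where finite dimension
  enters.\<close>

lemma long_path_I: "\<pi> \<in> paths Q \<Longrightarrow> l < path_length \<pi> \<Longrightarrow> pe \<pi> \<in> I"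
proof (rule ccontr)
  assume \<pi>: "\<pi> \<in> paths Q" "l < path_length \<pi>" "pe \<pi> \<notin> I"
  obtain N where N: "\<forall>\<pi>\<in>paths Q. N \<le> path_length \<pi> \<longrightarrow> pe \<pi> \<in> I"
    using finite_dimensional_bounded[OF fd] by auto
  let ?P = "\<lambda>\<kappa>. bound_path Q \<rho> \<kappa> \<and> l < path_length \<kappa>"
  have "?P \<pi>" using \<pi> by (simp add: bound_path_iff)
  moreover have "\<forall>\<kappa>. ?P \<kappa> \<longrightarrow> path_length \<kappa> < N"
    using N by (meson bound_path_iff not_le_imp_less)
  ultimately obtain \<kappa> where \<kappa>: "?P \<kappa>" "\<forall>y. ?P y \<longrightarrow> path_length y \<le> path_length \<kappa>"
    using ex_has_greatest_nat[of ?P \<pi> path_length N] by blast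
  have "maximal_bound_path Q \<rho> \<kappa>"
    unfolding maximal_bound_path_def
  proof (intro conjI allI impI)
    show "bound_path Q \<rho> \<kappa>" using \<kappa> by simp
    fix u q r assume "path_end Q (u, q) = fst \<kappa> \<and> bound_path Q \<rho> (u, q @ snd \<kappa> @ r)"
    then have "path_length (u, q @ snd \<kappa> @ r) \<le> path_length \<kappa>" using \<kappa> by (intro \<kappa>(2)[rule_format]) auto
    then show "q = []" "r = []" by auto
  qed
  then have "path_length \<kappa> = l" by (rule stable'(2))
  with \<kappa>(1) show False by simp
qed

lemmas long_I = long_paths_vanish[of l, OF long_path_I]

lemma maximal_bound_pathI:
  assumes "bound_path Q \<rho> \<pi>" "path_length \<pi> = l"
  shows "maximal_bound_path Q \<rho> \<pi>"
  unfolding maximal_bound_path_def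
proof (intro conjI allI impI)
  fix u q r assume "path_end Q (u, q) = fst \<pi> \<and> bound_path Q \<rho> (u, q @ snd \<pi> @ r)"
  then have "path_length (u, q @ snd \<pi> @ r) \<le> l"
    by (meson bound_path_iff long_path_I not_le_imp_less)
  then show "q = []" "r = []" using assms by auto
qed fact

lemma p_props:
  assumes "i \<in> verts Q"
  shows "p i \<in> paths Q" "fst (p i) = \<tau> i" "path_end Q (p i) = i" "path_length (p i) = l" "pe (p i) \<notin> I"
    "bound_path Q \<rho> (p i)"
  using p[OF assms] stable'(2)[of "p i"]
  by (auto simp: path_from_to_iff maximal_bound_path_def bound_path_iff)

lemma p_scl_I: "i \<in> verts Q \<Longrightarrow> c \<bullet> pe (p i) \<in> I \<Longrightarrow> c = 0"
  using I_scl[of "c \<bullet> pe (p i)" "1 / c"] p_props(5)[of i] by (cases "c = 0") auto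

lemma p_scl_eqv: "i \<in> verts Q \<Longrightarrow> c \<bullet> pe (p i) \<approx> d \<bullet> pe (p i) \<Longrightarrow> c = d"
  using p_scl_I[of i "c - d"] by (simp add: scl_distrib single_diff)

text \<open>The value of \<eta> on a path, relative to the chosen path with the same end vertex; it
  is unique because the chosen paths are nonzero in the quotient. The default 0 in other degrees
  makes its linear extension a functional on the whole path algebra.\<close>

definition top_coeff :: "('v, 'a) path \<Rightarrow> 'k" where
  "top_coeff \<pi> = (if \<pi> \<in> paths Q \<and> path_length \<pi> = l then SOME c. pe \<pi> \<approx> c \<bullet> pe (p (path_end Q \<pi>)) else 0)"

text \<open>As \<tau> is onto, the path starts at \<open>\<tau> i\<close> for some \<open>i\<close>,
  and a bound path of length \<open>l\<close> from there can end only at \<open>i\<close>.\<close>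

lemma top_path_I: "\<pi> \<in> paths Q \<Longrightarrow> path_length \<pi> = l \<Longrightarrow> fst \<pi> \<noteq> \<tau> (path_end Q \<pi>) \<Longrightarrow> pe \<pi> \<in> I"
proof (rule ccontr)
  assume \<pi>: "\<pi> \<in> paths Q" "path_length \<pi> = l" "fst \<pi> \<noteq> \<tau> (path_end Q \<pi>)" "pe \<pi> \<notin> I"
  obtain i where "i \<in> verts Q" "\<tau> i = fst \<pi>" using tau_surj[OF paths_verts(1)[OF \<pi>(1)]] by auto
  then show False using stable'(3)[of i \<pi>] \<pi> by (auto simp: bound_path_iff)
qed

text \<open>Two maximal bound paths with the same start are dependent, and the coefficient of \<pi>
  in the dependency is nonzero because the chosen path is not in the ideal; dividing by it gives the
  scalar.\<close>

lemma top_coeff_eqv: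
  assumes "\<pi> \<in> paths Q" "path_length \<pi> = l"
  shows "pe \<pi> \<approx> top_coeff \<pi> \<bullet> pe (p (path_end Q \<pi>))"
proof -
  let ?i = "path_end Q \<pi>"
  have i: "?i \<in> verts Q" using paths_verts assms by auto
  have "\<exists>c. pe \<pi> \<approx> c \<bullet> pe (p ?i)"
  proof (cases "pe \<pi> \<in> I")
    case True
    then show ?thesis by (intro exI[of _ 0]) simp
  next
    case False
    then have f: "fst \<pi> = \<tau> ?i" using top_path_I assms by blast
    have "maximal_bound_path Q \<rho> \<pi>" using assms False by (intro maximal_bound_pathI) (auto simp: bound_path_iff)
    moreover have "maximal_bound_path Q \<rho> (p ?i)" using p i by blast
    ultimately obtain c d where cd: "(c, d) \<noteq> (0, 0)" "c \<bullet> pe \<pi> + d \<bullet> pe (p ?i) \<in> I"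
      using stable'(4)[of \<pi> "p ?i"] f p_props(2)[OF i] by auto
    have "c \<noteq> 0"
    proof
      assume "c = 0"
      then show False using cd p_scl_I[OF i, of d] by auto
    qed
    then have "pe \<pi> \<approx> (- d / c) \<bullet> pe (p ?i)"
      using I_scl[OF cd(2), of "1 / c"] by (simp add: scl_distrib single_uminus)
    then show ?thesis by blast
  qed
  from someI_ex[OF this] show ?thesis using assms by (simp add: top_coeff_def)
qed

lemma top_coeff_eq_0: "\<not> (path_length \<pi> = l \<and> fst \<pi> = \<tau> (path_end Q \<pi>)) \<Longrightarrow> top_coeff \<pi> = 0"
proof (cases "\<pi> \<in> paths Q \<and> path_length \<pi> = l")
  case True
  assume "\<not> (path_length \<pi> = l \<and> fst \<pi> = \<tau> (path_end Q \<pi>))"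
  then have "pe \<pi> \<in> I" using True top_path_I by auto
  then have "top_coeff \<pi> \<bullet> pe (p (path_end Q \<pi>)) \<in> I" using top_coeff_eqv[of \<pi>] True eqv_I by blast
  then show ?thesis using p_scl_I paths_verts True by blast
qed (auto simp: top_coeff_def)

lemma top_coeff_p: "i \<in> verts Q \<Longrightarrow> top_coeff (p i) = 1"
  using top_coeff_eqv[of "p i"] p_props[of i] p_scl_eqv[of i 1 "top_coeff (p i)"] by simp

text \<open>The sum of all \<open>\<eta>\<^sub>i\<close>, extended by zero to the lower degrees and lifted to the path algebra.\<close>

definition theta :: "(('v, 'a) path \<Rightarrow>\<^sub>0 'k) \<Rightarrow> 'k" where "theta = linf top_coeff"

lemma theta_linear:
  "theta (x + y) = theta x + theta y" "theta (x - y) = theta x - theta y" "theta (c \<bullet> x) = c * theta x"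
  "theta 0 = 0" "theta (\<Sum>i\<in>A. f i) = (\<Sum>i\<in>A. theta (f i))"
  "theta (Poly_Mapping.single \<pi> c) = c * top_coeff \<pi>"
  by (simp_all add: theta_def linf_add linf_diff linf_scl linf_sum)

lemma theta_p: "i \<in> verts Q \<Longrightarrow> theta (pe (p i)) = 1"
  by (simp add: theta_linear top_coeff_p)

lemma theta_hcomp: "theta (hcomp l x) = theta x"
  by (induction x rule: poly_mapping_lin_induct) (auto simp: theta_linear restr_add top_coeff_eq_0)

lemma theta_top:
  assumes "x \<in> K" "homog l x" "\<And>\<pi>. \<pi> \<in> Poly_Mapping.keys x \<Longrightarrow> path_end Q \<pi> = i"
  shows "x \<approx> theta x \<bullet> pe (p i)"
proof -
  let ?A = "{\<pi> \<in> paths Q. path_length \<pi> = l \<and> path_end Q \<pi> = i}"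
  have "Poly_Mapping.keys x \<subseteq> ?A" using assms by (auto simp: kpaths_iff homog_def)
  then show ?thesis
  proof (induction rule: keys_span_induct)
    case (single \<pi> c)
    then show ?case using eqv_scl[OF top_coeff_eqv[of \<pi>], of c] by (auto simp: theta_linear)
  next
    case (add x y)
    then show ?case using eqv_add[of x "theta x \<bullet> pe (p i)" y "theta y \<bullet> pe (p i)"]
      by (simp add: theta_linear scl_distrib single_add distrib_right)
  qed (auto simp: theta_linear)
qed

lemma pmul_ve_keys: "x \<in> K \<Longrightarrow> \<pi> \<in> Poly_Mapping.keys (ve i \<star> x) \<Longrightarrow> path_end Q \<pi> = i"
  by (auto simp: vertex_mul keys_restr)

lemma homog_ve: "x \<in> K \<Longrightarrow> homog t x \<Longrightarrow> homog t (ve i \<star> x)"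
  by (simp add: vertex_mul)

text \<open>After passing to degree \<open>l\<close> and cutting by a vertex, an element of the
  ideal is congruent to a multiple of \<open>p i\<close>, and the factor must be zero. So
  \<open>theta\<close> is defined on the quotient.\<close>

lemma theta_I: "x \<in> I \<Longrightarrow> theta x = 0"
proof -
  assume x: "x \<in> I"
  let ?y = "hcomp l x"
  have y: "?y \<in> I" "?y \<in> K" using x I_sub by auto
  have "theta (ve i \<star> ?y) = 0" if i: "i \<in> verts Q" for i
  proof -
    have "ve i \<star> ?y \<in> I" using y i by (intro I_left) auto
    moreover have "ve i \<star> ?y \<approx> theta (ve i \<star> ?y) \<bullet> pe (p i)"
      using y i by (intro theta_top homog_ve) (auto dest: pmul_ve_keys)
    ultimately show ?thesis using eqv_I p_scl_I[OF i] by blast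
  qed
  then have "theta (\<Sum>i\<in>verts Q. ve i \<star> ?y) = 0" by (simp add: theta_linear)
  then have "theta (pone Q \<star> ?y) = 0" unfolding pone_sum pmul_sum_left .
  then show ?thesis using y by (simp add: theta_hcomp)
qed

lemma theta_eqv: "x \<approx> y \<Longrightarrow> theta x = theta y"
  using theta_I[of "x - y"] by (simp add: theta_linear)

text \<open>A bound path of length \<open>l\<close> starts at \<open>\<tau> i\<close> exactly when
  it ends at \<open>i\<close>. This is the identity defining \<nu>, for vertices instead of
  arrows.\<close>

lemma theta_vertex: "x \<in> K \<Longrightarrow> i \<in> verts Q \<Longrightarrow> theta (x \<star> ve (\<tau> i)) = theta (ve i \<star> x)"
proof (induction x rule: kpaths_induct)
  case (single \<pi> c)
  then have "path_end Q \<pi> \<in> verts Q" using paths_verts by blast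
  then have "top_coeff \<pi> = 0" if "(fst \<pi> = \<tau> i) \<noteq> (path_end Q \<pi> = i)"
    using that tau_inj[of i "path_end Q \<pi>"] single(2) by (intro top_coeff_eq_0) auto
  then show ?case using single by (auto simp: vertex_mul mul_vertex theta_linear)
qed (auto simp: pmul_distribs theta_linear)

lemma theta_pone: "x \<in> K \<Longrightarrow> theta x = (\<Sum>i\<in>verts Q. theta (ve i \<star> x))"
  using pone_mul[of x] unfolding pone_sum pmul_sum_left theta_linear(5)[symmetric] by simp

text \<open>
  By injectivity the map from the simple left module spanned by \<open>p i\<close> onto the one spanned by
  \<open>s\<close> is right multiplication by some \<open>b\<close>, so that \<open>s = p i b\<close> lies in the top degree.
\<close>

lemma left_socle:
  assumes s: "s \<in> K" and i: "i \<in> verts Q" and es: "ve i \<star> s \<approx> s"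
    and kill: "\<And>a. a \<in> arcs Q \<Longrightarrow> arrow_elem Q a \<star> s \<in> I"
  shows "s \<approx> theta s \<bullet> pe (p i)"
proof -
  note pi = p_props[OF i]
  have act_s: "x \<star> s \<approx> x $$ (i, []) \<bullet> s" if "x \<in> K" for x
    using simple_action[OF s i es kill that] .
  have act_p: "x \<star> pe (p i) \<approx> x $$ (i, []) \<bullet> pe (p i)" if "x \<in> K" for x
  proof (rule simple_action[OF _ i _ _ that])
    show "ve i \<star> pe (p i) \<approx> pe (p i)" using pi by (simp add: vertex_mul)
    fix a assume a: "a \<in> arcs Q"
    have "homog (1 + l) (arrow_elem Q a \<star> pe (p i))"
      using pi by (intro homog_pmul) (auto simp: homog_def)
    then show "arrow_elem Q a \<star> pe (p i) \<in> I" using pi a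
      by (intro long_I(1)) (auto intro: homog_fil)
  qed (use pi in auto)
  \<comment> \<open>The line spanned by \<open>p i\<close>: by \<open>act_p\<close> it is a left
    ideal, on which the algebra acts by the character at \<open>i\<close>.\<close>
  let ?N = "(\<lambda>c. cls (c \<bullet> pe (p i))) ` UNIV"
  have pK: "c \<bullet> pe (p i) \<in> K" for c using pi by auto
  have lm: "left_module BA (regular_module BA\<lparr>carrier := ?N\<rparr>)"
  proof (rule left_module_left_ideal)
    show "?N \<subseteq> carrier BA" using pK by auto
    show "\<zero>\<^bsub>BA\<^esub> \<in> ?N" by (auto simp: BA_simps intro!: image_eqI[of _ _ 0])
    show "x \<oplus>\<^bsub>BA\<^esub> y \<in> ?N" if xy: "x \<in> ?N" "y \<in> ?N" for x y
    proof -
      obtain c d where cd: "x = cls (c \<bullet> pe (p i))" "y = cls (d \<bullet> pe (p i))" using xy by auto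
      have "x \<oplus>\<^bsub>BA\<^esub> y = cls ((c + d) \<bullet> pe (p i))" unfolding cd BA_add[OF pK pK] scl_distrib ..
      then show ?thesis by blast
    qed
    show "a \<otimes>\<^bsub>BA\<^esub> x \<in> ?N" if ax: "a \<in> carrier BA" "x \<in> ?N" for a x
    proof -
      obtain c b where cb: "x = cls (c \<bullet> pe (p i))" "b \<in> K" "a = cls b"
        using ax by (auto elim: cls_cases)
      have "b \<star> (c \<bullet> pe (p i)) \<approx> c \<bullet> (b $$ (i, []) \<bullet> pe (p i))"
        unfolding pmul_scl_right using cb by (intro eqv_scl act_p)
      also have "c \<bullet> (b $$ (i, []) \<bullet> pe (p i)) = (c * b $$ (i, [])) \<bullet> pe (p i)" by simp
      finally have "cls (b \<star> (c \<bullet> pe (p i))) = cls ((c * b $$ (i, [])) \<bullet> pe (p i))"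
        by (simp only: cls_eq_iff)
      then have "a \<otimes>\<^bsub>BA\<^esub> x = cls ((c * b $$ (i, [])) \<bullet> pe (p i))"
        unfolding cb(1,3) BA_mult[OF cb(2) pK] .
      then show ?thesis by blast
    qed
  qed
  have reg: "regular_module BA\<lparr>carrier := carrier BA\<rparr> = regular_module BA"
    by (simp add: regular_module_def)
  \<comment> \<open>Sends \<open>c\<close> times \<open>p i\<close> to \<open>c\<close> times
    \<open>s\<close>. The scalar is unique since \<open>p i\<close> is nonzero in the quotient, and
    linearity over the algebra holds as both lines carry the same character.\<close>
  define f where "f = (\<lambda>z. cls ((THE c. z = cls (c \<bullet> pe (p i))) \<bullet> s))"
  have f: "f (cls (c \<bullet> pe (p i))) = cls (c \<bullet> s)" for c
  proof -
    have "(THE c'. cls (c \<bullet> pe (p i)) = cls (c' \<bullet> pe (p i))) = c"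
      by (rule the_equality) (simp, simp only: cls_eq_iff, metis p_scl_eqv[OF i])
    then show ?thesis unfolding f_def by simp
  qed
  have fhom: "f \<in> left_module_hom BA (regular_module BA\<lparr>carrier := ?N\<rparr>) (regular_module BA)"
    unfolding left_module_hom_def
  proof (intro CollectI conjI ballI)
    show "f \<in> carrier (regular_module BA\<lparr>carrier := ?N\<rparr>) \<rightarrow> carrier (regular_module BA)"
      using s f by (auto simp: regular_module_def simp del: map_single)
    fix x y assume xy: "x \<in> carrier (regular_module BA\<lparr>carrier := ?N\<rparr>)" "y \<in> carrier (regular_module BA\<lparr>carrier := ?N\<rparr>)"
    then obtain c d where cd: "x = cls (c \<bullet> pe (p i))" "y = cls (d \<bullet> pe (p i))" by auto
    have 1: "x \<oplus>\<^bsub>BA\<^esub> y = cls ((c + d) \<bullet> pe (p i))" unfolding cd BA_add[OF pK pK] scl_distrib ..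
    have 2: "f x \<oplus>\<^bsub>BA\<^esub> f y = cls ((c + d) \<bullet> s)"
      unfolding cd f scl_distrib using s by (intro BA_add) auto
    have "f (x \<oplus>\<^bsub>BA\<^esub> y) = f x \<oplus>\<^bsub>BA\<^esub> f y" unfolding 1 2 f ..
    then show "f (x \<oplus>\<^bsub>regular_module BA\<lparr>carrier := ?N\<rparr>\<^esub> y) = f x \<oplus>\<^bsub>regular_module BA\<^esub> f y"
      by (simp add: regular_module_def)
  next
    fix a x assume ax: "a \<in> carrier BA" "x \<in> carrier (regular_module BA\<lparr>carrier := ?N\<rparr>)"
    then obtain c b where cb: "x = cls (c \<bullet> pe (p i))" "b \<in> K" "a = cls b"
      by (auto elim: cls_cases)
    let ?d = "c * b $$ (i, [])"
    have "b \<star> (c \<bullet> pe (p i)) \<approx> c \<bullet> (b $$ (i, []) \<bullet> pe (p i))"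
      unfolding pmul_scl_right using cb by (intro eqv_scl act_p)
    then have 1: "a \<otimes>\<^bsub>BA\<^esub> x = cls (?d \<bullet> pe (p i))"
      unfolding cb(1,3) BA_mult[OF cb(2) pK] cls_eq_iff by (simp only: scl_simps)
    have "b \<star> (c \<bullet> s) \<approx> c \<bullet> (b $$ (i, []) \<bullet> s)"
      unfolding pmul_scl_right using cb by (intro eqv_scl act_s)
    then have 2: "a \<otimes>\<^bsub>BA\<^esub> f x = cls (?d \<bullet> s)"
      unfolding cb(1,3) f using s cb by (simp add: BA_mult cls_eq_iff)
    have "f (a \<otimes>\<^bsub>BA\<^esub> x) = a \<otimes>\<^bsub>BA\<^esub> f x" unfolding 1 2 f ..
    then show "f (a \<odot>\<^bsub>regular_module BA\<lparr>carrier := ?N\<rparr>\<^esub> x) = a \<odot>\<^bsub>regular_module BA\<^esub> f x"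
      by (simp add: regular_module_def)
  qed
  have idhom: "(\<lambda>x. x) \<in> left_module_hom BA (regular_module BA\<lparr>carrier := ?N\<rparr>) (regular_module BA)"
    using pK unfolding left_module_hom_def by (auto simp: regular_module_def simp del: map_single)
  have lmr: "left_module BA (regular_module BA)"
    using si by (simp add: self_injective_def injective_left_module_def)
  obtain g where g: "g \<in> left_module_hom BA (regular_module BA) (regular_module BA)"
    "\<forall>x\<in>?N. g x = f x"
    using si[unfolded self_injective_def injective_left_module_def, THEN conjunct2, rule_format,
        OF conjI[OF lm conjI[OF lmr conjI[OF idhom conjI[OF _ fhom]]]]]
    by auto
  interpret R: ring BA by (rule ring_BA)
  have "g \<one>\<^bsub>BA\<^esub> \<in> carrier BA" using g(1) by (auto simp: left_module_hom_def regular_module_def)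
  \<comment> \<open>The extension \<open>g\<close> to the whole algebra is right multiplication by
    its value at the identity.\<close>
  then obtain b where b: "b \<in> K" "g \<one>\<^bsub>BA\<^esub> = cls b" by (rule cls_cases)
  have pe: "pe (p i) \<in> K" using pi by auto
  have "cls (1 \<bullet> pe (p i)) \<in> ?N" by blast
  then have e1: "g (cls (pe (p i))) = cls s" using g(2) f[of 1] by auto
  have e2: "cls (pe (p i)) \<otimes>\<^bsub>BA\<^esub> \<one>\<^bsub>BA\<^esub> = cls (pe (p i))" using pe by simp
  have "\<forall>a\<in>carrier BA. \<forall>x\<in>carrier BA. g (a \<otimes>\<^bsub>BA\<^esub> x) = a \<otimes>\<^bsub>BA\<^esub> g x"
    using g(1) by (simp add: left_module_hom_def regular_module_def)
  then have e3: "g (cls (pe (p i)) \<otimes>\<^bsub>BA\<^esub> \<one>\<^bsub>BA\<^esub>) = cls (pe (p i)) \<otimes>\<^bsub>BA\<^esub> g \<one>\<^bsub>BA\<^esub>"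
    using pe by blast
  have "cls s = cls (pe (p i) \<star> b)"
    using e3 unfolding e1 e2 b(2) BA_mult[OF pe b(1)] .
  then have "s \<approx> pe (p i) \<star> b" by (simp add: cls_eq_iff)
  \<comment> \<open>Right multiplication by \<open>b\<close> may produce terms of higher degree,
    which vanish; what is left in degree \<open>l\<close> ends at \<open>i\<close> and is a multiple
    of \<open>p i\<close>.\<close>
  moreover have "pe (p i) \<star> b \<approx> hcomp l (pe (p i) \<star> b)"
  proof (rule long_I(2))
    have "fil (l + 0) (pe (p i) \<star> b)" using pi by (intro fil_pmul) (auto simp: fil_def)
    then show "fil l (pe (p i) \<star> b)" by simp
  qed (use pe b in auto)
  moreover have "hcomp l (pe (p i) \<star> b) \<approx> theta (hcomp l (pe (p i) \<star> b)) \<bullet> pe (p i)"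
  proof (rule theta_top)
    fix \<pi> assume "\<pi> \<in> Poly_Mapping.keys (hcomp l (pe (p i) \<star> b))"
    then have "\<pi> \<in> Poly_Mapping.keys (pe (p i) \<star> b)" by (auto simp: keys_restr)
    then show "path_end Q \<pi> = i" using pi by (auto dest!: keys_pmul simp: path_end_append)
  qed (use pe b in auto)
  ultimately have "s \<approx> theta (hcomp l (pe (p i) \<star> b)) \<bullet> pe (p i)"
    and "s \<approx> pe (p i) \<star> b" using eqv_trans by blast+
  then show ?thesis by (simp add: theta_hcomp theta_eqv[of s "pe (p i) \<star> b"])
qed

text \<open>Among the paths that do not annihilate \<open>x\<close> from the left, a longest one
  sends it to a nonzero element killed by all arrows. This element lies in the left socle, where
  \<open>theta\<close> gives the coefficient of a chosen path.\<close>

lemma nondegenerate: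
  assumes x: "x \<in> K" "x \<notin> I"
  shows "\<exists>\<pi>\<in>paths Q. theta (pe \<pi> \<star> x) \<noteq> 0"
proof -
  let ?P = "\<lambda>\<pi>. \<pi> \<in> paths Q \<and> pe \<pi> \<star> x \<notin> I"
  obtain i where i: "i \<in> verts Q" "ve i \<star> x \<notin> I"
  proof -
    have "\<not> (\<forall>i\<in>verts Q. ve i \<star> x \<in> I)"
      using I_sum[of "verts Q" "\<lambda>i. ve i \<star> x"] pone_mul[OF x(1)] x(2)
      unfolding pone_sum pmul_sum_left by auto
    then show ?thesis using that by blast
  qed
  then have "?P (i, [])" by simp
  moreover have "\<forall>\<pi>. ?P \<pi> \<longrightarrow> path_length \<pi> < Suc l"
    using long_path_I I_right x by (meson not_less_eq)
  ultimately obtain \<pi> where \<pi>: "?P \<pi>" "\<forall>y. ?P y \<longrightarrow> path_length y \<le> path_length \<pi>"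
    using ex_has_greatest_nat[of ?P "(i, [])" path_length "Suc l"] by blast
  obtain u q where uq: "\<pi> = (u, q)" by fastforce
  let ?i = "path_end Q \<pi>" and ?s = "pe \<pi> \<star> x"
  have s: "?s \<in> K" and i: "?i \<in> verts Q" using \<pi> x paths_verts by auto
  have "ve ?i \<star> ?s = ?s" using \<pi> by (simp add: pmul_assoc[symmetric] vertex_mul)
  then have es: "ve ?i \<star> ?s \<approx> ?s" by simp
  have kill: "arrow_elem Q a \<star> ?s \<in> I" if a: "a \<in> arcs Q" for a
  proof (cases "tail Q a = ?i")
    case True
    then have P: "(u, q @ [a]) \<in> paths Q" using a \<pi> uq by (simp add: paths_snoc)
    have "pe (u, q @ [a]) = arrow_elem Q a \<star> pe (u, q)" using P by (rule path_snoc_mul)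
    then have "arrow_elem Q a \<star> ?s = pe (u, q @ [a]) \<star> x" using uq by (simp add: pmul_assoc)
    moreover have "pe (u, q @ [a]) \<star> x \<in> I" using \<pi>(2)[rule_format, of "(u, q @ [a])"] P uq by auto
    ultimately show ?thesis by simp
  next
    case False
    then have "arrow_elem Q a \<star> ?s = 0" by (auto simp: pmul_assoc[symmetric] pmul_single pcomp_def)
    then show ?thesis by simp
  qed
  have "?s \<approx> theta ?s \<bullet> pe (p ?i)" using left_socle[OF s i es kill] .
  then have "theta ?s \<noteq> 0" using \<pi>(1) by auto
  then show ?thesis using \<pi> by blast
qed

end

section \<open>Bases of paths, representation of functionals and the Nakayama map\<close>

context quiver
begin

lemma finite_paths_le: "finite {\<pi>\<in>paths Q. path_length \<pi> \<le> m}"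
proof (rule finite_subset)
  show "{\<pi>\<in>paths Q. path_length \<pi> \<le> m} \<subseteq> verts Q \<times> {q. set q \<subseteq> arcs Q \<and> length q \<le> m}"
    by (auto simp: paths_iff)
qed (auto intro!: finite_lists_length_le)

end

context bq
begin

definition path_basis :: "('v, 'a) path set \<Rightarrow> bool" where
  "path_basis B \<longleftrightarrow> finite B \<and> B \<subseteq> paths Q \<and> (\<forall>x\<in>K. \<exists>c. x \<approx> (\<Sum>b\<in>B. c b \<bullet> pe b)) \<and>
    (\<forall>c. (\<Sum>b\<in>B. c b \<bullet> pe b) \<in> I \<longrightarrow> (\<forall>b\<in>B. c b = 0))"

text \<open>A spanning set of paths of least cardinality is independent; one exists because the
  finitely many paths of length at most \<open>m\<close> already span.\<close>

lemma ex_path_basis: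
  assumes long: "\<And>\<pi>. \<pi> \<in> paths Q \<Longrightarrow> m < path_length \<pi> \<Longrightarrow> pe \<pi> \<in> I"
  shows "\<exists>B. path_basis B"
proof -
  define sp where "sp = (\<lambda>B. finite B \<and> B \<subseteq> paths Q \<and> (\<forall>x\<in>K. \<exists>c. x \<approx> (\<Sum>b\<in>B. c b \<bullet> pe b)))"
  let ?P = "{\<pi>\<in>paths Q. path_length \<pi> \<le> m}"
  have "sp ?P"
    unfolding sp_def
  proof (intro conjI ballI finite_paths_le)
    fix x assume x: "x \<in> K"
    let ?y = "restr (\<lambda>\<pi>. path_length \<pi> \<le> m) x"
    have "x - ?y \<in> I"
    proof (rule long_paths_vanish(1)[OF long])
      show "fil (Suc m) (x - ?y)" by (auto simp: fil_def in_keys_iff lookup_minus split: if_splits)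
    qed (use x in auto)
    moreover have "?y = (\<Sum>b\<in>?P. x $$ b \<bullet> pe b)"
    proof (rule poly_mapping_eqI)
      fix \<pi>
      have "(\<Sum>b\<in>?P. x $$ b \<bullet> pe b) $$ \<pi> = (\<Sum>b\<in>?P. if \<pi> = b then x $$ b else 0)"
        unfolding lookup_sum by (intro sum.cong) (auto simp: lookup_single when_def)
      also have "\<dots> = (if \<pi> \<in> ?P then x $$ \<pi> else 0)" using finite_paths_le by (rule sum.delta')
      finally show "?y $$ \<pi> = (\<Sum>b\<in>?P. x $$ b \<bullet> pe b) $$ \<pi>"
        using kpaths_lookup[OF x, of \<pi>] by auto
    qed
    ultimately have "x \<approx> (\<Sum>b\<in>?P. x $$ b \<bullet> pe b)" by (simp only:)
    then show "\<exists>c. x \<approx> (\<Sum>b\<in>?P. c b \<bullet> pe b)" by (rule exI[of _ "\<lambda>b. x $$ b"])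
  qed auto
  then obtain B where B: "sp B" "\<forall>B'. sp B' \<longrightarrow> card B \<le> card B'"
    using ex_has_least_nat[of sp ?P card] by blast
  have ind: "c b = 0" if c: "(\<Sum>b\<in>B. c b \<bullet> pe b) \<in> I" and b: "b \<in> B" for c b
  proof (rule ccontr)
    assume nz: "c b \<noteq> 0"
    let ?B = "B - {b}"
    have fB: "finite B" using B by (simp add: sp_def)
    have sB: "(\<Sum>x\<in>B. d x \<bullet> pe x) = d b \<bullet> pe b + (\<Sum>x\<in>?B. d x \<bullet> pe x)" for d :: "_ \<Rightarrow> 'k"
      using fB b by (simp add: sum.remove)
    have "sp ?B"
      unfolding sp_def
    proof (intro conjI ballI)
      fix x assume "x \<in> K"
      then obtain d where d: "x \<approx> (\<Sum>b\<in>B. d b \<bullet> pe b)" using B unfolding sp_def by blast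
      \<comment> \<open>Subtracting \<open>r\<close> times the relation removes the coefficient of
        \<open>b\<close>, so the smaller set still spans.\<close>
      define r where "r = d b / c b"
      have "(\<Sum>b\<in>B. d b \<bullet> pe b) \<approx> (\<Sum>b\<in>B. d b \<bullet> pe b) - r \<bullet> (\<Sum>b\<in>B. c b \<bullet> pe b)"
        using I_scl[OF c, of r] by simp
      with d have "x \<approx> (\<Sum>b\<in>B. d b \<bullet> pe b) - r \<bullet> (\<Sum>b\<in>B. c b \<bullet> pe b)" by (rule eqv_trans)
      moreover have "(\<Sum>b\<in>B. d b \<bullet> pe b) - r \<bullet> (\<Sum>b\<in>B. c b \<bullet> pe b) = (\<Sum>x\<in>B. (d x - r * c x) \<bullet> pe x)"
        by (simp add: scl_sum sum_subtractf single_diff)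
      moreover have "\<dots> = (\<Sum>x\<in>?B. (d x - r * c x) \<bullet> pe x)"
        using sB[of "\<lambda>x. d x - r * c x"] nz by (simp add: r_def)
      ultimately have "x \<approx> (\<Sum>x\<in>?B. (d x - r * c x) \<bullet> pe x)" by (simp only:)
      then show "\<exists>c. x \<approx> (\<Sum>b\<in>?B. c b \<bullet> pe b)" by (rule exI[of _ "\<lambda>x. d x - r * c x"])
    qed (use B in \<open>auto simp: sp_def\<close>)
    then have "card B \<le> card ?B" using B by blast
    then show False using fB b card_Diff1_less[of B b] by simp
  qed
  have "path_basis B"
    unfolding path_basis_def conj_assoc[symmetric]
  proof (intro conjI allI impI ballI)
    show "finite B" "B \<subseteq> paths Q" using B(1) unfolding sp_def by auto
    show "\<exists>c. x \<approx> (\<Sum>b\<in>B. c b \<bullet> pe b)" if "x \<in> K" for x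
      using B(1)[unfolded sp_def, THEN conjunct2, THEN conjunct2] that by (rule bspec)
    show "c b = 0" if "(\<Sum>b\<in>B. c b \<bullet> pe b) \<in> I" "b \<in> B" for c b using ind[OF that] .
  qed
  then show ?thesis ..
qed

end

context stable_bq
begin

text \<open>The matrix of the pairing on a basis of paths has independent rows: a combination that
  pairs to 0 with every basis path on its left does so with all paths, hence lies in the ideal.
  Solving the square system gives D\<Lambda> = \<Lambda> \<theta>.\<close>

lemma represent:
  assumes add: "\<And>x y. x \<in> K \<Longrightarrow> y \<in> K \<Longrightarrow> f (x + y) = f x + f y"
    and scl: "\<And>c x. x \<in> K \<Longrightarrow> f (c \<bullet> x) = c * f x"
    and zero: "\<And>x. x \<in> I \<Longrightarrow> f x = (0 :: 'k)"
  shows "\<exists>x\<in>K. \<forall>z\<in>K. f z = theta (z \<star> x)"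
proof -
  obtain B where pB: "path_basis B" using ex_path_basis[OF long_path_I] ..
  note pB' = pB[unfolded path_basis_def]
  note B = pB'[THEN conjunct1] pB'[THEN conjunct2, THEN conjunct1]
    pB'[THEN conjunct2, THEN conjunct2, THEN conjunct1, rule_format]
    pB'[THEN conjunct2, THEN conjunct2, THEN conjunct2, rule_format]
  have BK: "c \<bullet> pe b \<in> K" if "b \<in> B" for b c using B(2) that by auto
  have "\<exists>c. \<forall>y\<in>B. (\<Sum>x\<in>B. c x * theta (pe y \<star> pe x)) = f (pe y)"
  proof (rule solvable_if_rows_independent[OF B(1)])
    fix c assume c: "\<forall>y\<in>B. (\<Sum>x\<in>B. c x * theta (pe y \<star> pe x)) = 0"
    let ?x = "\<Sum>b\<in>B. c b \<bullet> pe b"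
    have xK: "?x \<in> K" using BK by (rule kpaths_sum)
    have 0: "theta (pe y \<star> ?x) = 0" if "y \<in> B" for y
    proof -
      have "theta (pe y \<star> ?x) = (\<Sum>x\<in>B. c x * theta (pe y \<star> pe x))"
        unfolding pmul_sum_right pmul_scl_right theta_linear ..
      then show ?thesis using c that by simp
    qed
    have "?x \<in> I"
    proof (rule ccontr)
      assume "?x \<notin> I"
      then obtain \<pi> where \<pi>: "\<pi> \<in> paths Q" "theta (pe \<pi> \<star> ?x) \<noteq> 0" using nondegenerate[OF xK] by blast
      obtain d where d: "pe \<pi> \<approx> (\<Sum>b\<in>B. d b \<bullet> pe b)" using B(3)[OF kpaths_closed(7)[OF \<pi>(1)]] by (rule exE)
      have "theta (pe \<pi> \<star> ?x) = theta ((\<Sum>b\<in>B. d b \<bullet> pe b) \<star> ?x)"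
        by (intro theta_eqv eqv_right xK d)
      also have "\<dots> = (\<Sum>b\<in>B. d b * theta (pe b \<star> ?x))"
        unfolding pmul_sum_left pmul_scl_left theta_linear ..
      also have "\<dots> = 0" using 0 by simp
      finally show False using \<pi>(2) by simp
    qed
    then show "\<forall>x\<in>B. c x = 0" using B(4)[of c] by blast
  qed
  then obtain c where c: "\<forall>y\<in>B. (\<Sum>x\<in>B. c x * theta (pe y \<star> pe x)) = f (pe y)" by blast
  let ?x = "\<Sum>b\<in>B. c b \<bullet> pe b"
  have xK: "?x \<in> K" using BK by (rule kpaths_sum)
  have f0: "f 0 = 0" using zero by simp
  have fsum: "f (\<Sum>b\<in>A. d b \<bullet> pe b) = (\<Sum>b\<in>A. d b * f (pe b))" if "finite A" "A \<subseteq> B" for A d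
    using that
  proof (induction A)
    case (insert b A)
    have "f (\<Sum>b\<in>insert b A. d b \<bullet> pe b) = f (d b \<bullet> pe b) + f (\<Sum>b\<in>A. d b \<bullet> pe b)"
      unfolding sum.insert[OF insert(1,2)] using insert BK by (intro add kpaths_sum) auto
    moreover have "f (d b \<bullet> pe b) = d b * f (pe b)" using insert(4) B(2) by (intro scl) auto
    ultimately show ?case using insert by simp
  qed (simp add: f0)
  have "f z = theta (z \<star> ?x)" if z: "z \<in> K" for z
  proof -
    obtain d where d: "z \<approx> (\<Sum>b\<in>B. d b \<bullet> pe b)" using B(3)[OF z] by (rule exE)
    have dK: "(\<Sum>b\<in>B. d b \<bullet> pe b) \<in> K" using BK by (rule kpaths_sum)
    have "f z = f (z - (\<Sum>b\<in>B. d b \<bullet> pe b)) + f (\<Sum>b\<in>B. d b \<bullet> pe b)"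
      using add[of "z - (\<Sum>b\<in>B. d b \<bullet> pe b)" "\<Sum>b\<in>B. d b \<bullet> pe b"] z dK by simp
    also have "\<dots> = (\<Sum>b\<in>B. d b * f (pe b))" using zero[OF d] fsum[OF B(1) subset_refl] by simp
    also have "\<dots> = (\<Sum>b\<in>B. d b * theta (pe b \<star> ?x))"
    proof (rule sum.cong[OF refl])
      fix b assume "b \<in> B"
      have "theta (pe b \<star> ?x) = (\<Sum>x\<in>B. c x * theta (pe b \<star> pe x))"
        unfolding pmul_sum_right pmul_scl_right theta_linear ..
      then show "d b * f (pe b) = d b * theta (pe b \<star> ?x)" using c \<open>b \<in> B\<close> by simp
    qed
    also have "\<dots> = theta ((\<Sum>b\<in>B. d b \<bullet> pe b) \<star> ?x)"
      unfolding pmul_sum_left pmul_scl_left theta_linear ..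
    also have "\<dots> = theta (z \<star> ?x)"
      by (intro theta_eqv eqv_right xK eqv_sym[OF d])
    finally show ?thesis .
  qed
  then show ?thesis using xK by blast
qed

definition nak_keys :: "'a \<Rightarrow> (('v, 'a) path \<Rightarrow>\<^sub>0 'k) \<Rightarrow> bool" where
  "nak_keys \<beta> y \<longleftrightarrow> (\<forall>\<pi>\<in>Poly_Mapping.keys y.
     path_from_to Q (\<tau> (tail Q \<beta>)) (\<tau> (head Q \<beta>)) \<pi> \<and> path_length \<pi> = 1)"

abbreviation nak_arg :: "'a \<Rightarrow> ('v, 'a) path \<Rightarrow> bool" where
  "nak_arg \<beta> \<sigma> \<equiv> path_length \<sigma> = l - 1 \<and> fst \<sigma> = \<tau> (head Q \<beta>) \<and> path_end Q \<sigma> = tail Q \<beta>"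

lemma nak_keys_K: "nak_keys \<beta> y \<Longrightarrow> y \<in> K"
  by (auto simp: nak_keys_def kpaths_iff path_from_to_iff)

text \<open>\<open>theta\<close> sees only paths of length \<open>l\<close> from some
  \<open>\<tau> k\<close> to \<open>k\<close>. For \<beta> from \<open>i\<close> to
  \<open>j\<close>, a product of \<sigma> with \<beta>, or with an arrow from
  \<open>\<tau> i\<close> to \<open>\<tau> j\<close>, is of this kind only if \<sigma> goes from
  \<open>\<tau> j\<close> to \<open>i\<close> and has length \<open>l - 1\<close>; the second case
  uses that \<tau> is injective.\<close>

lemma nak_off:
  assumes \<beta>: "\<beta> \<in> arcs Q" and \<sigma>: "\<sigma> \<in> paths Q" "\<not> nak_arg \<beta> \<sigma>"
  shows "theta (arrow_elem Q \<beta> \<star> pe \<sigma>) = 0"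
    and "nak_keys \<beta> y \<Longrightarrow> theta (pe \<sigma> \<star> y) = 0"
proof -
  show "theta (arrow_elem Q \<beta> \<star> pe \<sigma>) = 0"
    using \<sigma> l_pos by (auto simp: pmul_single pcomp_def theta_linear intro!: top_coeff_eq_0)
  assume y: "nak_keys \<beta> y"
  let ?A = "{\<pi>\<in>paths Q. fst \<pi> = \<tau> (tail Q \<beta>) \<and> path_end Q \<pi> = \<tau> (head Q \<beta>) \<and> path_length \<pi> = 1}"
  have "Poly_Mapping.keys y \<subseteq> ?A" using y by (auto simp: nak_keys_def path_from_to_iff)
  then show "theta (pe \<sigma> \<star> y) = 0"
  proof (induction rule: keys_span_induct)
    case (single \<pi> c)
    have "path_end Q \<sigma> \<in> verts Q" "tail Q \<beta> \<in> verts Q" using paths_verts \<sigma> \<beta> by auto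
    then have inj: "\<tau> (path_end Q \<sigma>) = \<tau> (tail Q \<beta>) \<longleftrightarrow> path_end Q \<sigma> = tail Q \<beta>" by (rule tau_inj)
    have "top_coeff (fst \<pi>, snd \<pi> @ snd \<sigma>) = 0" if e: "path_end Q \<pi> = fst \<sigma>"
    proof (rule top_coeff_eq_0, rule notI)
      assume *: "path_length (fst \<pi>, snd \<pi> @ snd \<sigma>) = l \<and>
        fst (fst \<pi>, snd \<pi> @ snd \<sigma>) = \<tau> (path_end Q (fst \<pi>, snd \<pi> @ snd \<sigma>))"
      have \<pi>: "fst \<pi> = \<tau> (tail Q \<beta>)" "path_end Q \<pi> = \<tau> (head Q \<beta>)" "path_length \<pi> = 1"
        using single by blast+
      have "path_end Q (fst \<pi>, snd \<pi> @ snd \<sigma>) = path_end Q \<sigma>"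
        unfolding fst_conv snd_conv path_end_append e ..
      then have "fst \<pi> = \<tau> (path_end Q \<sigma>)" using conjunct2[OF *] by (metis fst_conv)
      then have "path_end Q \<sigma> = tail Q \<beta>" using inj \<pi>(1) by metis
      moreover have "path_length \<pi> + path_length \<sigma> = l" using conjunct1[OF *] by simp
      then have "path_length \<sigma> = l - 1" using \<pi>(3) by linarith
      moreover have "fst \<sigma> = \<tau> (head Q \<beta>)" using \<pi>(2) e by metis
      ultimately show False using \<sigma>(2) by blast
    qed
    then show ?case by (simp add: pmul_single pcomp_def theta_linear)
  qed (auto simp: pmul_distribs theta_linear)
qed

text \<open>Outside the one graded piece of the definition both sides vanish, so the equation of
  \<nu> extends to the whole path algebra and can be used without tracking degrees and ends.\<close>

lemma nak_extend:
  assumes \<beta>: "\<beta> \<in> arcs Q" and y: "nak_keys \<beta> y"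
    and eq: "\<And>\<sigma>. \<sigma> \<in> paths Q \<Longrightarrow> nak_arg \<beta> \<sigma> \<Longrightarrow> theta (arrow_elem Q \<beta> \<star> pe \<sigma>) = theta (pe \<sigma> \<star> y)"
    and q: "q \<in> K"
  shows "theta (arrow_elem Q \<beta> \<star> q) = theta (q \<star> y)"
  using q
proof (induction rule: kpaths_induct)
  case (single \<sigma> c)
  have "theta (arrow_elem Q \<beta> \<star> pe \<sigma>) = theta (pe \<sigma> \<star> y)"
  proof (cases "nak_arg \<beta> \<sigma>")
    case True
    then show ?thesis by (intro eq single)
  next
    case False
    then show ?thesis using nak_off[OF \<beta> single False] y by metis
  qed
  then have "theta (arrow_elem Q \<beta> \<star> (c \<bullet> pe \<sigma>)) = theta ((c \<bullet> pe \<sigma>) \<star> y)"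
    unfolding pmul_distribs theta_linear by simp
  then show ?case by simp
qed (auto simp: pmul_distribs theta_linear)

lemma ex_nak:
  assumes \<beta>: "\<beta> \<in> arcs Q"
  shows "\<exists>y. nak_keys \<beta> y \<and> (\<forall>q\<in>K. theta (arrow_elem Q \<beta> \<star> q) = theta (q \<star> y))"
proof -
  have bK: "arrow_elem Q \<beta> \<in> K" using \<beta> by auto
  obtain x where x: "x \<in> K" "\<forall>q\<in>K. theta (arrow_elem Q \<beta> \<star> q) = theta (q \<star> x)"
    using represent[of "\<lambda>q. theta (arrow_elem Q \<beta> \<star> q)"] bK
    by (auto simp: pmul_distribs theta_linear theta_I I_left)
  define S where "S = (\<lambda>\<pi>. fst \<pi> = \<tau> (tail Q \<beta>) \<and> path_end Q \<pi> = \<tau> (head Q \<beta>) \<and> path_length \<pi> = 1)"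
  have y: "nak_keys \<beta> (restr S x)"
    using x by (auto simp: nak_keys_def keys_restr S_def path_from_to_iff kpaths_iff)
  have r: "theta (pe \<sigma> \<star> restr S z) = theta (pe \<sigma> \<star> z)" if \<sigma>: "\<sigma> \<in> paths Q" "nak_arg \<beta> \<sigma>" and z: "z \<in> K" for \<sigma> z
    using z
  proof (induction rule: kpaths_induct)
    case (single \<pi> c)
    have "top_coeff (fst \<pi>, snd \<pi> @ snd \<sigma>) = 0" if nS: "\<not> S \<pi>" and e: "path_end Q \<pi> = fst \<sigma>"
    proof (rule top_coeff_eq_0, rule notI)
      assume *: "path_length (fst \<pi>, snd \<pi> @ snd \<sigma>) = l \<and>
        fst (fst \<pi>, snd \<pi> @ snd \<sigma>) = \<tau> (path_end Q (fst \<pi>, snd \<pi> @ snd \<sigma>))"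
      have "path_end Q (fst \<pi>, snd \<pi> @ snd \<sigma>) = path_end Q \<sigma>"
        unfolding fst_conv snd_conv path_end_append e ..
      then have "fst \<pi> = \<tau> (path_end Q \<sigma>)" using conjunct2[OF *] by (metis fst_conv)
      moreover have "path_length \<pi> + path_length \<sigma> = l" using conjunct1[OF *] by simp
      then have "path_length \<pi> = 1" using \<sigma>(2) l_pos by linarith
      ultimately show False using nS e \<sigma>(2) unfolding S_def by metis
    qed
    then have 0: "theta (pe \<sigma> \<star> Poly_Mapping.single \<pi> c) = 0" if "\<not> S \<pi>"
      using that by (simp add: pmul_single pcomp_def theta_linear)
    show ?case
    proof (cases "S \<pi>")
      case True
      then show ?thesis by (simp only: restr_simps if_True)
    next
      case False
      from 0[OF False] False show ?thesis by (simp only: restr_simps if_False pmul_0_right theta_linear(4))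
    qed
  qed (auto simp: pmul_distribs theta_linear restr_add)
  have "theta (arrow_elem Q \<beta> \<star> pe \<sigma>) = theta (pe \<sigma> \<star> restr S x)" if "\<sigma> \<in> paths Q" "nak_arg \<beta> \<sigma>" for \<sigma>
    unfolding r[OF that x(1)] using x(2) that(1) by blast
  then show ?thesis using nak_extend[OF \<beta> y] y by blast
qed

lemma eta_cls:
  assumes "i \<in> verts Q" "w \<in> K" "homog l w" "\<And>\<pi>. \<pi> \<in> Poly_Mapping.keys w \<Longrightarrow> path_end Q \<pi> = i"
  shows "eta Q \<rho> p i (cls w) = theta w"
proof -
  have pK: "pe (p i) \<in> K" using p_props assms by auto
  have w: "w \<approx> theta w \<bullet> pe (p i)" using theta_top assms by blast
  show ?thesis
    unfolding eta_def BA_smult[OF pK] cls_eq_iff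
  proof (rule the_equality)
    show "w \<approx> theta w \<bullet> pe (p i)" by (rule w)
    fix c assume "w \<approx> c \<bullet> pe (p i)"
    then show "c = theta w" using w p_scl_eqv[OF assms(1)] eqv_trans eqv_sym by blast
  qed
qed

text \<open>This gives meaning to the definite description: a solution exists by representing a
  functional, and two solutions differ by a combination of arrows lying in the ideal, which starts
  in degree two.\<close>

lemma nakayama:
  assumes \<beta>: "\<beta> \<in> arcs Q"
  shows "nak_keys \<beta> (nakayama_map Q \<rho> \<tau> l p \<beta>)"
    and "q \<in> K \<Longrightarrow> theta (arrow_elem Q \<beta> \<star> q) = theta (q \<star> nakayama_map Q \<rho> \<tau> l p \<beta>)"
proof -
  let ?i = "tail Q \<beta>" and ?j = "head Q \<beta>"
  have ij: "?i \<in> verts Q" "?j \<in> verts Q" using \<beta> by auto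
  have bK: "arrow_elem Q \<beta> \<in> K" using \<beta> by auto
  let ?C = "\<lambda>y. nak_keys \<beta> y \<and> (\<forall>q\<in>graded_piece Q \<rho> (l - 1) (\<tau> ?j) ?i.
           eta Q \<rho> p ?j (cls (arrow_elem Q \<beta>) \<otimes>\<^bsub>BA\<^esub> q) = eta Q \<rho> p ?i (q \<otimes>\<^bsub>BA\<^esub> cls y))"
  have gp: "(eta Q \<rho> p ?j (cls (arrow_elem Q \<beta>) \<otimes>\<^bsub>BA\<^esub> cls q) = eta Q \<rho> p ?i (cls q \<otimes>\<^bsub>BA\<^esub> cls y))
      = (theta (arrow_elem Q \<beta> \<star> q) = theta (q \<star> y))"
    if q: "\<forall>\<pi>\<in>Poly_Mapping.keys q. path_from_to Q (\<tau> ?j) ?i \<pi> \<and> path_length \<pi> = l - 1"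
      and y: "nak_keys \<beta> y" for q y
  proof -
    have qK: "q \<in> K" "homog (l - 1) q" using q by (auto simp: kpaths_iff path_from_to_iff homog_def)
    have yK: "y \<in> K" "homog 1 y" using y nak_keys_K by (auto simp: nak_keys_def homog_def)
    have "homog (1 + (l - 1)) (arrow_elem Q \<beta> \<star> q)" "homog ((l - 1) + 1) (q \<star> y)"
      using qK yK by (intro homog_pmul; simp add: homog_def)+
    \<comment> \<open>\<open>l\<close> is positive, so \<open>1 + (l - 1)\<close> is
      \<open>l\<close> even with truncated subtraction.\<close>
    then have h: "homog l (arrow_elem Q \<beta> \<star> q)" "homog l (q \<star> y)" using l_pos by auto
    have k1: "path_end Q \<pi> = ?j" if "\<pi> \<in> Poly_Mapping.keys (arrow_elem Q \<beta> \<star> q)" for \<pi>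
      using keys_pmul[OF that] by (auto simp: path_end_append)
    have k2: "path_end Q \<pi> = ?i" if \<pi>: "\<pi> \<in> Poly_Mapping.keys (q \<star> y)" for \<pi>
    proof -
      obtain \<sigma> \<kappa> where "\<sigma> \<in> Poly_Mapping.keys q" "path_end Q \<kappa> = fst \<sigma>" "\<pi> = (fst \<kappa>, snd \<kappa> @ snd \<sigma>)"
        using keys_pmul[OF \<pi>] by blast
      then show ?thesis using q by (auto simp: path_end_append path_from_to_iff)
    qed
    show ?thesis
      using h k1 k2 qK yK bK ij by (simp add: BA_mult eta_cls)
  qed
  have C_iff: "?C y \<longleftrightarrow> nak_keys \<beta> y \<and> (\<forall>q\<in>K. theta (arrow_elem Q \<beta> \<star> q) = theta (q \<star> y))" for y
  proof (intro iffI conjI)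
    assume C: "?C y"
    then show y: "nak_keys \<beta> y" by simp
    have "theta (arrow_elem Q \<beta> \<star> pe \<sigma>) = theta (pe \<sigma> \<star> y)" if \<sigma>: "\<sigma> \<in> paths Q" "nak_arg \<beta> \<sigma>" for \<sigma>
    proof -
      have "path_from_to Q (\<tau> ?j) ?i \<sigma>" unfolding path_from_to_iff using \<sigma> by blast
      then have k: "\<forall>\<pi>\<in>Poly_Mapping.keys (pe \<sigma>). path_from_to Q (\<tau> ?j) ?i \<pi> \<and> path_length \<pi> = l - 1"
        using \<sigma> by simp
      then have "cls (pe \<sigma>) \<in> graded_piece Q \<rho> (l - 1) (\<tau> ?j) ?i"
        unfolding graded_piece_def by blast
      then show ?thesis using C gp[OF k y] by blast
    qed
    then show "\<forall>q\<in>K. theta (arrow_elem Q \<beta> \<star> q) = theta (q \<star> y)" using nak_extend[OF \<beta> y] by blast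
  next
    assume *: "nak_keys \<beta> y \<and> (\<forall>q\<in>K. theta (arrow_elem Q \<beta> \<star> q) = theta (q \<star> y))"
    then show "nak_keys \<beta> y" by simp
    show "\<forall>q\<in>graded_piece Q \<rho> (l - 1) (\<tau> ?j) ?i.
           eta Q \<rho> p ?j (cls (arrow_elem Q \<beta>) \<otimes>\<^bsub>BA\<^esub> q) = eta Q \<rho> p ?i (q \<otimes>\<^bsub>BA\<^esub> cls y)"
    proof
      fix z assume "z \<in> graded_piece Q \<rho> (l - 1) (\<tau> ?j) ?i"
      then obtain q where q: "z = cls q"
        "\<forall>\<pi>\<in>Poly_Mapping.keys q. path_from_to Q (\<tau> ?j) ?i \<pi> \<and> path_length \<pi> = l - 1"
        unfolding graded_piece_def by blast
      then have "q \<in> K" by (auto simp: kpaths_iff path_from_to_iff)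
      then show "eta Q \<rho> p ?j (cls (arrow_elem Q \<beta>) \<otimes>\<^bsub>BA\<^esub> z) = eta Q \<rho> p ?i (z \<otimes>\<^bsub>BA\<^esub> cls y)"
        unfolding q(1) using gp[OF q(2)] * by blast
    qed
  qed
  have "\<exists>!y. ?C y"
  proof (rule ex_ex1I)
    show "\<exists>y. ?C y" using ex_nak[OF \<beta>] C_iff by blast
    fix y y' assume "?C y" "?C y'"
    then have y: "nak_keys \<beta> y" "nak_keys \<beta> y'" "\<forall>q\<in>K. theta (q \<star> y) = theta (q \<star> y')"
      unfolding C_iff by auto
    have "theta (pe \<pi> \<star> (y - y')) = 0" if "\<pi> \<in> paths Q" for \<pi>
      using y(3) that by (simp add: pmul_distribs theta_linear)
    then have "y - y' \<in> I" using nondegenerate[of "y - y'"] nak_keys_K y by blast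
    then have "y $$ \<pi> = y' $$ \<pi>" if "path_length \<pi> = 1" for \<pi> using eqv_lookup that by auto
    moreover have "y $$ \<pi> = 0" "y' $$ \<pi> = 0" if "path_length \<pi> \<noteq> 1" for \<pi>
      using y that by (auto simp: nak_keys_def in_keys_iff)
    ultimately show "y = y'" by (metis poly_mapping_eqI)
  qed
  then have the: "?C (THE y. ?C y)" by (rule theI')
  have eq: "nakayama_map Q \<rho> \<tau> l p \<beta> = (THE y. ?C y)"
    unfolding nakayama_map_def nak_keys_def Let_def ..
  have "?C (nakayama_map Q \<rho> \<tau> l p \<beta>)" by (rule ssubst[where P = ?C, OF eq the])
  then show "nak_keys \<beta> (nakayama_map Q \<rho> \<tau> l p \<beta>)"
    and "q \<in> K \<Longrightarrow> theta (arrow_elem Q \<beta> \<star> q) = theta (q \<star> nakayama_map Q \<rho> \<tau> l p \<beta>)"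
    unfolding C_iff by auto
qed

end

context stable_bq
begin

text \<open>Any other member of the basis that has length \<open>l\<close> and ends at
  \<open>i\<close> would be a multiple of \<open>p i\<close> and so have two expansions. Hence
  \<open>p i\<close> is the only member on which \<open>theta\<close>, cut at \<open>i\<close>, does
  not vanish.\<close>

lemma dual_basis_elem_p:
  assumes B: "bound_path_basis Q \<rho> B" and i: "i \<in> verts Q" "p i \<in> B" and x: "x \<in> K"
  shows "dual_basis_elem Q \<rho> B (p i) (cls x) = theta (ve i \<star> x)"
proof -
  have fB: "finite B" and Bb: "\<And>b. b \<in> B \<Longrightarrow> bound_path Q \<rho> b"
    and ex: "\<And>z. z \<in> carrier BA \<Longrightarrow> \<exists>!c. basis_expansion Q \<rho> B z c"
    using B unfolding bound_path_basis_def by auto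
  have BK: "pe b \<in> K" if "b \<in> B" for b using Bb[OF that] by (auto simp: bound_path_iff)
  have be: "basis_expansion Q \<rho> B (cls z) c \<longleftrightarrow> c \<in> B \<rightarrow>\<^sub>E UNIV \<and> z \<approx> (\<Sum>b\<in>B. c b \<bullet> pe b)" for z c
  proof -
    have "(\<Oplus>\<^bsub>BA\<^esub>b\<in>B. c b \<odot>\<^bsub>BA\<^esub> cls (pe b)) = cls (\<Sum>b\<in>B. c b \<bullet> pe b)"
      by (rule BA_finsum[OF fB BK])
    then show ?thesis by (simp only: basis_expansion_def cls_eq_iff)
  qed
  have other: "theta (ve i \<star> pe b) = (if b = p i then 1 else 0)" if b: "b \<in> B" for b
  proof (cases "b = p i")
    case True
    then show ?thesis using i p_props[of i] by (simp add: vertex_mul theta_p)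
  next
    case False
    have bp: "b \<in> paths Q" using Bb[OF b] by (simp add: bound_path_iff)
    show ?thesis
    proof (cases "path_end Q b = i \<and> path_length b = l")
      case True
      then have "pe b \<approx> top_coeff b \<bullet> pe (p i)" using top_coeff_eqv[of b] bp by auto
      moreover have "(\<Sum>x\<in>B. (if x = p i then c else 0) \<bullet> pe x) = c \<bullet> pe (p i)" for c :: 'k
      proof -
        have "(\<Sum>x\<in>B. (if x = p i then c else 0) \<bullet> pe x) = (\<Sum>x\<in>B. if x = p i then c \<bullet> pe x else 0)"
          by (intro sum.cong) auto
        then show ?thesis using fB i by simp
      qed
      moreover have "(\<Sum>x\<in>B. (if x = b then 1 else 0) \<bullet> pe x) = pe b"
      proof -
        have "(\<Sum>x\<in>B. (if x = b then 1 else 0) \<bullet> pe x) = (\<Sum>x\<in>B. if x = b then pe x else 0)"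
          by (intro sum.cong) auto
        then show ?thesis using fB b by simp
      qed
      \<comment> \<open>The same class written once as a multiple of \<open>p i\<close> and once as
        \<open>b\<close> itself.\<close>
      ultimately have "basis_expansion Q \<rho> B (cls (pe b)) (\<lambda>x\<in>B. if x = p i then top_coeff b else 0)"
        "basis_expansion Q \<rho> B (cls (pe b)) (\<lambda>x\<in>B. if x = b then 1 else 0)"
        unfolding be by (auto cong: sum.cong simp del: scl_single map_single)
      then have "(\<lambda>x\<in>B. if x = p i then top_coeff b else 0) = (\<lambda>x\<in>B. if x = b then 1 else 0)"
        using ex[of "cls (pe b)"] BK[OF b] by blast
      from fun_cong[OF this, of b] have False using b False by simp
      then show ?thesis ..
    next
      case f: False
      then have "theta (ve i \<star> pe b) = 0"
        using bp by (auto simp: vertex_mul theta_linear intro: top_coeff_eq_0)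
      then show ?thesis using False by simp
    qed
  qed
  obtain c where c: "basis_expansion Q \<rho> B (cls x) c" using ex[of "cls x"] x by blast
  then have the: "(THE c. basis_expansion Q \<rho> B (cls x) c) = c"
    using ex[of "cls x"] x by (intro the1_equality) auto
  have "x \<approx> (\<Sum>b\<in>B. c b \<bullet> pe b)" using c be by blast
  then have "theta (ve i \<star> x) = theta (ve i \<star> (\<Sum>b\<in>B. c b \<bullet> pe b))"
    using i by (intro theta_eqv eqv_left) auto
  also have "\<dots> = (\<Sum>b\<in>B. c b * theta (ve i \<star> pe b))"
    unfolding pmul_sum_right pmul_scl_right theta_linear ..
  also have "\<dots> = (\<Sum>b\<in>B. if b = p i then c b else 0)"
    by (intro sum.cong) (auto simp: other)
  also have "\<dots> = c (p i)" using fB i by simp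
  finally show ?thesis using x by (simp add: dual_basis_elem_def the)
qed

end

section \<open>The returning quiver\<close>

lemma homogeneous_bound_quiverI:
  assumes "fin_digraph Q" "\<And>r. r \<in> \<rho> \<Longrightarrow> r \<in> kpaths Q \<and> fil 2 r \<and> (\<exists>t. homog t r)"
  shows "homogeneous_bound_quiver Q \<rho>"
  unfolding homogeneous_bound_quiver_def bound_quiver_def
proof (intro conjI ballI)
  show "fin_digraph Q" by fact
  fix r \<pi> assume r: "r \<in> \<rho>" "\<pi> \<in> Poly_Mapping.keys r"
  show "\<pi> \<in> paths Q" using assms(2)[OF r(1)] r(2) unfolding kpaths_iff by blast
  show "2 \<le> path_length \<pi>" using assms(2)[OF r(1)] r(2) unfolding fil_def by blast
  fix \<sigma> assume "\<sigma> \<in> Poly_Mapping.keys r"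
  then show "path_length \<pi> = path_length \<sigma>" using assms(2)[OF r(1)] r(2) unfolding homog_def by metis
qed

lemma embed_elem_lin: "embed_elem = lin (\<lambda>\<pi>. path_elem (fst \<pi>, map Inl (snd \<pi>)))"
  by (rule ext) (simp add: embed_elem_def lin_def)

lemma embed_elem_simps:
  "embed_elem 0 = 0" "embed_elem (x + y) = embed_elem x + embed_elem y"
  "embed_elem (x - y) = embed_elem x - embed_elem y" "embed_elem (c \<bullet> x) = c \<bullet> embed_elem x"
  "embed_elem (Poly_Mapping.single \<pi> c) = Poly_Mapping.single (fst \<pi>, map Inl (snd \<pi>)) c"
  by (simp_all add: embed_elem_lin lin_add lin_diff lin_scl)

lemma keys_embed: "\<pi> \<in> Poly_Mapping.keys (embed_elem x) \<Longrightarrow>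
    \<exists>\<sigma>\<in>Poly_Mapping.keys x. \<pi> = (fst \<sigma>, map Inl (snd \<sigma>))"
proof (rule ccontr)
  assume a: "\<pi> \<in> Poly_Mapping.keys (embed_elem x)" "\<not> (\<exists>\<sigma>\<in>Poly_Mapping.keys x. \<pi> = (fst \<sigma>, map Inl (snd \<sigma>)))"
  have "embed_elem x $$ \<pi> = (\<Sum>\<sigma>\<in>Poly_Mapping.keys x. 0)"
    unfolding embed_elem_def lookup_sum using a(2) by (intro sum.cong) (auto simp: lookup_single when_def)
  then show False using a(1) by (simp add: in_keys_iff)
qed

lemma embed_homog: "homog t x \<Longrightarrow> homog t (embed_elem x)"
  unfolding homog_def by (auto dest!: keys_embed)

lemma embed_fil: "fil t x \<Longrightarrow> fil t (embed_elem x)"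
  unfolding fil_def by (auto dest!: keys_embed)

lemma returning_simps [simp]:
  "verts (returning_quiver Q \<tau>) = verts Q" "arcs (returning_quiver Q \<tau>) = Inl ` arcs Q \<union> Inr ` verts Q"
  "tail (returning_quiver Q \<tau>) (Inl a) = tail Q a" "tail (returning_quiver Q \<tau>) (Inr i) = i"
  "head (returning_quiver Q \<tau>) (Inl a) = head Q a" "head (returning_quiver Q \<tau>) (Inr i) = \<tau> i"
  by (simp_all add: returning_quiver_def)

lemma path_end_map_Inl [simp]:
  "pre_digraph.awlast (returning_quiver Q \<tau>) u (map Inl q) = pre_digraph.awlast Q u q"
  by (induction q arbitrary: u) simp_all

lemma embed_mul: "embed_elem (pmul Q x y) = pmul (returning_quiver Q \<tau>) (embed_elem x) (embed_elem y)"
proof (induction x rule: poly_mapping_lin_induct)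
  case (single \<pi> c)
  show ?case
    by (induction y rule: poly_mapping_lin_induct)
      (auto simp: pmul_single pcomp_def embed_elem_simps pmul_distribs)
qed (auto simp: pmul_distribs embed_elem_simps)

context stable_bq
begin

abbreviation "RQ \<equiv> returning_quiver Q \<tau>"
abbreviation "\<rho>R \<equiv> returning_relations Q \<rho> \<tau> l p"
abbreviation "nu \<equiv> nakayama_map Q \<rho> \<tau> l p"
abbreviation emb :: "_ \<Rightarrow> ('v, 'a + 'v) path \<Rightarrow>\<^sub>0 'k" where "emb \<equiv> embed_elem"
abbreviation mulR (infixl "\<circledast>" 78) where "mulR \<equiv> (pmul RQ :: (('v, 'a + 'v) path \<Rightarrow>\<^sub>0 'k) \<Rightarrow> _)"
abbreviation al :: "'v \<Rightarrow> ('v, 'a + 'v) path \<Rightarrow>\<^sub>0 'k" where "al i \<equiv> path_elem (i, [Inr i])"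

lemma fin_digraph_RQ: "fin_digraph RQ"
proof
  fix e assume "e \<in> arcs RQ"
  then show "tail RQ e \<in> verts RQ" "head RQ e \<in> verts RQ" by auto
qed auto

sublocale RQ: quiver RQ
  by (simp add: quiver_def fin_digraph_RQ)

lemma paths_RQ_Inl: "(u, map Inl q) \<in> paths RQ \<longleftrightarrow> (u, q) \<in> paths Q"
  by (induction q arbitrary: u) (auto simp: paths_Cons RQ.paths_Cons)

lemma emb_closed [simp, intro]: "x \<in> K \<Longrightarrow> emb x \<in> kpaths RQ"
  unfolding embed_elem_lin by (intro lin_kpaths) (auto simp: kpaths_iff paths_RQ_Inl intro!: kpaths_closed)

lemma al_closed [simp, intro]: "i \<in> verts Q \<Longrightarrow> al i \<in> kpaths RQ"
  by auto

lemma nu_props: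
  assumes "\<beta> \<in> arcs Q"
  shows "nu \<beta> \<in> K" "homog 1 (nu \<beta>)"
    "ve (\<tau> (head Q \<beta>)) \<star> nu \<beta> = nu \<beta>" "nu \<beta> \<star> ve (\<tau> (tail Q \<beta>)) = nu \<beta>"
proof -
  note k = nakayama(1)[OF assms]
  show K: "nu \<beta> \<in> K" using k by (rule nak_keys_K)
  show "homog 1 (nu \<beta>)" using k by (auto simp: nak_keys_def homog_def)
  show "ve (\<tau> (head Q \<beta>)) \<star> nu \<beta> = nu \<beta>" "nu \<beta> \<star> ve (\<tau> (tail Q \<beta>)) = nu \<beta>"
    unfolding vertex_mul[OF K] mul_vertex[OF K]
    using k by (auto intro!: restr_id simp: nak_keys_def path_from_to_iff)
qed

lemma relations_eq:
  "\<rho>R = emb ` \<rho> \<union> {al (\<tau> i) \<circledast> al i | i. i \<in> verts Q} \<union>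
    {al (head Q \<beta>) \<circledast> emb (arrow_elem Q \<beta>) - emb (nu \<beta>) \<circledast> al (tail Q \<beta>) | \<beta>. \<beta> \<in> arcs Q}"
  by (simp add: returning_relations_def Let_def pmul_def embed_elem_simps)

text \<open>The new relations are homogeneous of degree two because \<nu> takes arrows to
  combinations of arrows; so everything proved about homogeneous bound quivers applies to the
  returning one.\<close>

lemma bq_R: "bq RQ \<rho>R"
proof (rule bqI, rule homogeneous_bound_quiverI[OF fin_digraph_RQ])
  fix r assume "r \<in> \<rho>R"
  then consider (1) r' where "r' \<in> \<rho>" "r = emb r'"
    | (2) i where "i \<in> verts Q" "r = al (\<tau> i) \<circledast> al i"
    | (3) \<beta> where "\<beta> \<in> arcs Q" "r = al (head Q \<beta>) \<circledast> emb (arrow_elem Q \<beta>) - emb (nu \<beta>) \<circledast> al (tail Q \<beta>)"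
    unfolding relations_eq by blast
  then show "r \<in> kpaths RQ \<and> fil 2 r \<and> (\<exists>t. homog t r)"
  proof cases
    case 1
    then show ?thesis using rho_K rho_fil rho_homog embed_fil embed_homog by blast
  next
    case 2
    have "homog (1 + 1) r" unfolding 2 by (intro homog_pmul) (auto simp: homog_def)
    then show ?thesis using 2 homog_fil[of "1 + 1" r 2] by auto
  next
    case 3
    have "homog (1 + 1) (al (head Q \<beta>) \<circledast> emb (arrow_elem Q \<beta>))"
      by (intro homog_pmul) (auto simp: homog_def embed_elem_simps)
    moreover have "homog (1 + 1) (emb (nu \<beta>) \<circledast> al (tail Q \<beta>))"
      using nu_props(2)[OF 3(1)] by (intro homog_pmul embed_homog) (auto simp: homog_def)
    ultimately have h: "homog (1 + 1) r" unfolding 3 by (rule homog_simps)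
    have "r \<in> kpaths RQ" unfolding 3 using 3(1) nu_props(1)[OF 3(1)]
      by (intro kpaths_closed(3) RQ.pmul_closed emb_closed al_closed) auto
    then show ?thesis using h homog_fil[of "1 + 1" r 2] by auto
  qed
qed

end

sublocale stable_bq \<subseteq> R: bq RQ \<rho>R
  by (rule bq_R)

section \<open>Normal form in the path algebra of the returning quiver\<close>

context stable_bq
begin

abbreviation eqvR (infix "\<doteq>" 50) where "x \<doteq> y \<equiv> x - y \<in> R.I"
abbreviation "KR \<equiv> (kpaths RQ :: (('v, 'a + 'v) path \<Rightarrow>\<^sub>0 'k) set)"

text \<open>One element in place of a family: \<open>al i\<close> is recovered as
  \<open>alpha\<close> times the vertex \<open>i\<close> and as the vertex \<open>\<tau> i\<close>
  times \<open>alpha\<close>. The new relations become a rule for moving \<open>alpha\<close> past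
  an arrow and the vanishing of its square.\<close>

definition alpha :: "('v, 'a + 'v) path \<Rightarrow>\<^sub>0 'k" where
  "alpha = (\<Sum>i\<in>verts Q. al i)"

lemma alpha_closed [simp, intro]: "alpha \<in> KR"
  unfolding alpha_def by auto

lemma emb_ve [simp]: "emb (ve i) = vertex_elem i"
  by (simp add: embed_elem_simps)

lemma alpha_ve: "i \<in> verts Q \<Longrightarrow> alpha \<circledast> vertex_elem i = al i"
  unfolding alpha_def pmul_sum_left by (simp add: pmul_single pcomp_def)

lemma ve_alpha:
  assumes "i \<in> verts Q" shows "vertex_elem (\<tau> i) \<circledast> alpha = al i"
proof -
  have "vertex_elem (\<tau> i) \<circledast> alpha = (\<Sum>j\<in>verts Q. if j = i then al i else 0)"
    unfolding alpha_def pmul_sum_right using assms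
    by (intro sum.cong) (auto simp: pmul_single pcomp_def tau_inj)
  then show ?thesis using assms by simp
qed

lemma alpha_arrow:
  assumes "\<beta> \<in> arcs Q" shows "alpha \<circledast> emb (arrow_elem Q \<beta>) \<doteq> emb (nu \<beta>) \<circledast> alpha"
proof -
  have "al (head Q \<beta>) \<circledast> emb (arrow_elem Q \<beta>) - emb (nu \<beta>) \<circledast> al (tail Q \<beta>) \<in> R.I"
    using assms by (intro R.I_gen) (unfold relations_eq, blast)
  moreover have "al (head Q \<beta>) \<circledast> emb (arrow_elem Q \<beta>) = alpha \<circledast> emb (arrow_elem Q \<beta>)"
  proof -
    have "emb (arrow_elem Q \<beta>) = vertex_elem (head Q \<beta>) \<circledast> emb (arrow_elem Q \<beta>)"
      by (simp add: embed_elem_simps pmul_single pcomp_def)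
    then have "alpha \<circledast> emb (arrow_elem Q \<beta>) = (alpha \<circledast> vertex_elem (head Q \<beta>)) \<circledast> emb (arrow_elem Q \<beta>)"
      by (metis pmul_assoc)
    then show ?thesis using assms by (simp add: alpha_ve)
  qed
  moreover have "emb (nu \<beta>) \<circledast> al (tail Q \<beta>) = emb (nu \<beta>) \<circledast> alpha"
  proof -
    have "emb (nu \<beta>) = emb (nu \<beta>) \<circledast> vertex_elem (\<tau> (tail Q \<beta>))"
      using embed_mul[of Q "nu \<beta>" "ve (\<tau> (tail Q \<beta>))" \<tau>] nu_props(4)[OF assms] by simp
    then have "emb (nu \<beta>) \<circledast> alpha = emb (nu \<beta>) \<circledast> (vertex_elem (\<tau> (tail Q \<beta>)) \<circledast> alpha)"
      by (metis pmul_assoc)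
    then show ?thesis using assms by (simp add: ve_alpha)
  qed
  ultimately show ?thesis by simp
qed

lemma alpha_alpha: "alpha \<circledast> alpha \<in> R.I"
proof -
  have "alpha \<circledast> alpha = (\<Sum>i\<in>verts Q. alpha \<circledast> al i)"
    by (simp add: alpha_def pmul_sum_right)
  also have "\<dots> = (\<Sum>i\<in>verts Q. al (\<tau> i) \<circledast> al i)"
  proof (rule sum.cong[OF refl])
    fix i assume i: "i \<in> verts Q"
    have "al i = vertex_elem (\<tau> i) \<circledast> al i" by (simp add: pmul_single pcomp_def)
    then have "alpha \<circledast> al i = (alpha \<circledast> vertex_elem (\<tau> i)) \<circledast> al i" by (metis pmul_assoc)
    then show "alpha \<circledast> al i = al (\<tau> i) \<circledast> al i" using i by (simp add: alpha_ve)
  qed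
  also have "\<dots> \<in> R.I"
    by (intro R.I_sum R.I_gen) (unfold relations_eq, blast)
  finally show ?thesis .
qed

text \<open>\<open>alpha\<close> passes the arrows one by one, the last traversed arrow first, each
  being replaced by its image under \<nu>; at the trivial path the vertex \<open>u\<close> turns
  into \<open>\<tau> u\<close>. The length is kept since \<nu> preserves degrees.\<close>

lemma alpha_emb_path:
  assumes "(u, q) \<in> paths Q"
  shows "\<exists>x'\<in>K. homog (length q) x' \<and> alpha \<circledast> emb (pe (u, q)) \<doteq> emb x' \<circledast> alpha"
  using assms
proof (induction q rule: rev_induct)
  case Nil
  then have "alpha \<circledast> emb (pe (u, [])) = emb (ve (\<tau> u)) \<circledast> alpha"
    by (simp add: alpha_ve ve_alpha)
  then show ?case using Nil by (intro bexI[of _ "ve (\<tau> u)"]) (auto simp: homog_def)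
next
  case (snoc a q)
  then have a: "a \<in> arcs Q" and uq: "(u, q) \<in> paths Q" by (auto simp: paths_snoc)
  with snoc obtain x' where x': "x' \<in> K" "homog (length q) x'" "alpha \<circledast> emb (pe (u, q)) \<doteq> emb x' \<circledast> alpha"
    by blast
  have aK: "emb (arrow_elem Q a) \<in> KR" "emb (pe (u, q)) \<in> KR" using a uq by auto
  have e: "emb (pe (u, q @ [a])) = emb (arrow_elem Q a) \<circledast> emb (pe (u, q))"
    using path_snoc_mul[OF snoc(2)] by (metis embed_mul)
  have "alpha \<circledast> emb (pe (u, q @ [a])) = (alpha \<circledast> emb (arrow_elem Q a)) \<circledast> emb (pe (u, q))"
    by (simp only: e pmul_assoc)
  also have "\<dots> \<doteq> (emb (nu a) \<circledast> alpha) \<circledast> emb (pe (u, q))"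
    using aK a by (intro R.eqv_right alpha_arrow)
  also have "(emb (nu a) \<circledast> alpha) \<circledast> emb (pe (u, q)) = emb (nu a) \<circledast> (alpha \<circledast> emb (pe (u, q)))"
    by (rule pmul_assoc)
  also have "\<dots> \<doteq> emb (nu a) \<circledast> (emb x' \<circledast> alpha)"
    using x'(3) nu_props(1)[OF a] by (intro R.eqv_left emb_closed)
  also have "emb (nu a) \<circledast> (emb x' \<circledast> alpha) = emb (nu a \<star> x') \<circledast> alpha"
    by (simp only: embed_mul[of Q _ _ \<tau>] pmul_assoc)
  finally have "alpha \<circledast> emb (pe (u, q @ [a])) \<doteq> emb (nu a \<star> x') \<circledast> alpha" .
  moreover have "homog (1 + length q) (nu a \<star> x')" using nu_props(2)[OF a] x'(2) by (rule homog_pmul)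
  ultimately show ?case using nu_props(1)[OF a] x'(1) by (intro bexI[of _ "nu a \<star> x'"]) auto
qed

lemma alpha_emb:
  assumes "x \<in> K" "homog t x"
  shows "\<exists>x'\<in>K. homog t x' \<and> alpha \<circledast> emb x \<doteq> emb x' \<circledast> alpha"
proof -
  have "Poly_Mapping.keys x \<subseteq> {\<pi>\<in>paths Q. path_length \<pi> = t}" using assms by (auto simp: kpaths_iff homog_def)
  then show ?thesis
  proof (induction rule: keys_span_induct)
    case zero
    then show ?case by (intro bexI[of _ 0]) (auto simp: embed_elem_simps)
  next
    case (single \<pi> c)
    obtain u q where \<pi>: "\<pi> = (u, q)" by fastforce
    with single obtain x' where x': "x' \<in> K" "homog t x'" "alpha \<circledast> emb (pe \<pi>) \<doteq> emb x' \<circledast> alpha"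
      using alpha_emb_path[of u q] by auto
    have "alpha \<circledast> emb (c \<bullet> pe \<pi>) \<doteq> emb (c \<bullet> x') \<circledast> alpha"
      unfolding embed_elem_simps(4) pmul_distribs by (intro R.eqv_scl x')
    then show ?case using x' by (intro bexI[of _ "c \<bullet> x'"]) auto
  next
    case (add x y)
    then obtain x' y' where xy: "x' \<in> K" "homog t x'" "alpha \<circledast> emb x \<doteq> emb x' \<circledast> alpha"
      "y' \<in> K" "homog t y'" "alpha \<circledast> emb y \<doteq> emb y' \<circledast> alpha" by blast
    have "alpha \<circledast> emb (x + y) \<doteq> emb (x' + y') \<circledast> alpha"
      unfolding embed_elem_simps(2) pmul_distribs by (intro R.eqv_add xy)
    then show ?case using xy by (intro bexI[of _ "x' + y'"]) auto
  qed
qed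

text \<open>The degree of \<open>b\<close> is stated with \<open>Suc\<close> on the left, as a
  subtraction would be truncated in degree 0; there \<open>b\<close> has to vanish.\<close>

definition nform :: "nat \<Rightarrow> (('v, 'a + 'v) path \<Rightarrow>\<^sub>0 'k) \<Rightarrow> (('v, 'a) path \<Rightarrow>\<^sub>0 'k) \<Rightarrow> (('v, 'a) path \<Rightarrow>\<^sub>0 'k) \<Rightarrow> bool" where
  "nform t x a b \<longleftrightarrow> a \<in> K \<and> b \<in> K \<and> homog t a \<and> (\<forall>\<pi>\<in>Poly_Mapping.keys b. Suc (path_length \<pi>) = t) \<and>
     x \<doteq> emb a + emb b \<circledast> alpha"

text \<open>Appending an old arrow multiplies \<open>a\<close> and \<open>b\<close> from the left.
  Appending a new one moves \<open>alpha\<close> to the right: \<open>a\<close> turns into the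
  coefficient of \<open>alpha\<close>, and the term from \<open>b\<close> acquires a square of
  \<open>alpha\<close> and disappears.\<close>

lemma nform_path:
  assumes "(u, q) \<in> paths RQ"
  shows "\<exists>a b. nform (length q) (path_elem (u, q)) a b"
  using assms
proof (induction q rule: rev_induct)
  case Nil
  then show ?case by (intro exI[of _ "ve u"] exI[of _ 0]) (auto simp: nform_def homog_def embed_elem_simps)
next
  case (snoc e q)
  then have e: "e \<in> arcs RQ" and uq: "(u, q) \<in> paths RQ" by (auto simp: RQ.paths_snoc)
  with snoc obtain a b where "nform (length q) (path_elem (u, q)) a b" by blast
  then have ab: "a \<in> K" "b \<in> K" "homog (length q) a" "\<forall>\<pi>\<in>Poly_Mapping.keys b. Suc (path_length \<pi>) = length q"
    "path_elem (u, q) \<doteq> emb a + emb b \<circledast> alpha" unfolding nform_def by auto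
  have eK: "arrow_elem RQ e \<in> KR" using e RQ.paths_single by (intro kpaths_closed) blast
  have pq: "path_elem (u, q @ [e]) = arrow_elem RQ e \<circledast> path_elem (u, q)"
    using snoc(2) by (rule RQ.path_snoc_mul)
  have 1: "path_elem (u, q @ [e]) \<doteq> arrow_elem RQ e \<circledast> (emb a + emb b \<circledast> alpha)"
    unfolding pq using eK ab(5) by (rule R.eqv_left)
  from e consider (Inl) c where "c \<in> arcs Q" "e = Inl c" | (Inr) i where "i \<in> verts Q" "e = Inr i" by auto
  then show ?case
  proof cases
    case Inl
    have ce: "arrow_elem RQ e = emb (arrow_elem Q c)" using Inl by (simp add: embed_elem_simps)
    have cK: "arrow_elem Q c \<in> K" using Inl by auto
    have "arrow_elem RQ e \<circledast> (emb a + emb b \<circledast> alpha)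
        = emb (arrow_elem Q c \<star> a) + emb (arrow_elem Q c \<star> b) \<circledast> alpha"
      by (simp only: ce pmul_distribs embed_mul[of Q _ _ \<tau>] pmul_assoc)
    with 1 have "path_elem (u, q @ [e]) \<doteq> emb (arrow_elem Q c \<star> a) + emb (arrow_elem Q c \<star> b) \<circledast> alpha"
      by (simp only:)
    moreover have "homog (1 + length q) (arrow_elem Q c \<star> a)"
      using ab(3) by (intro homog_pmul) (auto simp: homog_def)
    moreover have "\<forall>\<pi>\<in>Poly_Mapping.keys (arrow_elem Q c \<star> b). Suc (path_length \<pi>) = length (q @ [e])"
      using ab(4) by (auto dest!: keys_pmul)
    ultimately show ?thesis using ab(1,2) cK
      by (intro exI[of _ "arrow_elem Q c \<star> a"] exI[of _ "arrow_elem Q c \<star> b"]) (simp add: nform_def)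
  next
    case Inr
    have ie: "arrow_elem RQ e = alpha \<circledast> emb (ve i)" using Inr by (simp add: alpha_ve)
    have iK: "ve i \<star> a \<in> K" "ve i \<star> b \<in> K" using Inr ab by auto
    obtain a' where a': "a' \<in> K" "homog (length q) a'" "alpha \<circledast> emb (ve i \<star> a) \<doteq> emb a' \<circledast> alpha"
      using alpha_emb[OF iK(1) homog_ve[OF ab(1,3)]] by blast
    \<comment> \<open>The truncated difference is harmless: for an empty \<open>q\<close> no path
      occurs in \<open>b\<close>.\<close>
    have "homog (length q - 1) b" using ab(4) unfolding homog_def by force
    then obtain b' where b': "b' \<in> K" "alpha \<circledast> emb (ve i \<star> b) \<doteq> emb b' \<circledast> alpha"
      using alpha_emb[OF iK(2) homog_ve[OF ab(2)]] by blast
    have "arrow_elem RQ e \<circledast> (emb a + emb b \<circledast> alpha)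
        = alpha \<circledast> emb (ve i \<star> a) + alpha \<circledast> emb (ve i \<star> b) \<circledast> alpha"
      by (simp only: ie pmul_distribs embed_mul[of Q _ _ \<tau>] pmul_assoc)
    with 1 have "path_elem (u, q @ [e]) \<doteq> alpha \<circledast> emb (ve i \<star> a) + alpha \<circledast> emb (ve i \<star> b) \<circledast> alpha"
      by (simp only:)
    also have "alpha \<circledast> emb (ve i \<star> a) + alpha \<circledast> emb (ve i \<star> b) \<circledast> alpha \<doteq> emb a' \<circledast> alpha + emb b' \<circledast> alpha \<circledast> alpha"
      by (intro R.eqv_add a' R.eqv_right b' alpha_closed)
    also have "emb a' \<circledast> alpha + emb b' \<circledast> alpha \<circledast> alpha \<doteq> emb a' \<circledast> alpha + 0"
    proof (intro R.eqv_add R.eqv_refl)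
      show "emb b' \<circledast> alpha \<circledast> alpha \<doteq> 0"
        unfolding diff_0_right pmul_assoc by (rule R.I_left[OF emb_closed[OF b'(1)] alpha_alpha])
    qed
    finally have "path_elem (u, q @ [e]) \<doteq> emb 0 + emb a' \<circledast> alpha" by (simp add: embed_elem_simps)
    then show ?thesis using a'(1,2)
      by (intro exI[of _ 0] exI[of _ a']) (auto simp add: nform_def homog_def)
  qed
qed

lemma nform_add: "nform t x a b \<Longrightarrow> nform t y c d \<Longrightarrow> nform t (x + y) (a + c) (b + d)"
proof -
  assume "nform t x a b" "nform t y c d"
  moreover from this have "x + y \<doteq> (emb a + emb b \<circledast> alpha) + (emb c + emb d \<circledast> alpha)"
    unfolding nform_def by (intro R.eqv_add) auto
  moreover have "(emb a + emb b \<circledast> alpha) + (emb c + emb d \<circledast> alpha) = emb (a + c) + emb (b + d) \<circledast> alpha"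
    by (simp add: embed_elem_simps pmul_distribs)
  ultimately show ?thesis unfolding nform_def using keys_add[of b d] by (auto simp only: kpaths_closed homog_simps)
qed

lemma nform_scl: "nform t x a b \<Longrightarrow> nform t (c \<bullet> x) (c \<bullet> a) (c \<bullet> b)"
proof -
  assume n: "nform t x a b"
  then have "c \<bullet> x \<doteq> c \<bullet> (emb a + emb b \<circledast> alpha)"
    unfolding nform_def by (intro R.eqv_scl) auto
  then show ?thesis using n keys_scl[of c b] unfolding nform_def
    by (auto simp: embed_elem_simps pmul_distribs scl_distrib)
qed

lemma ex_nform:
  assumes "x \<in> KR" "homog t x"
  shows "\<exists>a b. nform t x a b"
proof -
  have "Poly_Mapping.keys x \<subseteq> {\<pi>\<in>paths RQ. path_length \<pi> = t}" using assms by (auto simp: kpaths_iff homog_def)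
  then show ?thesis
  proof (induction rule: keys_span_induct)
    case zero
    then show ?case by (intro exI[of _ 0]) (auto simp: embed_elem_simps nform_def)
  next
    case (single \<pi> c)
    obtain u q where \<pi>: "\<pi> = (u, q)" by fastforce
    with single obtain a b where "nform t (path_elem \<pi>) a b" using nform_path[of u q] by auto
    then have "nform t (c \<bullet> path_elem \<pi>) (c \<bullet> a) (c \<bullet> b)" by (rule nform_scl)
    then show ?case by auto
  next
    case (add x y)
    then show ?case using nform_add by blast
  qed
qed

lemma ex_normal_form:
  assumes "x \<in> KR" shows "\<exists>a\<in>K. \<exists>b\<in>K. x \<doteq> emb a + emb b \<circledast> alpha"
  using assms
proof (induction rule: kpaths_induct)
  case zero
  then show ?case by (intro bexI[of _ 0]) (auto simp: embed_elem_simps)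
next
  case (single \<pi> c)
  then obtain a b where "nform (path_length \<pi>) (Poly_Mapping.single \<pi> c) a b"
    using ex_nform[of "Poly_Mapping.single \<pi> c" "path_length \<pi>"] homog_single by blast
  then show ?case unfolding nform_def by blast
next
  case (add x y)
  then obtain a b c d where *: "a \<in> K" "b \<in> K" "c \<in> K" "d \<in> K" "x \<doteq> emb a + emb b \<circledast> alpha" "y \<doteq> emb c + emb d \<circledast> alpha"
    by blast
  have "x + y \<doteq> (emb a + emb b \<circledast> alpha) + (emb c + emb d \<circledast> alpha)" by (intro R.eqv_add *)
  also have "(emb a + emb b \<circledast> alpha) + (emb c + emb d \<circledast> alpha) = emb (a + c) + emb (b + d) \<circledast> alpha"
    by (simp add: embed_elem_simps pmul_distribs)
  finally show ?case using * by blast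
qed

lemma emb_I: "x \<in> I \<Longrightarrow> emb x \<in> R.I"
proof (induction rule: I_induct)
  case (gen r)
  then show ?case by (intro R.I_gen) (unfold relations_eq, blast)
qed (auto simp: embed_elem_simps embed_mul[of Q _ _ \<tau>] intro: R.I_left R.I_right)

end

section \<open>The presentation of the trivial extension\<close>

type_synonym ('w, 'b, 'f) pathpair = "(('w, 'b) path \<Rightarrow>\<^sub>0 'f) \<times> ((('w, 'b) path \<Rightarrow>\<^sub>0 'f) \<Rightarrow> 'f)"

context stable_bq
begin

text \<open>
  The product of \<open>\<Lambda> \<ltimes> D\<Lambda>\<close> lifted to the path algebra. The second components are arbitrary
  functions, so that associativity needs no hypothesis.
\<close>

definition smul :: "('v, 'a, 'k) pathpair \<Rightarrow> ('v, 'a, 'k) pathpair \<Rightarrow> ('v, 'a, 'k) pathpair" where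
  "smul A B = (fst A \<star> fst B, \<lambda>z. snd B (z \<star> fst A) + snd A (fst B \<star> z))"

text \<open>The new arrow goes to the functional \<open>p_i^*\<close>, written as
  \<open>theta\<close> cut at two vertices. Cutting on both sides makes the products with vertices
  right for arbitrary \<open>z\<close>, even outside the path algebra; inside it the second cut
  changes nothing.\<close>

definition gen :: "'a + 'v \<Rightarrow> ('v, 'a, 'k) pathpair" where
  "gen = case_sum (\<lambda>a. (arrow_elem Q a, \<lambda>_. 0)) (\<lambda>i. (0, \<lambda>z. theta (ve i \<star> z \<star> ve (\<tau> i))))"

definition vert :: "'v \<Rightarrow> ('v, 'a, 'k) pathpair" where
  "vert u = (ve u, \<lambda>_. 0)"

definition pval :: "('v, 'a + 'v) path \<Rightarrow> ('v, 'a, 'k) pathpair" where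
  "pval \<pi> = fold (\<lambda>e. smul (gen e)) (snd \<pi>) (vert (fst \<pi>))"

definition lfun :: "((('v, 'a) path \<Rightarrow>\<^sub>0 'k) \<Rightarrow> 'k) \<Rightarrow> bool" where
  "lfun f \<longleftrightarrow> (\<forall>x y. f (x + y) = f x + f y) \<and> (\<forall>c x. f (c \<bullet> x) = c * f x)"

lemma lfunD: "lfun f \<Longrightarrow> f (x + y) = f x + f y" "lfun f \<Longrightarrow> f (c \<bullet> x) = c * f x"
  "lfun f \<Longrightarrow> f 0 = 0" "lfun f \<Longrightarrow> f (x - y) = f x - f y"
proof -
  assume f: "lfun f"
  show 1: "f (x + y) = f x + f y" for x y using f by (simp add: lfun_def)
  show 2: "f (c \<bullet> x) = c * f x" for c x using f by (simp add: lfun_def)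
  show "f 0 = 0" using 2[of 0 0] by simp
  show "f (x - y) = f x - f y" using 1[of "x - y" y] by simp
qed

lemma smul_assoc: "smul (smul A B) C = smul A (smul B C)"
  by (simp add: smul_def pmul_assoc add.assoc)

lemma lfun_smul: "lfun (snd A) \<Longrightarrow> lfun (snd B) \<Longrightarrow> lfun (snd (smul A B))"
  by (simp add: smul_def lfun_def pmul_distribs algebra_simps)

lemma smul_0: "lfun (snd A) \<Longrightarrow> smul A (0, \<lambda>_. 0) = (0, \<lambda>_. 0)" "lfun (snd A) \<Longrightarrow> smul (0, \<lambda>_. 0) A = (0, \<lambda>_. 0)"
  by (simp_all add: smul_def lfunD)

lemma lfun_gen: "lfun (snd (gen e))"
  by (cases e) (simp_all add: gen_def lfun_def pmul_distribs theta_linear)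

lemma lfun_vert: "lfun (snd (vert u))"
  by (simp add: vert_def lfun_def)

lemma pval_Nil [simp]: "pval (u, []) = vert u"
  by (simp add: pval_def)

lemma pval_snoc [simp]: "pval (u, q @ [e]) = smul (gen e) (pval (u, q))"
  by (simp add: pval_def)

lemma lfun_pval: "lfun (snd (pval (u, q)))"
  by (induction q rule: rev_induct) (simp_all add: lfun_vert lfun_smul lfun_gen)

lemma vert_vert: "smul (vert u) (vert v) = (if u = v then vert u else (0, \<lambda>_. 0))"
  by (simp add: smul_def vert_def pmul_single pcomp_def)

lemma vert_gen: "smul (vert u) (gen e) = (if u = head RQ e then gen e else (0, \<lambda>_. 0))"
proof (cases e)
  case (Inl a)
  then show ?thesis by (simp add: smul_def vert_def gen_def pmul_single pcomp_def)
next
  case (Inr i)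
  have "ve i \<star> (z \<star> ve u) \<star> ve (\<tau> i) = (if u = \<tau> i then ve i \<star> z \<star> ve (\<tau> i) else 0)" for z
    by (simp add: pmul_assoc pmul_single pcomp_def)
  with Inr show ?thesis by (simp add: smul_def vert_def gen_def theta_linear)
qed

lemma vert_pval: "smul (vert v) (pval (u, q)) = (if v = RQ.awlast u q then pval (u, q) else (0, \<lambda>_. 0))"
proof (induction q rule: rev_induct)
  case (snoc e q)
  show ?case by (simp add: smul_assoc[symmetric] vert_gen smul_0 lfun_pval)
qed (auto simp: vert_vert)

lemma pval_vert: "smul (pval (u, q)) (vert u) = pval (u, q)"
  by (induction q rule: rev_induct) (simp_all add: vert_vert smul_assoc)

lemma pval_append: "pval (u, q @ r) = smul (pval (RQ.awlast u q, r)) (pval (u, q))"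
proof (induction r rule: rev_induct)
  case (snoc e r)
  have "pval (u, q @ r @ [e]) = smul (gen e) (pval (u, q @ r))"
    using pval_snoc[of u "q @ r" e] by simp
  then show ?case using snoc by (simp add: smul_assoc)
qed (simp add: vert_pval)

text \<open>The value of a path absorbs the vertex at its start; inserted between the factors, this
  vertex kills the value of a path that ends elsewhere.\<close>

lemma pval_off:
  assumes "RQ.awlast u q \<noteq> v" shows "smul (pval (v, r)) (pval (u, q)) = (0, \<lambda>_. 0)"
proof -
  have "smul (pval (v, r)) (pval (u, q)) = smul (smul (pval (v, r)) (vert v)) (pval (u, q))"
    by (simp add: pval_vert)
  also have "\<dots> = smul (pval (v, r)) (smul (vert v) (pval (u, q)))" by (rule smul_assoc)
  finally show ?thesis using assms by (simp add: vert_pval smul_0 lfun_pval)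
qed

text \<open>\<open>Phi1\<close> and \<open>Phi2\<close> are the components of the algebra map that
  sends a path to the product of the values of its arrows; its target is the lifted trivial
  extension, before dividing by the old ideal.\<close>

definition Phi1 :: "(('v, 'a + 'v) path \<Rightarrow>\<^sub>0 'k) \<Rightarrow> (('v, 'a) path \<Rightarrow>\<^sub>0 'k)" where
  "Phi1 = lin (\<lambda>\<pi>. fst (pval \<pi>))"

definition Phi2 :: "(('v, 'a + 'v) path \<Rightarrow>\<^sub>0 'k) \<Rightarrow> (('v, 'a) path \<Rightarrow>\<^sub>0 'k) \<Rightarrow> 'k" where
  "Phi2 x z = linf (\<lambda>\<pi>. snd (pval \<pi>) z) x"

lemma Phi_simps:
  "Phi1 0 = 0" "Phi1 (x + y) = Phi1 x + Phi1 y" "Phi1 (x - y) = Phi1 x - Phi1 y" "Phi1 (c \<bullet> x) = c \<bullet> Phi1 x"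
  "Phi2 0 z = 0" "Phi2 (x + y) z = Phi2 x z + Phi2 y z" "Phi2 (x - y) z = Phi2 x z - Phi2 y z"
  "Phi2 (c \<bullet> x) z = c * Phi2 x z"
  by (simp_all add: Phi1_def Phi2_def lin_add lin_diff lin_scl linf_add linf_diff linf_scl)

lemma Phi_single:
  "Phi1 (Poly_Mapping.single \<pi> c) = c \<bullet> fst (pval \<pi>)" "Phi2 (Poly_Mapping.single \<pi> c) z = c * snd (pval \<pi>) z"
  by (simp_all add: Phi1_def Phi2_def)

lemma lfun_Phi2: "lfun (Phi2 x)"
proof (induction x rule: poly_mapping_lin_induct)
  case (single \<pi> c)
  obtain u q where "\<pi> = (u, q)" by fastforce
  then show ?case using lfun_pval[of u q] by (simp add: Phi_single lfun_def algebra_simps)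
qed (auto simp: lfun_def Phi_simps algebra_simps)

lemma Phi_single_mul:
  fixes \<pi> \<sigma> :: "('v, 'a + 'v) path"
  shows "Phi1 (pcomp RQ \<pi> \<sigma>) = fst (smul (pval \<pi>) (pval \<sigma>))"
    "Phi2 (pcomp RQ \<pi> \<sigma>) z = snd (smul (pval \<pi>) (pval \<sigma>)) z"
proof -
  obtain u q v r where *: "\<pi> = (v, r)" "\<sigma> = (u, q)" by fastforce
  show "Phi1 (pcomp RQ \<pi> \<sigma>) = fst (smul (pval \<pi>) (pval \<sigma>))"
    "Phi2 (pcomp RQ \<pi> \<sigma>) z = snd (smul (pval \<pi>) (pval \<sigma>)) z"
    unfolding * by (auto simp: pcomp_def Phi_single Phi_simps pval_append pval_off)
qed

lemma Phi1_mul: "Phi1 (x \<circledast> y) = Phi1 x \<star> Phi1 y"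
proof (induction x rule: poly_mapping_lin_induct)
  case (single \<pi> c)
  show ?case
    by (induction y rule: poly_mapping_lin_induct)
      (simp_all add: pmul_single Phi_simps Phi_single Phi_single_mul pmul_distribs smul_def mult.commute)
qed (simp_all add: pmul_distribs Phi_simps)

lemma Phi2_mul: "Phi2 (x \<circledast> y) z = Phi2 y (z \<star> Phi1 x) + Phi2 x (Phi1 y \<star> z)"
proof (induction x rule: poly_mapping_lin_induct)
  case (single \<pi> c)
  show ?case
  proof (induction y rule: poly_mapping_lin_induct)
    case (single \<sigma> d)
    obtain u q v r where *: "\<pi> = (v, r)" "\<sigma> = (u, q)" by fastforce
    have l: "lfun (snd (pval \<pi>))" "lfun (snd (pval \<sigma>))" unfolding * by (rule lfun_pval)+
    show ?case
      by (simp add: pmul_single Phi_simps Phi_single Phi_single_mul pmul_distribs smul_def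
          lfunD[OF l(1)] lfunD[OF l(2)] algebra_simps del: map_single)
  qed (simp_all add: pmul_distribs Phi_simps lfunD[OF lfun_Phi2])
qed (simp_all add: pmul_distribs Phi_simps lfunD[OF lfun_Phi2])

lemma pval_good:
  assumes "(u, q) \<in> paths RQ"
  shows "fst (pval (u, q)) \<in> K \<and> (\<forall>z\<in>I. snd (pval (u, q)) z = 0)"
  using assms
proof (induction q rule: rev_induct)
  case Nil
  then show ?case by (simp add: vert_def)
next
  case (snoc e q)
  then have e: "e \<in> arcs RQ" and uq: "(u, q) \<in> paths RQ" by (auto simp: RQ.paths_snoc)
  have g: "fst (gen e) \<in> K \<and> (\<forall>z\<in>I. snd (gen e) z = 0)"
    using e by (auto simp: gen_def theta_I I_left I_right)
  show ?case
    using snoc(1)[OF uq] g by (simp add: smul_def I_left I_right)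
qed

lemma Phi_good:
  assumes "x \<in> KR" shows "Phi1 x \<in> K" "z \<in> I \<Longrightarrow> Phi2 x z = 0"
proof -
  have "Phi1 x \<in> K \<and> (\<forall>z\<in>I. Phi2 x z = 0)"
    using assms
  proof (induction rule: kpaths_induct)
    case (single \<pi> c)
    obtain u q where "\<pi> = (u, q)" by fastforce
    then show ?case using pval_good[of u q] single by (auto simp: Phi_single)
  qed (auto simp: Phi_simps)
  then show "Phi1 x \<in> K" "z \<in> I \<Longrightarrow> Phi2 x z = 0" by auto
qed

lemma pval_emb:
  assumes "(u, q) \<in> paths Q" shows "pval (u, map Inl q) = (pe (u, q), \<lambda>_. 0)"
  using assms
proof (induction q rule: rev_induct)
  case (snoc a q)
  then have uq: "(u, q) \<in> paths Q" by (auto simp: paths_snoc)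
  have "pe (u, q @ [a]) = arrow_elem Q a \<star> pe (u, q)" using snoc(2) by (rule path_snoc_mul)
  then show ?case using snoc(1)[OF uq] by (simp add: smul_def gen_def)
qed (simp add: vert_def)

lemma Phi_emb:
  assumes "x \<in> K" shows "Phi1 (emb x) = x" "Phi2 (emb x) z = 0"
proof -
  have "Phi1 (emb x) = x \<and> Phi2 (emb x) z = 0"
    using assms
  proof (induction rule: kpaths_induct)
    case (single \<pi> c)
    then show ?case using pval_emb[of "fst \<pi>" "snd \<pi>"] by (simp add: Phi_single embed_elem_simps)
  qed (auto simp: Phi_simps embed_elem_simps)
  then show "Phi1 (emb x) = x" "Phi2 (emb x) z = 0" by auto
qed

lemma theta_sandwich: "z \<in> K \<Longrightarrow> i \<in> verts Q \<Longrightarrow> theta (ve i \<star> z \<star> ve (\<tau> i)) = theta (ve i \<star> z)"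
  using theta_vertex[of "ve i \<star> z" i] by (simp add: pmul_assoc[symmetric] pmul_single pcomp_def)

lemma Phi_al: "Phi1 (al i) = 0" "Phi2 (al i) z = theta (ve i \<star> z \<star> ve (\<tau> i))"
proof -
  have "pval (i, [Inr i]) = smul (gen (Inr i)) (vert i)" using pval_snoc[of i "[]"] by simp
  then show "Phi1 (al i) = 0" "Phi2 (al i) z = theta (ve i \<star> z \<star> ve (\<tau> i))"
    by (simp_all add: Phi_single smul_def gen_def vert_def pmul_assoc[symmetric] pmul_single pcomp_def)
qed

lemma Phi_alpha: "Phi1 alpha = 0" "z \<in> K \<Longrightarrow> Phi2 alpha z = theta z"
proof -
  have s: "Phi1 (\<Sum>i\<in>A. al i) = (\<Sum>i\<in>A. Phi1 (al i))" "Phi2 (\<Sum>i\<in>A. al i) z = (\<Sum>i\<in>A. Phi2 (al i) z)" for A z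
    by (induction A rule: infinite_finite_induct) (auto simp: Phi_simps)
  show "Phi1 alpha = 0" by (simp add: alpha_def s Phi_al)
  show "Phi2 alpha z = theta z" if "z \<in> K"
    using that by (simp add: alpha_def s Phi_al theta_sandwich theta_pone[of z])
qed

text \<open>The second component is \<open>b\<close> acting on \<open>theta\<close>. As all
  functionals on \<Lambda> have this form and only the class 0 acts on \<open>theta\<close> as zero,
  this computation decides both surjectivity and the kernel.\<close>

lemma Phi_nform:
  assumes "a \<in> K" "b \<in> K"
  shows "Phi1 (emb a + emb b \<circledast> alpha) = a" "z \<in> K \<Longrightarrow> Phi2 (emb a + emb b \<circledast> alpha) z = theta (z \<star> b)"
  using assms by (simp_all add: Phi_simps Phi1_mul Phi2_mul Phi_emb Phi_alpha)

text \<open>A product of two new arrows vanishes since both have first component 0, and the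
  commutation relation turns into the equation that defines \<nu>. Products cause no trouble because
  the second component of any image vanishes on the old ideal.\<close>

lemma Phi_I:
  assumes "x \<in> R.I" shows "Phi1 x \<in> I" "z \<in> K \<Longrightarrow> Phi2 x z = 0"
proof -
  have "Phi1 x \<in> I \<and> (\<forall>z\<in>K. Phi2 x z = 0)"
    using assms
  proof (induction rule: R.I_induct)
    case (gen r)
    then consider (1) r' where "r' \<in> \<rho>" "r = emb r'"
      | (2) i where "i \<in> verts Q" "r = al (\<tau> i) \<circledast> al i"
      | (3) \<beta> where "\<beta> \<in> arcs Q" "r = al (head Q \<beta>) \<circledast> emb (arrow_elem Q \<beta>) - emb (nu \<beta>) \<circledast> al (tail Q \<beta>)"
      unfolding relations_eq by blast
    then show ?case
    proof cases
      case 1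
      then show ?thesis using Phi_emb[of r'] I_gen[of r'] rho_K by auto
    next
      case 2
      then show ?thesis by (simp add: Phi1_mul Phi2_mul Phi_al lfunD[OF lfun_Phi2] theta_linear)
    next
      case 3
      let ?b = "arrow_elem Q \<beta>" and ?i = "tail Q \<beta>" and ?j = "head Q \<beta>"
      note n = nu_props[OF 3(1)]
      have bK: "?b \<in> K" and ij: "?i \<in> verts Q" "?j \<in> verts Q" using 3(1) by auto
      \<comment> \<open>The equation of \<nu>, with the vertex cuts of \<open>Phi_al\<close> around
        both sides; \<open>nu \<beta>\<close> absorbs the vertices at its ends, which lets the cuts
        be moved.\<close>
      have "theta (ve ?j \<star> (?b \<star> z) \<star> ve (\<tau> ?j)) = theta (ve ?i \<star> (z \<star> nu \<beta>) \<star> ve (\<tau> ?i))" if z: "z \<in> K" for z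
      proof -
        have vb: "ve ?j \<star> ?b = ?b" by (simp add: pmul_single pcomp_def)
        have "ve ?j \<star> (?b \<star> z) \<star> ve (\<tau> ?j) = ?b \<star> (z \<star> ve (\<tau> ?j))"
          unfolding pmul_assoc[symmetric] vb ..
        then have "theta (ve ?j \<star> (?b \<star> z) \<star> ve (\<tau> ?j)) = theta (z \<star> ve (\<tau> ?j) \<star> nu \<beta>)"
          using nakayama(2)[OF 3(1), of "z \<star> ve (\<tau> ?j)"] z ij by simp
        also have "\<dots> = theta (z \<star> nu \<beta>)" unfolding pmul_assoc n(3) ..
        also have "z \<star> nu \<beta> = z \<star> nu \<beta> \<star> ve (\<tau> ?i)" unfolding pmul_assoc n(4) ..
        also have "theta \<dots> = theta (ve ?i \<star> (z \<star> nu \<beta>))" using z n ij by (intro theta_vertex) auto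
        also have "\<dots> = theta (ve ?i \<star> (z \<star> nu \<beta>) \<star> ve (\<tau> ?i))" using z n ij by (intro theta_sandwich[symmetric]) auto
        finally show ?thesis .
      qed
      then show ?thesis unfolding 3(2)
        using n(1) bK by (simp add: Phi_simps Phi1_mul Phi2_mul Phi_al Phi_emb)
    qed
  next
    case (left a x)
    then show ?case using Phi_good[of a] by (simp add: Phi1_mul Phi2_mul I_left I_right)
  next
    case (right a x)
    then show ?case using Phi_good[of a] by (simp add: Phi1_mul Phi2_mul I_left I_right)
  qed (auto simp: Phi_simps)
  then show "Phi1 x \<in> I" "z \<in> K \<Longrightarrow> Phi2 x z = 0" by auto
qed

lemma Phi_eqv:
  assumes "x \<doteq> y" shows "Phi1 x \<approx> Phi1 y" "z \<in> K \<Longrightarrow> Phi2 x z = Phi2 y z"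
  using Phi_I[OF assms] by (auto simp: Phi_simps)

lemma theta_faithful:
  assumes "b \<in> K" "\<And>z. z \<in> K \<Longrightarrow> theta (z \<star> b) = 0" shows "b \<in> I"
  using nondegenerate[OF assms(1)] assms(2) kpaths_closed(7) by blast

text \<open>In normal form the two components recover \<open>a\<close> modulo the ideal, and
  \<open>b\<close> through the nondegenerate pairing. Hence the relations listed generate all
  relations.\<close>

lemma Phi_kernel:
  assumes x: "x \<in> KR" and 1: "Phi1 x \<in> I" and 2: "\<And>z. z \<in> K \<Longrightarrow> Phi2 x z = 0"
  shows "x \<in> R.I"
proof -
  obtain a b where ab: "a \<in> K" "b \<in> K" "x \<doteq> emb a + emb b \<circledast> alpha" using ex_normal_form[OF x] by blast
  have "Phi1 x \<approx> a" using Phi_eqv(1)[OF ab(3)] ab Phi_nform by simp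
  then have a: "a \<in> I" using 1 eqv_I by blast
  have "theta (z \<star> b) = 0" if "z \<in> K" for z
    using Phi_eqv(2)[OF ab(3) that] Phi_nform(2)[OF ab(1,2) that] 2[OF that] by simp
  then have b: "b \<in> I" using theta_faithful ab by blast
  have "emb a + emb b \<circledast> alpha \<in> R.I" by (intro R.I_add R.I_right emb_I a b alpha_closed)
  then show ?thesis using ab(3) R.eqv_I by blast
qed

section \<open>Passage to the quotients and the isomorphism onto the trivial extension\<close>

abbreviation "DA \<equiv> dual_bimodule BA"
abbreviation "TE \<equiv> dual_extension BA"

text \<open>Meaningful only for functions that are constant on the classes.\<close>

definition descend :: "((('v, 'a) path \<Rightarrow>\<^sub>0 'k) \<Rightarrow> 'k) \<Rightarrow> (('v, 'a) path \<Rightarrow>\<^sub>0 'k) set \<Rightarrow> 'k" where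
  "descend f = (\<lambda>Z\<in>carrier BA. f (SOME z. z \<in> K \<and> Z = cls z))"

lemma some_rep: "Z \<in> carrier BA \<Longrightarrow> (SOME z. z \<in> K \<and> Z = cls z) \<in> K \<and> Z = cls (SOME z. z \<in> K \<and> Z = cls z)"
  by (rule someI_ex) (auto simp: BA_simps)

lemma descend_cls:
  assumes "lfun f" "\<And>z. z \<in> I \<Longrightarrow> f z = 0" "z \<in> K"
  shows "descend f (cls z) = f z"
proof -
  let ?z = "SOME y. y \<in> K \<and> cls z = cls y"
  have "?z \<in> K \<and> cls z = cls ?z" using some_rep[of "cls z"] assms(3) by blast
  then have "z \<approx> ?z" by (simp only: cls_eq_iff)
  then have "f z = f ?z" using assms(2)[of "z - ?z"] lfunD[OF assms(1)] by simp
  then show ?thesis using assms(3) by (simp add: descend_def)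
qed

lemma descend_cong: "(\<And>z. z \<in> K \<Longrightarrow> f z = g z) \<Longrightarrow> descend f = descend g"
  unfolding descend_def using some_rep by (intro restrict_ext) blast

lemma descend_Phi2 [simp]: "x \<in> KR \<Longrightarrow> z \<in> K \<Longrightarrow> descend (Phi2 x) (cls z) = Phi2 x z"
  by (intro descend_cls lfun_Phi2 Phi_good)

lemma descend_extensional: "descend f \<in> extensional (carrier BA)"
  by (simp add: descend_def)

lemma extensional_BA_eqI:
  assumes "f \<in> extensional (carrier BA)" "g \<in> extensional (carrier BA)" "\<And>z. z \<in> K \<Longrightarrow> f (cls z) = g (cls z)"
  shows "f = g"
  using assms by (intro extensionalityI[of _ "carrier BA"]) (auto elim: cls_cases)

lemma DA_simps:
  "\<zero>\<^bsub>DA\<^esub> = (\<lambda>z\<in>carrier BA. 0)" "f \<oplus>\<^bsub>DA\<^esub> g = (\<lambda>z\<in>carrier BA. f z + g z)"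
  "c \<odot>\<^bsub>DA\<^esub> f = (\<lambda>z\<in>carrier BA. c * f z)" "lact DA a f = (\<lambda>z\<in>carrier BA. f (z \<otimes>\<^bsub>BA\<^esub> a))"
  "ract DA f a = (\<lambda>z\<in>carrier BA. f (a \<otimes>\<^bsub>BA\<^esub> z))"
  by (simp_all add: dual_bimodule_def)

lemma DA_carrier: "f \<in> carrier DA \<longleftrightarrow> f \<in> extensional (carrier BA) \<and>
    (\<forall>x\<in>K. \<forall>y\<in>K. f (cls (x + y)) = f (cls x) + f (cls y)) \<and> (\<forall>c. \<forall>x\<in>K. f (cls (c \<bullet> x)) = c * f (cls x))"
  by (simp add: dual_bimodule_def PiE_def BA_simps(1) ball_simps BA_add BA_smult)

lemma TE_simps:
  "carrier TE = carrier BA \<times> carrier DA" "\<one>\<^bsub>TE\<^esub> = (\<one>\<^bsub>BA\<^esub>, \<zero>\<^bsub>DA\<^esub>)"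
  "(a, x) \<otimes>\<^bsub>TE\<^esub> (b, y) = (a \<otimes>\<^bsub>BA\<^esub> b, lact DA a y \<oplus>\<^bsub>DA\<^esub> ract DA x b)"
  "(a, x) \<oplus>\<^bsub>TE\<^esub> (b, y) = (a \<oplus>\<^bsub>BA\<^esub> b, x \<oplus>\<^bsub>DA\<^esub> y)" "c \<odot>\<^bsub>TE\<^esub> (a, x) = (c \<odot>\<^bsub>BA\<^esub> a, c \<odot>\<^bsub>DA\<^esub> x)"
  by (simp_all add: trivial_extension_def)

definition phi :: "(('v, 'a + 'v) path \<Rightarrow>\<^sub>0 'k) set \<Rightarrow> (('v, 'a) path \<Rightarrow>\<^sub>0 'k) set \<times> ((('v, 'a) path \<Rightarrow>\<^sub>0 'k) set \<Rightarrow> 'k)" where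
  "phi X = (let x = SOME x. x \<in> KR \<and> X = R.cls x in (cls (Phi1 x), descend (Phi2 x)))"

lemma phi_cls:
  assumes "x \<in> KR" shows "phi (R.cls x) = (cls (Phi1 x), descend (Phi2 x))"
proof -
  let ?x = "SOME y. y \<in> KR \<and> R.cls x = R.cls y"
  have "?x \<in> KR \<and> R.cls x = R.cls ?x" by (rule someI_ex) (use assms in blast)
  from this[THEN conjunct2] have "x \<doteq> ?x" by (rule R.cls_eq_iff[THEN iffD1])
  then have "?x \<doteq> x" by (rule R.eqv_sym)
  then have "cls (Phi1 ?x) = cls (Phi1 x)" "descend (Phi2 ?x) = descend (Phi2 x)"
    unfolding cls_eq_iff using Phi_eqv by (auto intro: descend_cong)
  then show ?thesis by (simp add: phi_def Let_def)
qed

lemma descend_Phi2_carrier: "x \<in> KR \<Longrightarrow> descend (Phi2 x) \<in> carrier DA"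
  unfolding DA_carrier by (simp add: descend_extensional lfunD[OF lfun_Phi2])

lemma phi_alg_iso: "phi \<in> alg_iso (bound_algebra RQ \<rho>R) TE"
proof -
  have hom: "phi \<in> ring_hom R.BA TE"
  proof (rule ring_hom_memI)
    fix X assume "X \<in> carrier R.BA"
    then obtain x where x: "x \<in> KR" "X = R.cls x" by (rule R.cls_cases)
    then show "phi X \<in> carrier TE" by (simp add: phi_cls TE_simps Phi_good descend_Phi2_carrier)
    fix Y assume "Y \<in> carrier R.BA"
    then obtain y where y: "y \<in> KR" "Y = R.cls y" by (rule R.cls_cases)
    have K: "Phi1 x \<in> K" "Phi1 y \<in> K" using x y Phi_good by auto
    have m: "descend (Phi2 (x \<circledast> y)) = lact DA (cls (Phi1 x)) (descend (Phi2 y)) \<oplus>\<^bsub>DA\<^esub> ract DA (descend (Phi2 x)) (cls (Phi1 y))"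
      by (rule extensional_BA_eqI) (use x y K in \<open>simp_all add: descend_extensional DA_simps BA_mult Phi2_mul\<close>)
    show "phi (X \<otimes>\<^bsub>R.BA\<^esub> Y) = phi X \<otimes>\<^bsub>TE\<^esub> phi Y"
      using x y K m by (simp add: R.BA_mult phi_cls TE_simps BA_mult Phi1_mul)
    have a: "descend (Phi2 (x + y)) = descend (Phi2 x) \<oplus>\<^bsub>DA\<^esub> descend (Phi2 y)"
      by (rule extensional_BA_eqI) (use x y in \<open>simp_all add: descend_extensional DA_simps Phi_simps\<close>)
    show "phi (X \<oplus>\<^bsub>R.BA\<^esub> Y) = phi X \<oplus>\<^bsub>TE\<^esub> phi Y"
      using x y K a by (simp add: R.BA_add phi_cls TE_simps BA_add Phi_simps)
  next
    have e: "pone RQ = emb (pone Q)"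
      unfolding RQ.pone_sum pone_sum embed_elem_lin lin_sum by simp
    have z: "descend (Phi2 (emb (pone Q))) = \<zero>\<^bsub>DA\<^esub>"
      by (rule extensional_BA_eqI) (simp_all add: descend_extensional DA_simps Phi_emb)
    show "phi \<one>\<^bsub>R.BA\<^esub> = \<one>\<^bsub>TE\<^esub>"
      using z by (simp add: R.BA_simps e phi_cls TE_simps BA_simps Phi_emb)
  qed
  have sc: "phi (c \<odot>\<^bsub>R.BA\<^esub> X) = c \<odot>\<^bsub>TE\<^esub> phi X" if X: "X \<in> carrier R.BA" for c X
  proof -
    obtain x where x: "x \<in> KR" "X = R.cls x" using X by (rule R.cls_cases)
    have "descend (Phi2 (c \<bullet> x)) = c \<odot>\<^bsub>DA\<^esub> descend (Phi2 x)"
      by (rule extensional_BA_eqI) (use x in \<open>simp_all add: descend_extensional DA_simps Phi_simps\<close>)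
    then show ?thesis using x by (simp add: R.BA_smult phi_cls TE_simps BA_smult Phi_simps Phi_good)
  qed
  have "inj_on phi (carrier R.BA)"
  proof (rule inj_onI)
    fix X Y assume XY: "X \<in> carrier R.BA" "Y \<in> carrier R.BA" "phi X = phi Y"
    obtain x where x: "x \<in> KR" "X = R.cls x" using XY(1) by (rule R.cls_cases)
    obtain y where y: "y \<in> KR" "Y = R.cls y" using XY(2) by (rule R.cls_cases)
    have e: "cls (Phi1 x) = cls (Phi1 y)" "descend (Phi2 x) = descend (Phi2 y)"
      using XY(3) x y by (simp_all add: phi_cls)
    have "x - y \<in> R.I"
    proof (rule Phi_kernel)
      show "x - y \<in> KR" using x y by auto
      show "Phi1 (x - y) \<in> I" using e(1) by (simp add: cls_eq_iff Phi_simps)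
      fix z assume "z \<in> K"
      then show "Phi2 (x - y) z = 0"
        using fun_cong[OF e(2), of "cls z"] x y by (simp add: Phi_simps)
    qed
    then show "X = Y" using x y by (simp add: R.cls_eq_iff)
  qed
  moreover have "\<exists>X\<in>carrier R.BA. phi X = P" if P: "P \<in> carrier TE" for P
  proof -
    obtain A f where Pf: "P = (A, f)" "A \<in> carrier BA" "f \<in> carrier DA" using P by (auto simp: TE_simps)
    obtain a where a: "a \<in> K" "A = cls a" using Pf(2) by (rule cls_cases)
    note f = Pf(3)[unfolded DA_carrier]
    have f0: "f (cls 0) = 0" using f[THEN conjunct2, THEN conjunct2, rule_format, of 0 0] by simp
    \<comment> \<open>Surjectivity on the dual part is the representation of functionals:
      \<open>b\<close> times \<open>alpha\<close> has the image \<open>f\<close>.\<close>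
    have "\<exists>b\<in>K. \<forall>z\<in>K. f (cls z) = theta (z \<star> b)"
    proof (rule represent)
      fix x assume "x \<in> I"
      then have "cls x = cls 0" by (simp add: cls_eq_iff)
      then show "f (cls x) = 0" using f0 by simp
    qed (use f in auto)
    then obtain b where b: "b \<in> K" "\<forall>z\<in>K. f (cls z) = theta (z \<star> b)" by blast
    let ?x = "emb a + emb b \<circledast> alpha"
    have xK: "?x \<in> KR" using a b by auto
    have "descend (Phi2 ?x) = f"
    proof (rule extensional_BA_eqI)
      fix z assume z: "z \<in> K"
      then show "descend (Phi2 ?x) (cls z) = f (cls z)"
        using descend_Phi2[OF xK z] Phi_nform(2)[OF a(1) b(1) z] b(2) by simp
    qed (use f descend_extensional in auto)
    then have "phi (R.cls ?x) = P"
      using phi_cls[OF xK] Phi_nform(1)[OF a(1) b(1)] Pf a by simp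
    then show ?thesis using xK by blast
  qed
  then have "phi ` carrier R.BA = carrier TE"
  proof (intro equalityI subsetI)
    fix P assume "P \<in> phi ` carrier R.BA"
    then show "P \<in> carrier TE" using hom unfolding ring_hom_def by blast
  next
    fix P assume "P \<in> carrier TE"
    then show "P \<in> phi ` carrier R.BA" using \<open>\<And>P. P \<in> carrier TE \<Longrightarrow> \<exists>X\<in>carrier R.BA. phi X = P\<close> by blast
  qed
  ultimately show ?thesis
    using hom sc unfolding alg_iso_def ring_iso_def bij_betw_def by blast
qed

lemma phi_values:
  assumes "bound_path_basis Q \<rho> B" "\<forall>i\<in>verts Q. p i \<in> B"
  shows "i \<in> verts Q \<Longrightarrow> phi (R.cls (vertex_elem i)) = (cls (vertex_elem i), \<zero>\<^bsub>DA\<^esub>)"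
    and "\<beta> \<in> arcs Q \<Longrightarrow> phi (R.cls (arrow_elem RQ (Inl \<beta>))) = (cls (arrow_elem Q \<beta>), \<zero>\<^bsub>DA\<^esub>)"
    and "i \<in> verts Q \<Longrightarrow> phi (R.cls (arrow_elem RQ (Inr i))) = (\<zero>\<^bsub>BA\<^esub>, dual_basis_elem Q \<rho> B (p i))"
proof -
  have e: "phi (R.cls (emb x)) = (cls x, \<zero>\<^bsub>DA\<^esub>)" if "x \<in> K" for x
  proof -
    have "descend (Phi2 (emb x)) = \<zero>\<^bsub>DA\<^esub>"
      by (rule extensional_BA_eqI) (use that in \<open>simp_all add: descend_extensional DA_simps Phi_emb\<close>)
    then show ?thesis using that by (simp add: phi_cls Phi_emb)
  qed
  show "phi (R.cls (vertex_elem i)) = (cls (vertex_elem i), \<zero>\<^bsub>DA\<^esub>)" if "i \<in> verts Q"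
    using e[of "ve i"] that by simp
  show "phi (R.cls (arrow_elem RQ (Inl \<beta>))) = (cls (arrow_elem Q \<beta>), \<zero>\<^bsub>DA\<^esub>)" if "\<beta> \<in> arcs Q"
    using e[of "arrow_elem Q \<beta>"] that by (simp add: embed_elem_simps)
  show "phi (R.cls (arrow_elem RQ (Inr i))) = (\<zero>\<^bsub>BA\<^esub>, dual_basis_elem Q \<rho> B (p i))" if i: "i \<in> verts Q"
  proof -
    have alK: "al i \<in> KR" using i by auto
    have "descend (Phi2 (al i)) = dual_basis_elem Q \<rho> B (p i)"
    proof (rule extensional_BA_eqI)
      show "dual_basis_elem Q \<rho> B (p i) \<in> extensional (carrier BA)" by (simp add: dual_basis_elem_def)
      fix z assume z: "z \<in> K"
      have "p i \<in> B" using assms(2) i by blast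
      then show "descend (Phi2 (al i)) (cls z) = dual_basis_elem Q \<rho> B (p i) (cls z)"
        using descend_Phi2[OF alK z] dual_basis_elem_p[OF assms(1) i _ z] theta_sandwich[OF z i] by (simp add: Phi_al)
    qed (rule descend_extensional)
    then show ?thesis using phi_cls[OF alK] by (simp add: Phi_al BA_simps)
  qed
qed

end

section \<open>Isomorphisms of bound quiver algebras\<close>

text \<open>Bijections between the arrows are chosen separately for every pair of vertices; they
  glue because an arrow determines its ends.\<close>

lemma digraph_isoI:
  assumes G: "fin_digraph G" and H: "fin_digraph H" and \<sigma>: "bij_betw \<sigma> (verts G) (verts H)"
    and c: "\<And>i j. i \<in> verts G \<Longrightarrow> j \<in> verts G \<Longrightarrow>
      card {a\<in>arcs G. tail G a = i \<and> head G a = j} = card {b\<in>arcs H. tail H b = \<sigma> i \<and> head H b = \<sigma> j}"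
  shows "digraph_iso G H"
proof -
  interpret G: fin_digraph G by fact
  interpret H: fin_digraph H by fact
  let ?A = "\<lambda>i j. {a\<in>arcs G. tail G a = i \<and> head G a = j}"
  let ?B = "\<lambda>i j. {b\<in>arcs H. tail H b = i \<and> head H b = j}"
  have ex: "\<exists>h. bij_betw h (?A i j) (?B (\<sigma> i) (\<sigma> j))" if "i \<in> verts G" "j \<in> verts G" for i j
    by (rule finite_same_card_bij) (use c[OF that] in auto)
  define h where "h = (\<lambda>i j. SOME h. bij_betw h (?A i j) (?B (\<sigma> i) (\<sigma> j)))"
  have h: "bij_betw (h i j) (?A i j) (?B (\<sigma> i) (\<sigma> j))" if "i \<in> verts G" "j \<in> verts G" for i j
    unfolding h_def by (rule someI_ex[OF ex[OF that]])
  define f where "f = (\<lambda>a. h (tail G a) (head G a) a)"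
  have f: "f a \<in> ?B (\<sigma> (tail G a)) (\<sigma> (head G a))" if "a \<in> arcs G" for a
    using bij_betwE[OF h[of "tail G a" "head G a"]] that by (simp add: f_def)
  have inj_\<sigma>: "i = j" if "\<sigma> i = \<sigma> j" "i \<in> verts G" "j \<in> verts G" for i j
    using \<sigma> that by (auto simp: bij_betw_def dest: inj_onD)
  have inj: "inj_on f (arcs G)"
  proof (rule inj_onI)
    fix a b assume ab: "a \<in> arcs G" "b \<in> arcs G" "f a = f b"
    then have "\<sigma> (tail G a) = \<sigma> (tail G b)" "\<sigma> (head G a) = \<sigma> (head G b)" using f[of a] f[of b] by auto
    then have e: "tail G a = tail G b" "head G a = head G b" using inj_\<sigma> ab by auto
    have "inj_on (h (tail G a) (head G a)) (?A (tail G a) (head G a))"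
      using h ab by (auto simp: bij_betw_def)
    then show "a = b" by (rule inj_onD) (use ab e in \<open>auto simp: f_def\<close>)
  qed
  have im: "f ` arcs G = arcs H"
  proof (intro equalityI subsetI)
    fix b assume b: "b \<in> arcs H"
    obtain i j where ij: "i \<in> verts G" "j \<in> verts G" "\<sigma> i = tail H b" "\<sigma> j = head H b"
      using \<sigma> H.tail_in_verts[OF b] H.head_in_verts[OF b] unfolding bij_betw_def by (metis imageE)
    then have "b \<in> h i j ` ?A i j" using h[OF ij(1,2)] b by (simp add: bij_betw_def)
    then show "b \<in> f ` arcs G" by (auto simp: f_def)
  qed (use f in auto)
  \<comment> \<open>An isomorphism of digraphs demands equality of records, so head and tail are
    taken over from \<open>H\<close> as functions, also outside its arcs.\<close>
  let ?h = "\<lparr>iso_verts = \<sigma>, iso_arcs = f, iso_head = head H, iso_tail = tail H\<rparr>"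
  have "pre_digraph.digraph_isomorphism G ?h"
    unfolding pre_digraph.digraph_isomorphism_def
    using G.wf_digraph_axioms inj f \<sigma> by (auto simp: bij_betw_def)
  moreover have "H = app_iso ?h G"
    using im \<sigma> by (simp add: app_iso_def bij_betw_def)
  ultimately show ?thesis unfolding digraph_iso_def by blast
qed

text \<open>A trivial path factors only into itself twice, so each vertex coefficient is
  multiplicative; at a vertex of the quiver it is a character of the path algebra.\<close>

lemma mul_lookup_vertex: "pmul Q x y $$ (m, []) = x $$ (m, []) * y $$ (m, [])"
proof (induction x rule: poly_mapping_lin_induct)
  case (single \<pi> c)
  show ?case
    by (induction y rule: poly_mapping_lin_induct)
      (auto simp: pmul_single pcomp_def pmul_distribs lookup_add lookup_single when_def algebra_simps prod_eq_iff)
qed (auto simp: pmul_distribs lookup_add algebra_simps)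

lemma pcomp_lookup_arrow:
  "pcomp Q \<pi> \<sigma> $$ (u, [g]) = (if \<pi> = (path_end Q \<sigma>, []) \<and> \<sigma> = (u, [g]) \<or>
     \<pi> = (path_end Q \<sigma>, [g]) \<and> \<sigma> = (u, []) then 1 else 0)"
  by (cases \<pi>; cases \<sigma>) (auto simp: pcomp_def lookup_single when_def append_eq_Cons_conv)

context quiver
begin

text \<open>An arrow has only two factorizations, one with the vertex at its head and one with the
  vertex at its tail: a Leibniz rule for the characters at the two ends.\<close>

lemma mul_lookup_arrow:
  assumes "x \<in> kpaths Q" "y \<in> kpaths Q"
  shows "pmul Q x y $$ (tail Q g, [g]) =
    x $$ (head Q g, []) * y $$ (tail Q g, [g]) + x $$ (tail Q g, [g]) * y $$ (tail Q g, [])"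
  using assms(1)
proof (induction rule: kpaths_induct)
  case (single \<pi> c)
  show ?case using assms(2)
  proof (induction rule: kpaths_induct)
    case (single \<sigma> d)
    show ?case
      by (auto simp: pmul_single pcomp_lookup_arrow lookup_single when_def)
  qed (auto simp: pmul_distribs lookup_add algebra_simps)
qed (auto simp: pmul_distribs lookup_add algebra_simps)

lemma fil1_iff: "x \<in> kpaths Q \<Longrightarrow> fil 1 x \<longleftrightarrow> (\<forall>m\<in>verts Q. x $$ (m, []) = 0)"
proof
  assume x: "x \<in> kpaths Q"
  show "fil 1 x \<Longrightarrow> \<forall>m\<in>verts Q. x $$ (m, []) = 0" by (force simp: fil_def in_keys_iff)
  assume a: "\<forall>m\<in>verts Q. x $$ (m, []) = 0"
  show "fil 1 x"
    unfolding fil_def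
  proof
    fix \<pi> assume k: "\<pi> \<in> Poly_Mapping.keys x"
    obtain u q where \<pi>: "\<pi> = (u, q)" by fastforce
    have "\<pi> \<in> paths Q" using k x by (auto simp: kpaths_iff)
    then have "q \<noteq> []" using a k \<pi> by (auto simp: in_keys_iff)
    then show "1 \<le> path_length \<pi>" using \<pi> by (cases q) auto
  qed
qed

lemma fil2I:
  assumes "x \<in> kpaths Q" "\<And>m. m \<in> verts Q \<Longrightarrow> x $$ (m, []) = 0" "\<And>g. g \<in> arcs Q \<Longrightarrow> x $$ (tail Q g, [g]) = 0"
  shows "fil 2 x"
  unfolding fil_def
proof
  fix \<pi> assume k: "\<pi> \<in> Poly_Mapping.keys x"
  obtain u q where \<pi>: "\<pi> = (u, q)" by fastforce
  have P: "\<pi> \<in> paths Q" using k assms(1) by (auto simp: kpaths_iff)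
  have "q \<noteq> []" using P assms(2) k \<pi> by (auto simp: in_keys_iff)
  moreover have "q \<noteq> [g]" for g using P assms(3) k \<pi> by (auto simp: in_keys_iff)
  ultimately show "2 \<le> path_length \<pi>" using \<pi> by (cases q; cases "tl q") auto
qed

end

context bq
begin

lemma simple_action_right:
  assumes s: "s \<in> K" "i \<in> verts Q" "s \<star> ve i \<approx> s" "\<And>a. a \<in> arcs Q \<Longrightarrow> s \<star> arrow_elem Q a \<in> I"
    and "x \<in> K"
  shows "s \<star> x \<approx> x $$ (i, []) \<bullet> s"
  using assms(5)
proof (induction rule: kpaths_induct)
  case (single \<pi> c)
  obtain u q where \<pi>: "\<pi> = (u, q)" by fastforce
  have "s \<star> pe \<pi> \<approx> (if \<pi> = (i, []) then s else 0)"
  proof (cases q rule: rev_cases)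
    case Nil
    show ?thesis
    proof (cases "u = i")
      case True
      then show ?thesis using s \<pi> Nil by simp
    next
      case False
      have "s \<star> ve u \<approx> (s \<star> ve i) \<star> ve u"
        using single \<pi> Nil s by (intro eqv_right eqv_sym[OF s(3)]) auto
      also have "(s \<star> ve i) \<star> ve u = 0"
        using False by (simp add: pmul_assoc pmul_single pcomp_def)
      finally show ?thesis using \<pi> Nil False by simp
    qed
  next
    case (snoc r a)
    have P: "(u, r @ [a]) \<in> paths Q" using single \<pi> snoc by simp
    have "pe (u, r @ [a]) = arrow_elem Q a \<star> pe (u, r)" using P by (rule path_snoc_mul)
    then have "s \<star> pe \<pi> = (s \<star> arrow_elem Q a) \<star> pe (u, r)" using \<pi> snoc by (simp add: pmul_assoc)
    moreover have "(s \<star> arrow_elem Q a) \<star> pe (u, r) \<in> I"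
    proof (rule I_right)
      show "pe (u, r) \<in> K" "s \<star> arrow_elem Q a \<in> I" using P s(4)[of a] by (auto simp: paths_snoc)
    qed
    ultimately show ?thesis using \<pi> snoc by simp
  qed
  then have "c \<bullet> (s \<star> pe \<pi>) \<approx> c \<bullet> (if \<pi> = (i, []) then s else 0)" by (rule eqv_scl)
  then show ?case
    using pmul_scl_right[of Q s c "pe \<pi>"] by (auto simp: lookup_single when_def split: if_splits)
next
  case (add x y)
  then show ?case using eqv_add[of "s \<star> x" "x $$ (i, []) \<bullet> s" "s \<star> y" "y $$ (i, []) \<bullet> s"]
    by (simp add: pmul_distribs lookup_add scl_distrib)
qed auto

end

text \<open>
  Unlike stability, which speaks about paths, these properties are invariant under ungraded
  isomorphisms; stability with trivial translation follows from them.
\<close>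

locale symmetric_top = bq Q \<rho> for Q :: "('v, 'a) pre_digraph" and \<rho> :: "(('v, 'a) path \<Rightarrow>\<^sub>0 'k::field) set" +
  fixes L :: nat and \<omega> :: "'v \<Rightarrow> ('v, 'a) path \<Rightarrow>\<^sub>0 'k"
  assumes long_I: "\<And>\<pi>. \<pi> \<in> paths Q \<Longrightarrow> L < path_length \<pi> \<Longrightarrow> pe \<pi> \<in> I"
    and socle: "\<And>x. x \<in> K \<Longrightarrow> (\<And>y. y \<in> K \<Longrightarrow> fil 1 y \<Longrightarrow> x \<star> y \<in> I \<and> y \<star> x \<in> I) \<Longrightarrow>
      \<exists>y\<in>K. fil L y \<and> x \<approx> y"
    and top_span: "\<And>y. y \<in> K \<Longrightarrow> fil L y \<Longrightarrow> \<exists>c. y \<approx> (\<Sum>i\<in>verts Q. c i \<bullet> \<omega> i)"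
    and omega_closed: "\<And>i. i \<in> verts Q \<Longrightarrow> \<omega> i \<in> K"
    and omega_fil: "\<And>i. i \<in> verts Q \<Longrightarrow> \<exists>y\<in>K. fil L y \<and> \<omega> i \<approx> y"
    and omega_nz: "\<And>i. i \<in> verts Q \<Longrightarrow> \<omega> i \<notin> I"
    and omega_left: "\<And>i x. i \<in> verts Q \<Longrightarrow> x \<in> K \<Longrightarrow> x \<star> \<omega> i \<approx> x $$ (i, []) \<bullet> \<omega> i"
    and omega_right: "\<And>i x. i \<in> verts Q \<Longrightarrow> x \<in> K \<Longrightarrow> \<omega> i \<star> x \<approx> x $$ (i, []) \<bullet> \<omega> i"
begin

text \<open>Multiplying the expansion by the end vertex on the left leaves one summand; multiplying
  by a different start vertex on the right kills that one too.\<close>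

lemma top_path:
  assumes \<pi>: "\<pi> \<in> paths Q" "path_length \<pi> = L"
  shows "\<exists>c. pe \<pi> \<approx> c \<bullet> \<omega> (path_end Q \<pi>)" "fst \<pi> \<noteq> path_end Q \<pi> \<Longrightarrow> pe \<pi> \<in> I"
proof -
  let ?i = "fst \<pi>" and ?j = "path_end Q \<pi>"
  have ij: "?i \<in> verts Q" "?j \<in> verts Q" using paths_verts \<pi> by auto
  have pK: "pe \<pi> \<in> K" "fil L (pe \<pi>)" using \<pi> by (auto simp: fil_def)
  obtain c where c: "pe \<pi> \<approx> (\<Sum>i\<in>verts Q. c i \<bullet> \<omega> i)" using top_span[OF pK] by (rule exE)
  have "pe \<pi> = ve ?j \<star> pe \<pi>" using pK by (simp add: vertex_mul)
  also have "ve ?j \<star> pe \<pi> \<approx> ve ?j \<star> (\<Sum>i\<in>verts Q. c i \<bullet> \<omega> i)" using c ij by (intro eqv_left) auto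
  also have "ve ?j \<star> (\<Sum>i\<in>verts Q. c i \<bullet> \<omega> i) = (\<Sum>i\<in>verts Q. c i \<bullet> (ve ?j \<star> \<omega> i))"
    by (simp only: pmul_sum_right pmul_scl_right)
  also have "(\<Sum>i\<in>verts Q. c i \<bullet> (ve ?j \<star> \<omega> i)) \<approx> (\<Sum>i\<in>verts Q. c i \<bullet> (ve ?j $$ (i, []) \<bullet> \<omega> i))"
    by (rule eqv_sum, rule eqv_scl, rule omega_left) (use ij in auto)
  also have "(\<Sum>i\<in>verts Q. c i \<bullet> (ve ?j $$ (i, []) \<bullet> \<omega> i)) = (\<Sum>i\<in>verts Q. if i = ?j then c i \<bullet> \<omega> i else 0)"
    by (intro sum.cong) (auto simp: lookup_single when_def)
  also have "\<dots> = c ?j \<bullet> \<omega> ?j" using ij by simp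
  finally have 1: "pe \<pi> \<approx> c ?j \<bullet> \<omega> ?j" .
  then show "\<exists>c. pe \<pi> \<approx> c \<bullet> \<omega> ?j" by (rule exI)
  assume ne: "?i \<noteq> ?j"
  have "pe \<pi> = pe \<pi> \<star> ve ?i" using pK by (simp add: mul_vertex)
  also have "pe \<pi> \<star> ve ?i \<approx> (c ?j \<bullet> \<omega> ?j) \<star> ve ?i" using 1 ij by (intro eqv_right) auto
  also have "(c ?j \<bullet> \<omega> ?j) \<star> ve ?i = c ?j \<bullet> (\<omega> ?j \<star> ve ?i)" by (simp only: pmul_scl_left)
  also have "c ?j \<bullet> (\<omega> ?j \<star> ve ?i) \<approx> c ?j \<bullet> (ve ?i $$ (?j, []) \<bullet> \<omega> ?j)"
    by (rule eqv_scl, rule omega_right) (use ij in auto)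
  also have "c ?j \<bullet> (ve ?i $$ (?j, []) \<bullet> \<omega> ?j) = 0" using ne by (simp add: lookup_single when_def)
  finally show "pe \<pi> \<in> I" by simp
qed

lemma maximal_if_top:
  assumes "bound_path Q \<rho> \<pi>" "path_length \<pi> = L"
  shows "maximal_bound_path Q \<rho> \<pi>"
  unfolding maximal_bound_path_def
proof (intro conjI allI impI)
  fix u q r assume "path_end Q (u, q) = fst \<pi> \<and> bound_path Q \<rho> (u, q @ snd \<pi> @ r)"
  then have "path_length (u, q @ snd \<pi> @ r) \<le> L"
    by (meson bound_path_iff long_I not_le_imp_less)
  then show "q = []" "r = []" using assms by auto
qed fact

text \<open>Maximality says that every prolongation vanishes, so the path lies in the socle and is
  congruent to an element of degrees at least \<open>L\<close>. The ideal being graded, a nonzero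
  path cannot be shorter, and longer ones vanish.\<close>

lemma maximal_length:
  assumes m: "maximal_bound_path Q \<rho> \<pi>" shows "path_length \<pi> = L"
proof -
  have b: "\<pi> \<in> paths Q" "pe \<pi> \<notin> I" using m by (auto simp: maximal_bound_path_def bound_path_iff)
  have ext: "pe (u, q @ snd \<pi> @ r) \<in> I"
    if "path_end Q (u, q) = fst \<pi>" "(u, q @ snd \<pi> @ r) \<in> paths Q" "q \<noteq> [] \<or> r \<noteq> []" for u q r
    using m that unfolding maximal_bound_path_def bound_path_iff by blast
  have "\<exists>y\<in>K. fil L y \<and> pe \<pi> \<approx> y"
  proof (rule socle)
    show "pe \<pi> \<in> K" using b by auto
    fix y assume y: "y \<in> K" "fil 1 y"
    then have "Poly_Mapping.keys y \<subseteq> {\<sigma>\<in>paths Q. snd \<sigma> \<noteq> []}" by (auto simp: kpaths_iff fil_def)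
    then show "pe \<pi> \<star> y \<in> I \<and> y \<star> pe \<pi> \<in> I"
    proof (induction rule: keys_span_induct)
      case (single \<sigma> c)
      have "pcomp Q \<pi> \<sigma> \<in> I"
        using ext[of "fst \<sigma>" "snd \<sigma>" "[]"] single b paths_append[of "fst \<sigma>" "snd \<sigma>" "snd \<pi>"]
        by (auto simp: pcomp_def)
      moreover have "pcomp Q \<sigma> \<pi> \<in> I"
        using ext[of "fst \<pi>" "[]" "snd \<sigma>"] single b paths_append[of "fst \<pi>" "snd \<pi>" "snd \<sigma>"]
        by (auto simp: pcomp_def)
      ultimately show ?case by (auto simp: pmul_single simp del: map_single)
    qed (auto simp: pmul_distribs)
  qed
  then obtain y where y: "y \<in> K" "fil L y" "pe \<pi> \<approx> y" by blast
  have "\<not> path_length \<pi> < L"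
  proof
    assume "path_length \<pi> < L"
    then have "hcomp (path_length \<pi>) y = 0" using y(2) hcomp_fil by blast
    then have "hcomp (path_length \<pi>) (pe \<pi>) \<in> I" using eqv_hcomp[OF y(3), of "path_length \<pi>"] by simp
    then show False using b by simp
  qed
  moreover have "\<not> L < path_length \<pi>" using long_I b by blast
  ultimately show ?thesis by simp
qed

lemma stable_id:
  assumes "1 \<le> L" shows "stable_bound_quiver (L + 1) Q \<rho> id"
  unfolding stable_bound_quiver_def
proof (intro conjI exI[of _ L] allI impI ballI)
  fix i assume i: "i \<in> verts Q"
  obtain y where y: "y \<in> K" "fil L y" "\<omega> i \<approx> y" using omega_fil[OF i] by blast
  \<comment> \<open>Cutting at \<open>i\<close> on both sides does not change the class of
    \<open>\<omega> i\<close>, so some path in \<open>y\<close> that runs from \<open>i\<close> to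
    \<open>i\<close> is nonzero in the quotient.\<close>
  let ?y = "ve i \<star> y \<star> ve i"
  have "ve i \<star> \<omega> i \<star> ve i \<approx> (ve i $$ (i, []) \<bullet> \<omega> i) \<star> ve i"
    using i by (intro eqv_right omega_left) auto
  also have "(ve i $$ (i, []) \<bullet> \<omega> i) \<star> ve i = \<omega> i \<star> ve i" by simp
  also have "\<omega> i \<star> ve i \<approx> ve i $$ (i, []) \<bullet> \<omega> i" using i by (intro omega_right) auto
  also have "ve i $$ (i, []) \<bullet> \<omega> i = \<omega> i" by simp
  finally have "ve i \<star> \<omega> i \<star> ve i \<approx> \<omega> i" .
  moreover have "ve i \<star> \<omega> i \<star> ve i \<approx> ?y" using i y by (intro eqv_right eqv_left) auto
  ultimately have nI: "?y \<notin> I" using omega_nz[OF i] eqv_I by blast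
  have sm: "(\<Sum>\<pi>\<in>Poly_Mapping.keys ?y. ?y $$ \<pi> \<bullet> pe \<pi>) = ?y" by (simp add: sum_single_keys)
  have "\<exists>\<pi>\<in>Poly_Mapping.keys ?y. ?y $$ \<pi> \<bullet> pe \<pi> \<notin> I"
  proof (rule ccontr)
    assume "\<not> ?thesis"
    then have "(\<Sum>\<pi>\<in>Poly_Mapping.keys ?y. ?y $$ \<pi> \<bullet> pe \<pi>) \<in> I" by (intro I_sum) blast
    then show False using nI unfolding sm by blast
  qed
  then obtain \<pi> where \<pi>: "\<pi> \<in> Poly_Mapping.keys ?y" "?y $$ \<pi> \<bullet> pe \<pi> \<notin> I" by blast
  have "ve i \<star> y \<in> K" using i y by auto
  then have k: "\<pi> \<in> Poly_Mapping.keys y" "fst \<pi> = i" "path_end Q \<pi> = i"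
    using \<pi>(1) y(1) by (auto simp: mul_vertex vertex_mul keys_restr)
  have p: "\<pi> \<in> paths Q" using k y by (auto simp: kpaths_iff)
  have b: "pe \<pi> \<notin> I" using \<pi>(2) I_scl by blast
  have "L \<le> path_length \<pi>" using k y by (auto simp: fil_def)
  moreover have "\<not> L < path_length \<pi>" using long_I p b by blast
  ultimately have "path_length \<pi> = L" by simp
  then have "maximal_bound_path Q \<rho> \<pi>" using maximal_if_top b p by (simp add: bound_path_iff)
  then show "\<exists>\<pi>. maximal_bound_path Q \<rho> \<pi> \<and> path_from_to Q (id i) i \<pi>"
    using k p unfolding path_from_to_iff id_apply by blast
  show "\<not> (\<exists>\<pi> j. j \<noteq> i \<and> bound_path Q \<rho> \<pi> \<and> path_length \<pi> = L \<and> path_from_to Q (id i) j \<pi>)"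
    using top_path(2) unfolding path_from_to_iff bound_path_iff id_def by metis
next
  fix \<pi> \<sigma> assume m: "maximal_bound_path Q \<rho> \<pi> \<and> maximal_bound_path Q \<rho> \<sigma> \<and> fst \<pi> = fst \<sigma>"
  have *: "\<exists>c. pe \<kappa> \<approx> c \<bullet> \<omega> (fst \<kappa>)" "\<kappa> \<in> paths Q" "pe \<kappa> \<notin> I" if "maximal_bound_path Q \<rho> \<kappa>" for \<kappa>
  proof -
    show b: "\<kappa> \<in> paths Q" "pe \<kappa> \<notin> I" using that by (auto simp: maximal_bound_path_def bound_path_iff)
    show "\<exists>c. pe \<kappa> \<approx> c \<bullet> \<omega> (fst \<kappa>)"
      using top_path[OF b(1) maximal_length[OF that]] b(2) by (cases "fst \<kappa> = path_end Q \<kappa>") simp_all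
  qed
  let ?w = "\<omega> (fst \<pi>)"
  obtain c where c: "pe \<pi> \<approx> c \<bullet> ?w" using *(1)[of \<pi>] m by blast
  obtain d where d: "pe \<sigma> \<approx> d \<bullet> ?w" using *(1)[of \<sigma>] m by auto
  \<comment> \<open>\<sigma> is bound, so \<open>d\<close> is nonzero and the pair of
    \<open>d\<close> and \<open>- c\<close> is a genuine dependency.\<close>
  have dn: "d \<noteq> 0" using d *(3)[of \<sigma>] m by auto
  have K: "d \<bullet> pe \<pi> \<in> K" "(- c) \<bullet> pe \<sigma> \<in> K" "pe \<pi> \<in> K" "pe \<sigma> \<in> K"
    using *(2)[of \<pi>] *(2)[of \<sigma>] m by auto
  have "d \<bullet> pe \<pi> + (- c) \<bullet> pe \<sigma> \<approx> d \<bullet> (c \<bullet> ?w) + (- c) \<bullet> (d \<bullet> ?w)"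
    by (intro eqv_add eqv_scl c d)
  also have "d \<bullet> (c \<bullet> ?w) + (- c) \<bullet> (d \<bullet> ?w) = 0"
    by (rule poly_mapping_eqI) (simp add: lookup_add)
  finally have "cls (d \<bullet> pe \<pi> + (- c) \<bullet> pe \<sigma>) = cls 0" by (simp only: cls_eq_iff)
  then have "d \<odot>\<^bsub>BA\<^esub> cls (pe \<pi>) \<oplus>\<^bsub>BA\<^esub> (- c) \<odot>\<^bsub>BA\<^esub> cls (pe \<sigma>) = \<zero>\<^bsub>BA\<^esub>"
    unfolding BA_smult[OF K(3)] BA_smult[OF K(4)] BA_add[OF K(1,2)] BA_simps(2) .
  then show "\<exists>c d :: 'k. (c, d) \<noteq> (0, 0) \<and> c \<odot>\<^bsub>BA\<^esub> cls (pe \<pi>) \<oplus>\<^bsub>BA\<^esub> d \<odot>\<^bsub>BA\<^esub> cls (pe \<sigma>) = \<zero>\<^bsub>BA\<^esub>"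
    using dn by (intro exI[of _ d] exI[of _ "- c"]) simp
qed (use assms hbq maximal_length in auto)

end

text \<open>An algebra homomorphism between the quotients, followed on chosen representatives;
  therefore its laws hold only modulo the ideal of the target.\<close>

locale bq_hom = A: bq Q1 \<rho>1 + B: bq Q2 \<rho>2
  for Q1 :: "('v1, 'a1) pre_digraph" and \<rho>1 :: "(('v1, 'a1) path \<Rightarrow>\<^sub>0 'k::field) set"
    and Q2 :: "('v2, 'a2) pre_digraph" and \<rho>2 :: "(('v2, 'a2) path \<Rightarrow>\<^sub>0 'k) set" +
  fixes F :: "(('v1, 'a1) path \<Rightarrow>\<^sub>0 'k) \<Rightarrow> (('v2, 'a2) path \<Rightarrow>\<^sub>0 'k)"
  assumes F_closed [simp, intro]: "\<And>x. x \<in> A.K \<Longrightarrow> F x \<in> B.K"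
    and F_add: "\<And>x y. x \<in> A.K \<Longrightarrow> y \<in> A.K \<Longrightarrow> F (x + y) - (F x + F y) \<in> B.I"
    and F_scl: "\<And>c x. x \<in> A.K \<Longrightarrow> F (c \<bullet> x) - c \<bullet> F x \<in> B.I"
    and F_mul: "\<And>x y. x \<in> A.K \<Longrightarrow> y \<in> A.K \<Longrightarrow> F (pmul Q1 x y) - pmul Q2 (F x) (F y) \<in> B.I"
    and F_one: "F (pone Q1) - pone Q2 \<in> B.I"
    and F_I: "\<And>x. x \<in> A.I \<Longrightarrow> F x \<in> B.I"
begin

abbreviation mul1 (infixl "\<star>\<^sub>1" 78) where "mul1 \<equiv> (pmul Q1 :: (('v1, 'a1) path \<Rightarrow>\<^sub>0 'k) \<Rightarrow> _)"
abbreviation mul2 (infixl "\<star>\<^sub>2" 78) where "mul2 \<equiv> (pmul Q2 :: (('v2, 'a2) path \<Rightarrow>\<^sub>0 'k) \<Rightarrow> _)"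
abbreviation eqv1 (infix "\<approx>\<^sub>1" 50) where "x \<approx>\<^sub>1 y \<equiv> x - y \<in> A.I"
abbreviation eqv2 (infix "\<approx>\<^sub>2" 50) where "x \<approx>\<^sub>2 y \<equiv> x - y \<in> B.I"

lemma F_0: "F 0 \<in> B.I"
  by (rule F_I) simp

lemma F_eqv:
  assumes "x \<in> A.K" "y \<in> A.K" "x \<approx>\<^sub>1 y" shows "F x \<approx>\<^sub>2 F y"
proof -
  have "F ((x - y) + y) \<approx>\<^sub>2 F (x - y) + F y" using assms by (intro F_add) auto
  also have "F (x - y) + F y \<approx>\<^sub>2 0 + F y"
    using F_I[OF assms(3)] by (intro B.eqv_add) auto
  finally show ?thesis by simp
qed

lemma F_sum:
  assumes "finite X" "\<And>x. x \<in> X \<Longrightarrow> f x \<in> A.K"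
  shows "F (\<Sum>x\<in>X. c x \<bullet> f x) \<approx>\<^sub>2 (\<Sum>x\<in>X. c x \<bullet> F (f x))"
  using assms
proof (induction X)
  case (insert x X)
  have K: "c x \<bullet> f x \<in> A.K" "(\<Sum>x\<in>X. c x \<bullet> f x) \<in> A.K" using insert by auto
  have "F (c x \<bullet> f x + (\<Sum>x\<in>X. c x \<bullet> f x)) \<approx>\<^sub>2 F (c x \<bullet> f x) + F (\<Sum>x\<in>X. c x \<bullet> f x)"
    using K by (rule F_add)
  also have "F (c x \<bullet> f x) + F (\<Sum>x\<in>X. c x \<bullet> f x) \<approx>\<^sub>2 c x \<bullet> F (f x) + (\<Sum>x\<in>X. c x \<bullet> F (f x))"
    using insert by (intro B.eqv_add F_scl) auto
  finally show ?case by (simp only: sum.insert[OF insert(1,2)])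
qed (simp add: F_0)

text \<open>If all paths longer than \<open>m\<close> vanish in the target, the coefficients at the
  shorter paths determine a class there. These are finitely many coordinates, so the bound paths of
  the source have bounded length, too.\<close>

lemma bounded_pull:
  assumes inj: "\<And>x. x \<in> A.K \<Longrightarrow> F x \<in> B.I \<Longrightarrow> x \<in> A.I"
    and long: "\<And>\<pi>. \<pi> \<in> paths Q2 \<Longrightarrow> m < path_length \<pi> \<Longrightarrow> path_elem \<pi> \<in> B.I"
  shows "\<exists>N. \<forall>\<pi>\<in>paths Q1. N \<le> path_length \<pi> \<longrightarrow> A.pe \<pi> \<in> A.I"
proof (rule A.bounded_lengths[where Y = "{\<pi>\<in>paths Q2. path_length \<pi> \<le> m}" and M = "\<lambda>\<pi> y. F (A.pe \<pi>) $$ y"])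
  show "finite {\<pi>\<in>paths Q2. path_length \<pi> \<le> m}" by (rule B.finite_paths_le)
  fix X and c :: "_ \<Rightarrow> 'k"
  assume X: "finite X" "X \<subseteq> paths Q1" "\<forall>y\<in>{\<pi>\<in>paths Q2. path_length \<pi> \<le> m}. (\<Sum>\<pi>\<in>X. c \<pi> * F (A.pe \<pi>) $$ y) = 0"
  let ?v = "\<Sum>\<pi>\<in>X. c \<pi> \<bullet> F (A.pe \<pi>)"
  have pK: "A.pe \<pi> \<in> A.K" if "\<pi> \<in> X" for \<pi> using X that by auto
  have vK: "?v \<in> B.K" using pK by auto
  have "fil (Suc m) ?v"
    unfolding fil_def
  proof
    fix y assume y: "y \<in> Poly_Mapping.keys ?v"
    then have "y \<in> paths Q2" using vK by (auto simp: kpaths_iff)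
    moreover have "(\<Sum>\<pi>\<in>X. c \<pi> * F (A.pe \<pi>) $$ y) \<noteq> 0" using y by (simp add: in_keys_iff lookup_sum)
    ultimately have "\<not> path_length y \<le> m" using X(3) by blast
    then show "Suc m \<le> path_length y" by simp
  qed
  then have "?v \<in> B.I" using B.long_paths_vanish(1)[OF long vK] by blast
  then have "F (\<Sum>\<pi>\<in>X. c \<pi> \<bullet> A.pe \<pi>) \<in> B.I"
    using B.eqv_I[OF F_sum[of X A.pe c]] X(1) pK by blast
  then show "(\<Sum>\<pi>\<in>X. c \<pi> \<bullet> A.pe \<pi>) \<in> A.I"
    by (intro inj kpaths_sum kpaths_closed(5)) (rule pK)
qed

end

locale bq_nil_hom = bq_hom Q1 \<rho>1 Q2 \<rho>2 F
  for Q1 :: "('v1, 'a1) pre_digraph" and \<rho>1 :: "(('v1, 'a1) path \<Rightarrow>\<^sub>0 'k::field) set"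
    and Q2 :: "('v2, 'a2) pre_digraph" and \<rho>2 :: "(('v2, 'a2) path \<Rightarrow>\<^sub>0 'k) set" and F +
  assumes nil: "\<exists>N. \<forall>\<pi>\<in>paths Q1. N \<le> path_length \<pi> \<longrightarrow> path_elem \<pi> \<in> rel_ideal Q1 \<rho>1"
begin

text \<open>Elements of positive degree are nilpotent, and so are the coefficients of their images at vertices.\<close>

lemma F_fil1:
  assumes x: "x \<in> A.K" "fil 1 x" shows "fil 1 (F x)"
proof -
  obtain N where N: "\<forall>\<pi>\<in>paths Q1. N \<le> path_length \<pi> \<longrightarrow> A.pe \<pi> \<in> A.I" using nil by blast
  define pw where "pw = (\<lambda>n. ((\<lambda>y. x \<star>\<^sub>1 y) ^^ n) (pone Q1))"
  have pw: "pw n \<in> A.K \<and> fil n (pw n) \<and> (\<forall>m\<in>verts Q2. F (pw n) $$ (m, []) = (F x $$ (m, [])) ^ n)" for n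
  proof (induction n)
    case 0
    have "F (pone Q1) $$ (m, []) = pone Q2 $$ (m, [])" for m by (rule B.eqv_lookup[OF F_one]) simp
    moreover have "pone Q2 $$ (m, []) = (1 :: 'k)" if "m \<in> verts Q2" for m
      using that by (simp add: B.pone_sum lookup_sum lookup_single when_def)
    ultimately show ?case by (simp add: pw_def)
  next
    case (Suc n)
    have "F (x \<star>\<^sub>1 pw n) $$ (m, []) = (F x \<star>\<^sub>2 F (pw n)) $$ (m, [])" for m
      by (rule B.eqv_lookup[OF F_mul]) (use x Suc in auto)
    then show ?case using Suc x fil_pmul[of 1 x n "pw n" Q1]
      by (simp add: pw_def mul_lookup_vertex)
  qed
  have "pw (Suc N) \<in> A.I"
    by (rule A.long_paths_vanish(1)[of N]) (use N pw in auto)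
  then have 0: "F (pw (Suc N)) $$ (m, []) = 0" for m using B.I_lookup[OF F_I] by simp
  show ?thesis
  proof (subst B.fil1_iff)
    show "F x \<in> B.K" using x by simp
    show "\<forall>m\<in>verts Q2. F x $$ (m, []) = 0"
    proof
      fix m assume "m \<in> verts Q2"
      then have "(F x $$ (m, [])) ^ Suc N = 0" using pw[of "Suc N"] 0[of m] by metis
      then show "F x $$ (m, []) = 0" by (rule power_eq_0_iff[THEN iffD1, THEN conjunct1])
    qed
  qed
qed

lemma F_fil_path:
  assumes "(u, q) \<in> paths Q1" shows "\<exists>y\<in>B.K. fil (length q) y \<and> F (A.pe (u, q)) \<approx>\<^sub>2 y"
  using assms
proof (induction q rule: rev_induct)
  case Nil
  then show ?case by (intro bexI[of _ "F (A.ve u)"]) auto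
next
  case (snoc a q)
  then have a: "a \<in> arcs Q1" and uq: "(u, q) \<in> paths Q1" by (auto simp: A.paths_snoc)
  with snoc obtain y where y: "y \<in> B.K" "fil (length q) y" "F (A.pe (u, q)) \<approx>\<^sub>2 y" by blast
  have aK: "arrow_elem Q1 a \<in> A.K" using a by auto
  have e: "A.pe (u, q @ [a]) = arrow_elem Q1 a \<star>\<^sub>1 A.pe (u, q)" using snoc(2) by (rule A.path_snoc_mul)
  have "F (A.pe (u, q @ [a])) \<approx>\<^sub>2 F (arrow_elem Q1 a) \<star>\<^sub>2 F (A.pe (u, q))"
    unfolding e using aK uq by (intro F_mul) auto
  also have "F (arrow_elem Q1 a) \<star>\<^sub>2 F (A.pe (u, q)) \<approx>\<^sub>2 F (arrow_elem Q1 a) \<star>\<^sub>2 y"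
    using aK y by (intro B.eqv_left) auto
  finally have "F (A.pe (u, q @ [a])) \<approx>\<^sub>2 F (arrow_elem Q1 a) \<star>\<^sub>2 y" .
  moreover have "fil (1 + length q) (F (arrow_elem Q1 a) \<star>\<^sub>2 y)"
    using aK y by (intro fil_pmul F_fil1) (auto simp: fil_def)
  ultimately show ?case using aK y by (intro bexI[of _ "F (arrow_elem Q1 a) \<star>\<^sub>2 y"]) auto
qed

lemma fil_mono: "fil t x \<Longrightarrow> s \<le> t \<Longrightarrow> fil s x"
  by (force simp: fil_def)

text \<open>Arrows go to positive degree and products add degrees. The element \<open>y\<close> is
  there because the representative chosen by \<open>F\<close> may contain terms of the ideal of
  smaller degree.\<close>

lemma F_fil:
  assumes "x \<in> A.K" "fil t x" shows "\<exists>y\<in>B.K. fil t y \<and> F x \<approx>\<^sub>2 y"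
proof -
  have "Poly_Mapping.keys x \<subseteq> {\<pi>\<in>paths Q1. t \<le> path_length \<pi>}" using assms by (auto simp: kpaths_iff fil_def)
  then have "x \<in> A.K \<and> (\<exists>y\<in>B.K. fil t y \<and> F x \<approx>\<^sub>2 y)"
  proof (induction rule: keys_span_induct)
    case zero
    then show ?case using F_0 by (intro conjI bexI[of _ 0]) auto
  next
    case (single \<pi> c)
    obtain u q where \<pi>: "\<pi> = (u, q)" by fastforce
    have P: "(u, q) \<in> paths Q1" "t \<le> length q" using single \<pi> by auto
    obtain y where y: "y \<in> B.K" "fil (length q) y" "F (A.pe (u, q)) \<approx>\<^sub>2 y" using F_fil_path[OF P(1)] by blast
    have "F (c \<bullet> A.pe (u, q)) \<approx>\<^sub>2 c \<bullet> F (A.pe (u, q))" using P by (intro F_scl) auto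
    also have "c \<bullet> F (A.pe (u, q)) \<approx>\<^sub>2 c \<bullet> y" using y(3) by (rule B.eqv_scl)
    finally have "F (Poly_Mapping.single \<pi> c) \<approx>\<^sub>2 c \<bullet> y" using \<pi> by simp
    moreover have "fil t (c \<bullet> y)" using fil_mono[OF y(2) P(2)] by simp
    ultimately show ?case using y(1) single by blast
  next
    case (add x y)
    then obtain x' y' where xy: "x \<in> A.K" "y \<in> A.K" "x' \<in> B.K" "fil t x'" "F x \<approx>\<^sub>2 x'" "y' \<in> B.K" "fil t y'" "F y \<approx>\<^sub>2 y'" by blast
    have "F (x + y) \<approx>\<^sub>2 F x + F y" using xy by (intro F_add)
    also have "F x + F y \<approx>\<^sub>2 x' + y'" using xy by (intro B.eqv_add)
    finally show ?case using xy by blast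
  qed
  then show ?thesis by blast
qed

text \<open>
  The coefficient of \<open>F x\<close> at \<open>m\<close> is a character of the first algebra, hence it is the
  coefficient of \<open>x\<close> at some vertex.
\<close>

definition vertex_map :: "'v2 \<Rightarrow> 'v1" where
  "vertex_map m = (THE i. i \<in> verts Q1 \<and> F (vertex_elem i) $$ (m, []) = 1)"

text \<open>The vertices are orthogonal idempotents with sum one; on these a character can only be 0
  or 1, not 1 on two of them, and not 0 on all.\<close>

lemma vertex_map:
  assumes m: "m \<in> verts Q2"
  shows "vertex_map m \<in> verts Q1" and "i \<in> verts Q1 \<Longrightarrow> F (A.ve i) $$ (m, []) = (if i = vertex_map m then 1 else 0)"
proof -
  let ?E = "\<lambda>i. F (A.ve i) $$ (m, [])"
  have mul: "?E i * ?E j = (if i = j then ?E i else 0)" if "i \<in> verts Q1" "j \<in> verts Q1" for i j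
  proof -
    have "F (A.ve i \<star>\<^sub>1 A.ve j) $$ (m, []) = (F (A.ve i) \<star>\<^sub>2 F (A.ve j)) $$ (m, [])"
      by (rule B.eqv_lookup[OF F_mul]) (use that in auto)
    moreover have "A.ve i \<star>\<^sub>1 A.ve j = (if i = j then A.ve i else 0)" by (simp add: pmul_single pcomp_def)
    moreover have "F 0 $$ (m, []) = 0" using B.I_lookup[OF F_0] by simp
    ultimately show ?thesis by (simp add: mul_lookup_vertex split: if_splits)
  qed
  have 01: "?E i = 0 \<or> ?E i = 1" if "i \<in> verts Q1" for i using mul[OF that that] by auto
  have "F (pone Q1) $$ (m, []) = pone Q2 $$ (m, [])" by (rule B.eqv_lookup[OF F_one]) simp
  then have one: "F (pone Q1) $$ (m, []) = 1" using m by (simp add: B.pone_sum lookup_sum lookup_single when_def)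
  have "F (\<Sum>i\<in>verts Q1. 1 \<bullet> A.ve i) $$ (m, []) = (\<Sum>i\<in>verts Q1. 1 \<bullet> F (A.ve i)) $$ (m, [])"
    by (rule B.eqv_lookup[OF F_sum]) auto
  then have s: "(\<Sum>i\<in>verts Q1. ?E i) = 1" using one by (simp add: A.pone_sum lookup_sum)
  have "\<exists>i\<in>verts Q1. ?E i = 1"
  proof (rule ccontr)
    assume "\<not> ?thesis"
    then have "(\<Sum>i\<in>verts Q1. ?E i) = 0" using 01 by (intro sum.neutral) blast
    then show False using s by simp
  qed
  then obtain i0 where i0: "i0 \<in> verts Q1" "?E i0 = 1" by blast
  have uniq: "i = i0" if "i \<in> verts Q1" "?E i = 1" for i
    using mul[OF that(1) i0(1)] that(2) i0(2) by (auto split: if_splits)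
  have k: "vertex_map m = i0"
    unfolding vertex_map_def
  proof (rule the_equality)
    show "i0 \<in> verts Q1 \<and> ?E i0 = 1" using i0 by blast
    show "i = i0" if "i \<in> verts Q1 \<and> ?E i = 1" for i using uniq that by blast
  qed
  show "vertex_map m \<in> verts Q1" unfolding k by (rule i0)
  show "?E i = (if i = vertex_map m then 1 else 0)" if i: "i \<in> verts Q1"
  proof (cases "i = i0")
    case True
    then show ?thesis unfolding k using i0 by simp
  next
    case False
    then have "?E i \<noteq> 1" using uniq[OF i] by blast
    then show ?thesis unfolding k using 01[OF i] False by simp
  qed
qed

lemma F_lookup: "x \<in> A.K \<Longrightarrow> m \<in> verts Q2 \<Longrightarrow> F x $$ (m, []) = x $$ (vertex_map m, [])"
proof (induction rule: kpaths_induct)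
  case zero
  then show ?case using B.I_lookup[OF F_0] by simp
next
  case (single \<pi> c)
  obtain u q where \<pi>: "\<pi> = (u, q)" by fastforce
  have P: "A.pe \<pi> \<in> A.K" using single by auto
  have "F (c \<bullet> A.pe \<pi>) $$ (m, []) = (c \<bullet> F (A.pe \<pi>)) $$ (m, [])"
    by (rule B.eqv_lookup[OF F_scl[OF P]]) simp
  moreover have "F (A.pe \<pi>) $$ (m, []) = (if \<pi> = (vertex_map m, []) then 1 else 0)"
  proof (cases "q = []")
    case True
    then show ?thesis using vertex_map(2)[of m u] single \<pi> by auto
  next
    case False
    then have "fil 1 (A.pe \<pi>)" using \<pi> by (cases q) (auto simp: fil_def)
    then show ?thesis using F_fil1[OF P] B.fil1_iff[of "F (A.pe \<pi>)"] P single(2) False \<pi> by auto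
  qed
  ultimately show ?case by (simp add: lookup_single when_def)
next
  case (add x y)
  have "F (x + y) $$ (m, []) = (F x + F y) $$ (m, [])"
    by (rule B.eqv_lookup[OF F_add]) (use add in auto)
  then show ?case using add by (simp add: lookup_add)
qed

end

locale bq_iso = bq_nil_hom Q1 \<rho>1 Q2 \<rho>2 F + inv: bq_nil_hom Q2 \<rho>2 Q1 \<rho>1 G
  for Q1 :: "('v1, 'a1) pre_digraph" and \<rho>1 :: "(('v1, 'a1) path \<Rightarrow>\<^sub>0 'k::field) set"
    and Q2 :: "('v2, 'a2) pre_digraph" and \<rho>2 :: "(('v2, 'a2) path \<Rightarrow>\<^sub>0 'k) set" and F G +
  assumes GF: "\<And>x. x \<in> kpaths Q1 \<Longrightarrow> G (F x) - x \<in> rel_ideal Q1 \<rho>1"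
    and FG: "\<And>y. y \<in> kpaths Q2 \<Longrightarrow> F (G y) - y \<in> rel_ideal Q2 \<rho>2"
begin

lemma F_reflects_I: "x \<in> A.K \<Longrightarrow> F x \<in> B.I \<Longrightarrow> x \<in> A.I"
  using GF[of x] inv.F_I[of "F x"] A.eqv_I by blast

text \<open>Characters are pulled back, so \<open>vertex_map\<close> runs against \<open>F\<close>.
  Pulling back along \<open>G\<close> and then along \<open>F\<close> is pulling back along
  \<open>G\<close> after \<open>F\<close>, which is the identity modulo the ideal.\<close>

lemma vertex_map_left_inverse: "i \<in> verts Q1 \<Longrightarrow> vertex_map (inv.vertex_map i) = i"
proof -
  assume i: "i \<in> verts Q1"
  have k: "inv.vertex_map i \<in> verts Q2" using inv.vertex_map(1)[OF i] .
  have vK: "A.ve i \<in> A.K" using i by auto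
  have "G (F (A.ve i)) $$ (i, []) = A.ve i $$ (i, [])" by (rule A.eqv_lookup[OF GF[OF vK]]) simp
  then have "F (A.ve i) $$ (inv.vertex_map i, []) = 1" using inv.F_lookup[of "F (A.ve i)" i] vK i by simp
  then show ?thesis using vertex_map(2)[OF k i] by (auto split: if_splits)
qed

lemma vertex_map_right_inverse: "m \<in> verts Q2 \<Longrightarrow> inv.vertex_map (vertex_map m) = m"
proof -
  assume m: "m \<in> verts Q2"
  have k: "vertex_map m \<in> verts Q1" using vertex_map(1)[OF m] .
  have vK: "B.ve m \<in> B.K" using m by auto
  have "F (G (B.ve m)) $$ (m, []) = B.ve m $$ (m, [])" by (rule B.eqv_lookup[OF FG[OF vK]]) simp
  then have "G (B.ve m) $$ (vertex_map m, []) = 1" using F_lookup[of "G (B.ve m)" m] vK m by simp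
  then show ?thesis using inv.vertex_map(2)[OF k m] by (auto split: if_splits)
qed

text \<open>
  Otherwise a nontrivial combination of the arrows on the left is sent into the square of
  the radical, and so lies in it.
\<close>

lemma card_arrows_le:
  assumes ij: "i \<in> verts Q1" "j \<in> verts Q1"
  shows "card {a\<in>arcs Q1. tail Q1 a = i \<and> head Q1 a = j}
    \<le> card {b\<in>arcs Q2. tail Q2 b = inv.vertex_map i \<and> head Q2 b = inv.vertex_map j}" (is "card ?X \<le> card ?Y")
proof (rule ccontr)
  assume "\<not> card ?X \<le> card ?Y"
  then have lt: "card ?Y < card ?X" by simp
  have fin: "finite ?X" "finite ?Y" by auto
  \<comment> \<open>With fewer arrows on the right, the images of some nontrivial combination have
    no coefficient at any arrow between the corresponding vertices.\<close>
  obtain c where c: "\<exists>x\<in>?X. c x \<noteq> 0"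
    "\<forall>y\<in>?Y. (\<Sum>x\<in>?X. c x * F (arrow_elem Q1 x) $$ (tail Q2 y, [y])) = 0"
    using nontrivial_solution[OF fin(2,1) lt, of "\<lambda>x y. F (arrow_elem Q1 x) $$ (tail Q2 y, [y])"] by blast
  let ?z = "\<Sum>x\<in>?X. c x \<bullet> arrow_elem Q1 x"
  have aK: "arrow_elem Q1 x \<in> A.K" if "x \<in> ?X" for x using that by auto
  have zK: "?z \<in> A.K" using aK by (intro kpaths_sum kpaths_closed) auto
  have z1: "fil 1 ?z" by (intro fil_sum fil_simps) (auto simp: fil_def)
  have z_ij: "A.ve j \<star>\<^sub>1 (?z \<star>\<^sub>1 A.ve i) = ?z"
    unfolding pmul_sum_left pmul_sum_right pmul_scl_left pmul_scl_right
    by (intro sum.cong) (auto simp: pmul_single pcomp_def)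
  have FK: "F ?z \<in> B.K" "F (A.ve i) \<in> B.K" "F (A.ve j) \<in> B.K" using zK ij by auto
  have F1: "F ?z $$ (m, []) = 0" if "m \<in> verts Q2" for m
    using F_fil1[OF zK z1] B.fil1_iff[OF FK(1)] that by blast
  have "F ?z $$ (tail Q2 g, [g]) = 0" if g: "g \<in> arcs Q2" for g
  proof (cases "g \<in> ?Y")
    case True
    have "F ?z $$ (tail Q2 g, [g]) = (\<Sum>x\<in>?X. c x \<bullet> F (arrow_elem Q1 x)) $$ (tail Q2 g, [g])"
      by (rule B.eqv_lookup[OF F_sum[OF fin(1) aK]]) simp_all
    then show ?thesis using c(2) True by (simp add: lookup_sum)
  next
    case False
    have tv: "tail Q2 g \<in> verts Q2" "head Q2 g \<in> verts Q2" using g by auto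
    have "F (A.ve j \<star>\<^sub>1 (?z \<star>\<^sub>1 A.ve i)) \<approx>\<^sub>2 F (A.ve j) \<star>\<^sub>2 F (?z \<star>\<^sub>1 A.ve i)"
      using zK ij by (intro F_mul) auto
    also have "F (A.ve j) \<star>\<^sub>2 F (?z \<star>\<^sub>1 A.ve i) \<approx>\<^sub>2 F (A.ve j) \<star>\<^sub>2 (F ?z \<star>\<^sub>2 F (A.ve i))"
      using zK ij by (intro B.eqv_left F_mul) auto
    finally have "F ?z $$ (tail Q2 g, [g]) = (F (A.ve j) \<star>\<^sub>2 (F ?z \<star>\<^sub>2 F (A.ve i))) $$ (tail Q2 g, [g])"
      unfolding z_ij by (rule B.eqv_lookup) simp
    \<comment> \<open>All vertex coefficients of \<open>F ?z\<close> vanish, so one term of each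
      Leibniz rule survives; its vertex factors are both 1 only if \<open>g\<close> runs between the
      corresponding vertices.\<close>
    also have "\<dots> = F (A.ve j) $$ (head Q2 g, []) * (F ?z $$ (tail Q2 g, [g]) * F (A.ve i) $$ (tail Q2 g, []))"
      using FK F1[OF tv(1)] F1[OF tv(2)] by (simp add: B.mul_lookup_arrow mul_lookup_vertex)
    also have "\<dots> = 0"
    proof -
      have "head Q2 g \<noteq> inv.vertex_map j \<or> tail Q2 g \<noteq> inv.vertex_map i" using False g by blast
      then have "j \<noteq> vertex_map (head Q2 g) \<or> i \<noteq> vertex_map (tail Q2 g)"
        using vertex_map_right_inverse[OF tv(1)] vertex_map_right_inverse[OF tv(2)] by metis
      then show ?thesis using vertex_map(2)[OF tv(2) ij(2)] vertex_map(2)[OF tv(1) ij(1)] by auto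
    qed
    finally show ?thesis .
  qed
  then have "fil 2 (F ?z)" using FK F1 by (intro B.fil2I) auto
  \<comment> \<open>Back on the left, \<open>?z\<close> would be congruent to an element of degrees
    at least two, although its arrow coefficients depend only on the class and are not all
    0.\<close>
  then obtain y where y: "y \<in> A.K" "fil 2 y" "G (F ?z) \<approx>\<^sub>1 y" using inv.F_fil[OF FK(1)] by blast
  have zy: "?z \<approx>\<^sub>1 y" using A.eqv_trans[OF A.eqv_sym[OF GF[OF zK]] y(3)] .
  obtain a where a: "a \<in> ?X" "c a \<noteq> 0" using c(1) by blast
  have "?z $$ (tail Q1 a, [a]) = y $$ (tail Q1 a, [a])" by (rule A.eqv_lookup[OF zy]) simp
  also have "\<dots> = 0" using y(2) by (force simp: fil_def in_keys_iff)
  finally have 0: "?z $$ (tail Q1 a, [a]) = 0" .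
  have "?z $$ (tail Q1 a, [a]) = (\<Sum>x\<in>?X. if x = a then c x else 0)"
    unfolding lookup_sum by (intro sum.cong) (auto simp: lookup_single when_def)
  also have "\<dots> = c a" using a(1) fin(1) by simp
  finally show False using 0 a(2) by simp
qed

end

context bq_iso
begin

lemma swap: "bq_iso Q2 \<rho>2 Q1 \<rho>1 G F"
  by (intro bq_iso.intro bq_iso_axioms.intro inv.bq_nil_hom_axioms bq_nil_hom_axioms FG GF)

lemma digraph_iso: "digraph_iso Q1 Q2"
proof (rule digraph_isoI)
  interpret sw: bq_iso Q2 \<rho>2 Q1 \<rho>1 G F by (rule swap)
  show "fin_digraph Q1" "fin_digraph Q2" by (rule A.fin_digraph_axioms B.fin_digraph_axioms)+
  show "bij_betw inv.vertex_map (verts Q1) (verts Q2)"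
    by (rule bij_betw_byWitness[where f' = vertex_map]) (auto simp: vertex_map_left_inverse vertex_map_right_inverse vertex_map(1) inv.vertex_map(1))
  fix i j assume ij: "i \<in> verts Q1" "j \<in> verts Q1"
  show "card {a\<in>arcs Q1. tail Q1 a = i \<and> head Q1 a = j} =
      card {b\<in>arcs Q2. tail Q2 b = inv.vertex_map i \<and> head Q2 b = inv.vertex_map j}"
    using card_arrows_le[OF ij] sw.card_arrows_le[OF inv.vertex_map(1)[OF ij(1)] inv.vertex_map(1)[OF ij(2)]]
    unfolding vertex_map_left_inverse[OF ij(1)] vertex_map_left_inverse[OF ij(2)] by (rule order_antisym)
qed

text \<open>The conditions mention only products, the length filtration, the ideal and the vertex
  coefficients. \<open>F\<close> and \<open>G\<close> respect all of these modulo the ideal, the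
  coefficients through the bijection of vertices, which also reindexes \<omega>.\<close>

lemma symmetric_top_transport:
  assumes "symmetric_top Q1 \<rho>1 L \<omega>"
  shows "symmetric_top Q2 \<rho>2 L (\<lambda>m. F (\<omega> (vertex_map m)))"
proof -
  interpret S: symmetric_top Q1 \<rho>1 L \<omega> by fact
  show ?thesis
  proof (intro symmetric_top.intro symmetric_top_axioms.intro)
    show "bq Q2 \<rho>2" by (rule B.bq_axioms)
    fix \<pi> assume \<pi>: "\<pi> \<in> paths Q2" "L < path_length \<pi>"
    have pK: "B.pe \<pi> \<in> B.K" and "fil (Suc L) (B.pe \<pi>)" using \<pi> by (auto simp: fil_def)
    then obtain y where y: "y \<in> A.K" "fil (Suc L) y" "G (B.pe \<pi>) \<approx>\<^sub>1 y" using inv.F_fil by blast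
    have "y \<in> A.I" using A.long_paths_vanish(1)[OF S.long_I y(1,2)] .
    then have "G (B.pe \<pi>) \<in> A.I" using A.eqv_I[OF y(3)] by blast
    then have "F (G (B.pe \<pi>)) \<in> B.I" by (rule F_I)
    then show "B.pe \<pi> \<in> B.I" using B.eqv_I[OF FG[OF pK]] by blast
  next
    fix x assume x: "x \<in> B.K" "\<And>y. y \<in> B.K \<Longrightarrow> fil 1 y \<Longrightarrow> x \<star>\<^sub>2 y \<in> B.I \<and> y \<star>\<^sub>2 x \<in> B.I"
    have "\<exists>y\<in>A.K. fil L y \<and> G x \<approx>\<^sub>1 y"
    proof (rule S.socle)
      show GK: "G x \<in> A.K" using x(1) by (rule inv.F_closed)
      fix y assume y: "y \<in> A.K" "fil 1 y"
      have Fy: "F y \<in> B.K" "fil 1 (F y)" using y F_fil1 by auto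
      have e: "F (G x) \<approx>\<^sub>2 x" using FG x(1) by blast
      have "F (G x \<star>\<^sub>1 y) \<approx>\<^sub>2 F (G x) \<star>\<^sub>2 F y" using GK y by (intro F_mul)
      also have "F (G x) \<star>\<^sub>2 F y \<approx>\<^sub>2 x \<star>\<^sub>2 F y" using Fy e by (intro B.eqv_right)
      finally have "F (G x \<star>\<^sub>1 y) \<in> B.I" using x(2)[OF Fy] B.eqv_I by blast
      moreover have "F (y \<star>\<^sub>1 G x) \<approx>\<^sub>2 F y \<star>\<^sub>2 F (G x)" using GK y by (intro F_mul)
      then have "F (y \<star>\<^sub>1 G x) \<approx>\<^sub>2 F y \<star>\<^sub>2 x" using Fy e by (elim B.eqv_trans) (intro B.eqv_left)
      then have "F (y \<star>\<^sub>1 G x) \<in> B.I" using x(2)[OF Fy] B.eqv_I by blast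
      ultimately show "G x \<star>\<^sub>1 y \<in> A.I \<and> y \<star>\<^sub>1 G x \<in> A.I" using GK y F_reflects_I by auto
    qed
    then obtain y where y: "y \<in> A.K" "fil L y" "G x \<approx>\<^sub>1 y" by blast
    obtain z where z: "z \<in> B.K" "fil L z" "F y \<approx>\<^sub>2 z" using F_fil[OF y(1,2)] by blast
    have "x \<approx>\<^sub>2 F (G x)" using FG[OF x(1)] by (rule B.eqv_sym)
    also have "F (G x) \<approx>\<^sub>2 F y" using x y by (intro F_eqv) auto
    also have "F y \<approx>\<^sub>2 z" by (rule z)
    finally show "\<exists>y\<in>B.K. fil L y \<and> x \<approx>\<^sub>2 y" using z by blast
  next
    fix y assume y: "y \<in> B.K" "fil L y"
    obtain x where x: "x \<in> A.K" "fil L x" "G y \<approx>\<^sub>1 x" using inv.F_fil[OF y] by blast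
    obtain c where c: "x \<approx>\<^sub>1 (\<Sum>i\<in>verts Q1. c i \<bullet> \<omega> i)" using S.top_span[OF x(1,2)] by (rule exE)
    have sK: "(\<Sum>i\<in>verts Q1. c i \<bullet> \<omega> i) \<in> A.K" using S.omega_closed by auto
    have "y \<approx>\<^sub>2 F (G y)" using FG[OF y(1)] by (rule B.eqv_sym)
    also have "F (G y) \<approx>\<^sub>2 F (\<Sum>i\<in>verts Q1. c i \<bullet> \<omega> i)"
      using y sK A.eqv_trans[OF x(3) c] by (intro F_eqv) auto
    also have "F (\<Sum>i\<in>verts Q1. c i \<bullet> \<omega> i) \<approx>\<^sub>2 (\<Sum>i\<in>verts Q1. c i \<bullet> F (\<omega> i))"
      by (rule F_sum) (use S.omega_closed in auto)
    also have "(\<Sum>i\<in>verts Q1. c i \<bullet> F (\<omega> i)) = (\<Sum>m\<in>verts Q2. c (vertex_map m) \<bullet> F (\<omega> (vertex_map m)))"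
      by (rule sum.reindex_bij_witness[where i = vertex_map and j = inv.vertex_map])
        (auto simp: vertex_map_left_inverse vertex_map_right_inverse vertex_map(1) inv.vertex_map(1))
    finally show "\<exists>c. y \<approx>\<^sub>2 (\<Sum>i\<in>verts Q2. c i \<bullet> F (\<omega> (vertex_map i)))" by (rule exI[of _ "\<lambda>m. c (vertex_map m)"])
  next
    fix m assume m: "m \<in> verts Q2"
    have k: "vertex_map m \<in> verts Q1" using vertex_map(1)[OF m] .
    have wK: "\<omega> (vertex_map m) \<in> A.K" using S.omega_closed[OF k] .
    show "F (\<omega> (vertex_map m)) \<in> B.K" using wK by (rule F_closed)
    obtain y where y: "y \<in> A.K" "fil L y" "\<omega> (vertex_map m) \<approx>\<^sub>1 y" using S.omega_fil[OF k] by blast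
    obtain z where z: "z \<in> B.K" "fil L z" "F y \<approx>\<^sub>2 z" using F_fil[OF y(1,2)] by blast
    show "\<exists>y\<in>B.K. fil L y \<and> F (\<omega> (vertex_map m)) \<approx>\<^sub>2 y"
      using z B.eqv_trans[OF F_eqv[OF wK y(1,3)] z(3)] by blast
    show "F (\<omega> (vertex_map m)) \<notin> B.I" using F_reflects_I[OF wK] S.omega_nz[OF k] by blast
    fix x assume x: "x \<in> B.K"
    have Gx: "G x \<in> A.K" and e: "x \<approx>\<^sub>2 F (G x)" using x B.eqv_sym[OF FG[OF x]] by auto
    have l: "G x $$ (vertex_map m, []) = x $$ (m, [])"
      using inv.F_lookup[OF x k] vertex_map_right_inverse[OF m] by simp
    have "x \<star>\<^sub>2 F (\<omega> (vertex_map m)) \<approx>\<^sub>2 F (G x) \<star>\<^sub>2 F (\<omega> (vertex_map m))" using wK e by (intro B.eqv_right) auto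
    also have "F (G x) \<star>\<^sub>2 F (\<omega> (vertex_map m)) \<approx>\<^sub>2 F (G x \<star>\<^sub>1 \<omega> (vertex_map m))"
      using Gx wK by (intro B.eqv_sym[OF F_mul])
    also have "F (G x \<star>\<^sub>1 \<omega> (vertex_map m)) \<approx>\<^sub>2 F (G x $$ (vertex_map m, []) \<bullet> \<omega> (vertex_map m))"
      using Gx wK S.omega_left[OF k Gx] by (intro F_eqv) auto
    also have "F (G x $$ (vertex_map m, []) \<bullet> \<omega> (vertex_map m)) \<approx>\<^sub>2 G x $$ (vertex_map m, []) \<bullet> F (\<omega> (vertex_map m))"
      using wK by (rule F_scl)
    finally show "x \<star>\<^sub>2 F (\<omega> (vertex_map m)) \<approx>\<^sub>2 x $$ (m, []) \<bullet> F (\<omega> (vertex_map m))" unfolding l .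
    have "F (\<omega> (vertex_map m)) \<star>\<^sub>2 x \<approx>\<^sub>2 F (\<omega> (vertex_map m)) \<star>\<^sub>2 F (G x)" using wK e by (intro B.eqv_left) auto
    also have "F (\<omega> (vertex_map m)) \<star>\<^sub>2 F (G x) \<approx>\<^sub>2 F (\<omega> (vertex_map m) \<star>\<^sub>1 G x)"
      using Gx wK by (intro B.eqv_sym[OF F_mul])
    also have "F (\<omega> (vertex_map m) \<star>\<^sub>1 G x) \<approx>\<^sub>2 F (G x $$ (vertex_map m, []) \<bullet> \<omega> (vertex_map m))"
      using Gx wK S.omega_right[OF k Gx] by (intro F_eqv) auto
    also have "F (G x $$ (vertex_map m, []) \<bullet> \<omega> (vertex_map m)) \<approx>\<^sub>2 G x $$ (vertex_map m, []) \<bullet> F (\<omega> (vertex_map m))"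
      using wK by (rule F_scl)
    finally show "F (\<omega> (vertex_map m)) \<star>\<^sub>2 x \<approx>\<^sub>2 x $$ (m, []) \<bullet> F (\<omega> (vertex_map m))" unfolding l .
  qed
qed

end

section \<open>From algebra isomorphisms to maps between path algebras\<close>

lemma alg_iso_inv:
  assumes f: "f \<in> alg_iso A B" and A: "ring A" and cl: "\<And>c x. x \<in> carrier A \<Longrightarrow> c \<odot>\<^bsub>A\<^esub> x \<in> carrier A"
  shows "inv_into (carrier A) f \<in> alg_iso B A"
proof -
  have fr: "f \<in> ring_iso A B" and fs: "\<And>c x. x \<in> carrier A \<Longrightarrow> f (c \<odot>\<^bsub>A\<^esub> x) = c \<odot>\<^bsub>B\<^esub> f x"
    using f by (auto simp: alg_iso_def)
  have bij: "bij_betw f (carrier A) (carrier B)" using fr by (simp add: ring_iso_def)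
  have "inv_into (carrier A) f (c \<odot>\<^bsub>B\<^esub> y) = c \<odot>\<^bsub>A\<^esub> inv_into (carrier A) f y" if y: "y \<in> carrier B" for c y
  proof -
    let ?x = "inv_into (carrier A) f y"
    have x: "?x \<in> carrier A" "f ?x = y"
      using bij y by (auto simp: bij_betw_def inv_into_into f_inv_into_f)
    have "c \<odot>\<^bsub>B\<^esub> y = f (c \<odot>\<^bsub>A\<^esub> ?x)" using fs[OF x(1)] x(2) by simp
    then show ?thesis using bij cl[OF x(1)] by (simp add: bij_betw_def)
  qed
  then show ?thesis using ring_iso_set_sym[OF A fr] by (simp add: alg_iso_def)
qed

lemma alg_iso_comp:
  assumes f: "f \<in> alg_iso A B" and g: "g \<in> alg_iso B C"
  shows "g \<circ> f \<in> alg_iso A C"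
proof -
  have "f x \<in> carrier B" if "x \<in> carrier A" for x
    using f that by (auto simp: alg_iso_def ring_iso_def ring_hom_def)
  then show ?thesis using ring_iso_set_trans[of f A B g C] f g by (auto simp: alg_iso_def)
qed

definition lift_hom :: "('v2, 'a2) pre_digraph \<Rightarrow> (('v2, 'a2) path \<Rightarrow>\<^sub>0 'k::field) set \<Rightarrow>
    ('y \<Rightarrow> (('v2, 'a2) path \<Rightarrow>\<^sub>0 'k) set) \<Rightarrow> 'y \<Rightarrow> (('v2, 'a2) path \<Rightarrow>\<^sub>0 'k)" where
  "lift_hom Q \<rho> f X = (SOME y. y \<in> kpaths Q \<and> f X = path_class Q \<rho> y)"

lemma lift_hom:
  assumes "bq Q1 \<rho>1" "bq Q2 \<rho>2" and f: "f \<in> alg_iso (bound_algebra Q1 \<rho>1) (bound_algebra Q2 \<rho>2)"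
  defines "F \<equiv> \<lambda>x. lift_hom Q2 \<rho>2 f (path_class Q1 \<rho>1 x)"
  shows "bq_hom Q1 \<rho>1 Q2 \<rho>2 F"
    and "x \<in> kpaths Q1 \<Longrightarrow> f (path_class Q1 \<rho>1 x) = path_class Q2 \<rho>2 (F x)"
proof -
  interpret A: bq Q1 \<rho>1 by fact
  interpret B: bq Q2 \<rho>2 by fact
  have hom: "f \<in> ring_hom A.BA B.BA" using f by (simp add: alg_iso_def ring_iso_def)
  have F: "F x \<in> B.K" "f (A.cls x) = B.cls (F x)" if x: "x \<in> A.K" for x
  proof -
    have "f (A.cls x) \<in> carrier B.BA" using ring_hom_closed[OF hom] x by blast
    then have "\<exists>y. y \<in> B.K \<and> f (A.cls x) = B.cls y" by (auto elim: B.cls_cases)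
    from someI_ex[OF this] show "F x \<in> B.K" "f (A.cls x) = B.cls (F x)"
      by (simp_all add: F_def lift_hom_def)
  qed
  show "bq_hom Q1 \<rho>1 Q2 \<rho>2 F"
  proof (intro bq_hom.intro bq_hom_axioms.intro assms)
    fix x assume x: "x \<in> A.K"
    show "F x \<in> B.K" by (rule F(1)[OF x])
    have "B.cls (F (c \<bullet> x)) = B.cls (c \<bullet> F x)" for c
    proof -
      have "B.cls (F (c \<bullet> x)) = f (c \<odot>\<^bsub>A.BA\<^esub> A.cls x)" using F(2)[of "c \<bullet> x"] x by (simp add: A.BA_smult)
      also have "\<dots> = c \<odot>\<^bsub>B.BA\<^esub> f (A.cls x)" using f x by (auto simp: alg_iso_def)
      also have "\<dots> = B.cls (c \<bullet> F x)" using F[OF x] by (simp add: B.BA_smult)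
      finally show ?thesis .
    qed
    then show "F (c \<bullet> x) - c \<bullet> F x \<in> B.I" for c by (rule B.cls_eq_iff[THEN iffD1])
    fix y assume y: "y \<in> A.K"
    have "B.cls (F (x + y)) = f (A.cls x \<oplus>\<^bsub>A.BA\<^esub> A.cls y)" using F(2)[of "x + y"] x y by (simp add: A.BA_add)
    also have "\<dots> = f (A.cls x) \<oplus>\<^bsub>B.BA\<^esub> f (A.cls y)" using hom x y by (intro ring_hom_add) auto
    also have "\<dots> = B.cls (F x + F y)" using F[OF x] F[OF y] by (simp add: B.BA_add)
    finally show "F (x + y) - (F x + F y) \<in> B.I" by (rule B.cls_eq_iff[THEN iffD1])
    have "B.cls (F (pmul Q1 x y)) = f (A.cls x \<otimes>\<^bsub>A.BA\<^esub> A.cls y)" using F(2)[of "pmul Q1 x y"] x y by (simp add: A.BA_mult)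
    also have "\<dots> = f (A.cls x) \<otimes>\<^bsub>B.BA\<^esub> f (A.cls y)" using hom x y by (intro ring_hom_mult) auto
    also have "\<dots> = B.cls (pmul Q2 (F x) (F y))" using F[OF x] F[OF y] by (simp add: B.BA_mult)
    finally show "F (pmul Q1 x y) - pmul Q2 (F x) (F y) \<in> B.I" by (rule B.cls_eq_iff[THEN iffD1])
  next
    have "B.cls (F (pone Q1)) = f \<one>\<^bsub>A.BA\<^esub>" using F(2)[of "pone Q1"] by (simp add: A.BA_simps)
    also have "\<dots> = B.cls (pone Q2)" using ring_hom_one[OF hom] by (simp add: B.BA_simps)
    finally show "F (pone Q1) - pone Q2 \<in> B.I" by (rule B.cls_eq_iff[THEN iffD1])
  next
    fix x assume x: "x \<in> A.I"
    \<comment> \<open>The zero class is written as 0 times itself, which reduces the claim to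
      compatibility of \<open>f\<close> with scalars.\<close>
    have x0: "A.cls x = A.cls (0 \<bullet> x)" using x A.cls_eq_iff[of x 0] by simp
    have xK: "x \<in> A.K" using x by (rule A.I_sub)
    have "B.cls (F x) = f (0 \<odot>\<^bsub>A.BA\<^esub> A.cls x)"
      using F(2)[OF xK] x0 A.BA_smult[OF xK, of 0] by simp
    also have "\<dots> = 0 \<odot>\<^bsub>B.BA\<^esub> f (A.cls x)" using f xK by (auto simp: alg_iso_def)
    also have "\<dots> = B.cls 0" using F[OF xK] B.BA_smult[OF F(1)[OF xK], of 0] by simp
    finally have "F x - 0 \<in> B.I" by (rule B.cls_eq_iff[THEN iffD1])
    then show "F x \<in> B.I" by simp
  qed
  show "f (path_class Q1 \<rho>1 x) = path_class Q2 \<rho>2 (F x)" if "x \<in> kpaths Q1" by (rule F(2)[OF that])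
qed

text \<open>A bound on path lengths is given for the first quiver; for the second it is pulled back
  along \<open>G\<close>, which reflects the ideal because \<open>F\<close> inverts it. Both bounds
  enter the comparison of the filtrations.\<close>

lemma ex_bq_iso:
  assumes 1: "bq Q1 \<rho>1" and 2: "bq Q2 \<rho>2" and f: "f \<in> alg_iso (bound_algebra Q1 \<rho>1) (bound_algebra Q2 \<rho>2)"
    and long: "\<And>\<pi>. \<pi> \<in> paths Q1 \<Longrightarrow> m < path_length \<pi> \<Longrightarrow> path_elem \<pi> \<in> rel_ideal Q1 \<rho>1"
  shows "\<exists>F G. bq_iso Q1 \<rho>1 Q2 \<rho>2 F G"
proof -
  interpret A: bq Q1 \<rho>1 by fact
  interpret B: bq Q2 \<rho>2 by fact
  let ?g = "inv_into (carrier A.BA) f"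
  have g: "?g \<in> alg_iso B.BA A.BA"
    by (rule alg_iso_inv[OF f A.ring_BA]) (auto simp: A.BA_smult elim!: A.cls_cases)
  define F where "F = (\<lambda>x. lift_hom Q2 \<rho>2 f (A.cls x))"
  define G where "G = (\<lambda>x. lift_hom Q1 \<rho>1 ?g (B.cls x))"
  note lf = lift_hom(1)[OF 1 2 f, folded F_def] and lg = lift_hom(1)[OF 2 1 g, folded G_def]
  have cF: "f (A.cls x) = B.cls (F x)" if "x \<in> A.K" for x
    using lift_hom(2)[OF 1 2 f that] by (simp only: F_def)
  have cG: "?g (B.cls y) = A.cls (G y)" if "y \<in> B.K" for y
    using lift_hom(2)[OF 2 1 g that] by (simp only: G_def)
  interpret F: bq_hom Q1 \<rho>1 Q2 \<rho>2 F by (rule lf)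
  interpret G: bq_hom Q2 \<rho>2 Q1 \<rho>1 G by (rule lg)
  have bij: "bij_betw f (carrier A.BA) (carrier B.BA)" using f by (simp add: alg_iso_def ring_iso_def)
  have GF: "G (F x) - x \<in> A.I" if x: "x \<in> A.K" for x
  proof -
    have "A.cls (G (F x)) = ?g (f (A.cls x))" unfolding cF[OF x] cG[OF F.F_closed[OF x]] ..
    also have "\<dots> = A.cls x" using bij x by (simp add: bij_betw_def)
    finally show ?thesis by (rule A.cls_eq_iff[THEN iffD1])
  qed
  have FG: "F (G y) - y \<in> B.I" if y: "y \<in> B.K" for y
  proof -
    have "B.cls (F (G y)) = f (?g (B.cls y))" unfolding cG[OF y] cF[OF G.F_closed[OF y]] ..
    also have "\<dots> = B.cls y" using bij y by (intro f_inv_into_f) (simp add: bij_betw_def)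
    finally show ?thesis by (rule B.cls_eq_iff[THEN iffD1])
  qed
  have nil1: "\<exists>N. \<forall>\<pi>\<in>paths Q1. N \<le> path_length \<pi> \<longrightarrow> path_elem \<pi> \<in> A.I"
    by (rule exI[of _ "Suc m"]) (use long in auto)
  have nil2: "\<exists>N. \<forall>\<pi>\<in>paths Q2. N \<le> path_length \<pi> \<longrightarrow> path_elem \<pi> \<in> B.I"
  proof (rule G.bounded_pull[OF _ long])
    fix y assume y: "y \<in> B.K" "G y \<in> A.I"
    then have "F (G y) \<in> B.I" by (intro F.F_I)
    then show "y \<in> B.I" using B.eqv_I[OF FG[OF y(1)]] by blast
  qed
  have "bq_iso Q1 \<rho>1 Q2 \<rho>2 F G"
    by (intro bq_iso.intro bq_iso_axioms.intro bq_nil_hom.intro bq_nil_hom_axioms.intro lf lg nil1 nil2 GF FG)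
  then show ?thesis by blast
qed

section \<open>The top degree of the trivial extension\<close>

context stable_bq
begin

text \<open>From \<open>i\<close> along the new arrow to \<open>\<tau> i\<close> and back along
  \<open>p i\<close>: this cycle spans the top degree at \<open>i\<close> and accounts for the
  trivial translation. Its image in the dual part is the functional reading the coefficient at
  \<open>i\<close>.\<close>

definition omega :: "'v \<Rightarrow> ('v, 'a + 'v) path \<Rightarrow>\<^sub>0 'k" where
  "omega i = emb (pe (p i)) \<circledast> alpha"

lemma pe_p_closed [simp, intro]: "i \<in> verts Q \<Longrightarrow> pe (p i) \<in> K"
  using p_props(1) by auto

lemma omega_closed: "i \<in> verts Q \<Longrightarrow> omega i \<in> KR"
  unfolding omega_def by (intro RQ.pmul_closed emb_closed pe_p_closed alpha_closed)

lemma alpha_fil: "fil 1 alpha"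
  unfolding alpha_def by (intro fil_sum) (auto simp: fil_def)

lemma omega_homog: "i \<in> verts Q \<Longrightarrow> fil (l + 1) (omega i)"
  unfolding omega_def using p_props(4)[of i]
  by (intro fil_pmul embed_fil alpha_fil) (auto simp: fil_def)

text \<open>Beyond degree \<open>l + 1\<close> both parts of the normal form lie beyond degree
  \<open>l\<close>, where the old algebra vanishes.\<close>

lemma R_long:
  assumes "\<pi> \<in> paths RQ" "l + 1 < path_length \<pi>"
  shows "path_elem \<pi> \<in> R.I"
proof -
  have "path_elem \<pi> \<in> KR" "homog (path_length \<pi>) (path_elem \<pi> :: _ \<Rightarrow>\<^sub>0 'k)"
    using assms by (auto simp: homog_def)
  then obtain a b where "nform (path_length \<pi>) (path_elem \<pi>) a b" using ex_nform by blast
  then have ab: "a \<in> K" "b \<in> K" "homog (path_length \<pi>) a"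
    "\<forall>\<kappa>\<in>Poly_Mapping.keys b. Suc (path_length \<kappa>) = path_length \<pi>" "path_elem \<pi> \<doteq> emb a + emb b \<circledast> alpha"
    unfolding nform_def by auto
  have "fil (Suc l) a" using ab(3) assms(2) by (intro homog_fil) auto
  then have a: "a \<in> I" by (rule long_I(1)[OF _ _ ab(1), rotated -1])
  have "fil (Suc l) b" using ab(4) assms(2) by (force simp: fil_def)
  then have b: "b \<in> I" by (rule long_I(1)[OF _ _ ab(2), rotated -1])
  have "emb a + emb b \<circledast> alpha \<in> R.I" by (intro R.I_add R.I_right emb_I a b alpha_closed)
  then show ?thesis using R.eqv_I[OF ab(5)] by blast
qed

lemma omega_expand:
  assumes "b \<in> K" "b \<approx> (\<Sum>i\<in>verts Q. c i \<bullet> pe (p i))"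
  shows "emb b \<circledast> alpha \<doteq> (\<Sum>i\<in>verts Q. c i \<bullet> omega i)"
proof -
  have s: "emb (\<Sum>i\<in>A. c i \<bullet> pe (p i)) = (\<Sum>i\<in>A. c i \<bullet> emb (pe (p i)))" for A
    unfolding embed_elem_lin lin_sum lin_scl ..
  have "emb (b - (\<Sum>i\<in>verts Q. c i \<bullet> pe (p i))) \<in> R.I" using assms(2) by (rule emb_I)
  then have "emb b \<doteq> (\<Sum>i\<in>verts Q. c i \<bullet> emb (pe (p i)))" unfolding embed_elem_simps(3) s .
  then have "emb b \<circledast> alpha \<doteq> (\<Sum>i\<in>verts Q. c i \<bullet> emb (pe (p i))) \<circledast> alpha" by (intro R.eqv_right alpha_closed)
  then show ?thesis unfolding pmul_sum_left pmul_scl_left omega_def .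
qed

lemma pone_split: "b \<in> K \<Longrightarrow> b = (\<Sum>i\<in>verts Q. ve i \<star> b)"
  using pone_mul[of b] unfolding pone_sum pmul_sum_left by simp

text \<open>In degree \<open>l + 1\<close> the part \<open>a\<close> is too long to survive, and the
  part \<open>b\<close> has degree \<open>l\<close>, so cutting by vertices turns it into a
  combination of the chosen paths.\<close>

lemma R_top_span:
  assumes "y \<in> KR" "fil (l + 1) y"
  shows "\<exists>c. y \<doteq> (\<Sum>i\<in>verts Q. c i \<bullet> omega i)"
proof -
  let ?y = "hcomp (l + 1) y"
  have y: "y \<doteq> ?y" using R.long_paths_vanish(2)[OF R_long assms] .
  have "?y \<in> KR" "homog (l + 1) ?y" using assms by auto
  then obtain a b where "nform (l + 1) ?y a b" using ex_nform by blast
  then have ab: "a \<in> K" "b \<in> K" "homog (l + 1) a" "homog l b" "?y \<doteq> emb a + emb b \<circledast> alpha"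
    unfolding nform_def by (auto simp: homog_def)
  have "fil (Suc l) a" using ab(3) by (intro homog_fil) auto
  then have a: "a \<in> I" by (rule long_I(1)[OF _ _ ab(1), rotated -1])
  have "(\<Sum>i\<in>verts Q. ve i \<star> b) \<approx> (\<Sum>i\<in>verts Q. theta (ve i \<star> b) \<bullet> pe (p i))"
    using ab by (intro eqv_sum theta_top homog_ve) (auto dest: pmul_ve_keys)
  then have b: "b \<approx> (\<Sum>i\<in>verts Q. theta (ve i \<star> b) \<bullet> pe (p i))"
    unfolding pone_split[OF ab(2), symmetric] .
  have "y \<doteq> emb a + emb b \<circledast> alpha" using y ab(5) by (rule R.eqv_trans)
  also have "emb a + emb b \<circledast> alpha \<doteq> 0 + (\<Sum>i\<in>verts Q. theta (ve i \<star> b) \<bullet> omega i)"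
    using emb_I[OF a] omega_expand[OF ab(2) b] by (intro R.eqv_add) auto
  finally have "y \<doteq> (\<Sum>i\<in>verts Q. theta (ve i \<star> b) \<bullet> omega i)" by simp
  then show ?thesis by (rule exI[of _ "\<lambda>i. theta (ve i \<star> b)"])
qed

text \<open>The image of \<open>b\<close> times \<open>alpha\<close> is \<open>b\<close> acting on
  \<open>theta\<close>, which is the zero functional only for the zero class. So right
  multiplication by \<open>alpha\<close> is injective on the old algebra.\<close>

lemma emb_alpha_I:
  assumes "b \<in> K" "emb b \<circledast> alpha \<in> R.I" shows "b \<in> I"
proof (rule theta_faithful[OF assms(1)])
  fix z assume z: "z \<in> K"
  have "emb 0 + emb b \<circledast> alpha \<in> R.I" using assms(2) by (simp add: embed_elem_simps)
  then show "theta (z \<star> b) = 0"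
    using Phi_nform(2)[of 0 b z] Phi_I(2)[of "emb 0 + emb b \<circledast> alpha" z] assms(1) z by simp
qed

text \<open>Multiplication by \<open>alpha\<close> on the right removes \<open>b\<close> and shows
  that \<open>a\<close> vanishes; multiplication by the old arrows on the left then puts
  \<open>b\<close> into the left socle of the old algebra, which is its degree
  \<open>l\<close>.\<close>

lemma R_socle:
  assumes x: "x \<in> KR" and ann: "\<And>y. y \<in> KR \<Longrightarrow> fil 1 y \<Longrightarrow> x \<circledast> y \<in> R.I \<and> y \<circledast> x \<in> R.I"
  shows "\<exists>y\<in>KR. fil (l + 1) y \<and> x \<doteq> y"
proof -
  obtain a b where ab: "a \<in> K" "b \<in> K" "x \<doteq> emb a + emb b \<circledast> alpha" using ex_normal_form[OF x] by blast
  have "x \<circledast> alpha \<doteq> (emb a + emb b \<circledast> alpha) \<circledast> alpha" by (intro R.eqv_right alpha_closed ab)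
  also have "(emb a + emb b \<circledast> alpha) \<circledast> alpha = emb a \<circledast> alpha + emb b \<circledast> (alpha \<circledast> alpha)"
    by (simp only: pmul_distribs pmul_assoc)
  also have "emb a \<circledast> alpha + emb b \<circledast> (alpha \<circledast> alpha) \<doteq> emb a \<circledast> alpha + 0"
    using R.I_left[OF emb_closed[OF ab(2)] alpha_alpha] by (intro R.eqv_add R.eqv_refl) simp
  finally have "x \<circledast> alpha \<doteq> emb a \<circledast> alpha" by simp
  then have "emb a \<circledast> alpha \<in> R.I" using ann[OF alpha_closed alpha_fil] R.eqv_I by blast
  then have "a \<in> I" by (rule emb_alpha_I[OF ab(1)])
  then have "emb a + emb b \<circledast> alpha \<doteq> 0 + emb b \<circledast> alpha" using emb_I by (intro R.eqv_add) auto
  then have xb: "x \<doteq> emb b \<circledast> alpha" using R.eqv_trans[OF ab(3)] by simp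
  have kill: "arrow_elem Q g \<star> b \<in> I" if g: "g \<in> arcs Q" for g
  proof -
    have gK: "arrow_elem Q g \<in> K" using g by auto
    have "emb (arrow_elem Q g) \<circledast> x \<doteq> emb (arrow_elem Q g) \<circledast> (emb b \<circledast> alpha)"
      using gK xb by (intro R.eqv_left) auto
    also have "emb (arrow_elem Q g) \<circledast> (emb b \<circledast> alpha) = emb (arrow_elem Q g \<star> b) \<circledast> alpha"
      by (simp only: embed_mul[of Q _ _ \<tau>] pmul_assoc)
    finally have "emb (arrow_elem Q g) \<circledast> x \<doteq> emb (arrow_elem Q g \<star> b) \<circledast> alpha" .
    moreover have "fil 1 (emb (arrow_elem Q g))" by (intro embed_fil) (auto simp: fil_def)
    then have "emb (arrow_elem Q g) \<circledast> x \<in> R.I" using ann[of "emb (arrow_elem Q g)"] gK by auto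
    ultimately have "emb (arrow_elem Q g \<star> b) \<circledast> alpha \<in> R.I" using R.eqv_I by blast
    then show ?thesis using gK ab(2) by (intro emb_alpha_I) auto
  qed
  have "ve i \<star> b \<approx> theta (ve i \<star> b) \<bullet> pe (p i)" if i: "i \<in> verts Q" for i
  proof (rule left_socle)
    show "ve i \<star> b \<in> K" "i \<in> verts Q" using i ab by auto
    show "ve i \<star> (ve i \<star> b) \<approx> ve i \<star> b" by (simp add: pmul_assoc[symmetric] pmul_single pcomp_def)
    fix g assume g: "g \<in> arcs Q"
    have e: "arrow_elem Q g \<star> (ve i \<star> b) = (if tail Q g = i then arrow_elem Q g \<star> b else 0)"
      by (simp add: pmul_assoc[symmetric] pmul_single pcomp_def)
    show "arrow_elem Q g \<star> (ve i \<star> b) \<in> I"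
      unfolding e using kill[OF g] by (cases "tail Q g = i") simp_all
  qed
  then have "(\<Sum>i\<in>verts Q. ve i \<star> b) \<approx> (\<Sum>i\<in>verts Q. theta (ve i \<star> b) \<bullet> pe (p i))" by (rule eqv_sum)
  then have "b \<approx> (\<Sum>i\<in>verts Q. theta (ve i \<star> b) \<bullet> pe (p i))" unfolding pone_split[OF ab(2), symmetric] .
  then have "x \<doteq> (\<Sum>i\<in>verts Q. theta (ve i \<star> b) \<bullet> omega i)"
    by (intro R.eqv_trans[OF xb] omega_expand ab)
  moreover have "fil (l + 1) (\<Sum>i\<in>verts Q. theta (ve i \<star> b) \<bullet> omega i)"
    using omega_homog by (intro fil_sum fil_simps)
  moreover have "(\<Sum>i\<in>verts Q. theta (ve i \<star> b) \<bullet> omega i) \<in> KR" using omega_closed by auto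
  ultimately show ?thesis by blast
qed

lemma R_symmetric_top: "symmetric_top RQ \<rho>R (l + 1) omega"
proof (intro symmetric_top.intro symmetric_top_axioms.intro bq_R)
  show "\<And>\<pi>. \<pi> \<in> paths RQ \<Longrightarrow> l + 1 < path_length \<pi> \<Longrightarrow> path_elem \<pi> \<in> R.I" by (rule R_long)
  show "\<And>x. x \<in> KR \<Longrightarrow> (\<And>y. y \<in> KR \<Longrightarrow> fil 1 y \<Longrightarrow> x \<circledast> y \<in> R.I \<and> y \<circledast> x \<in> R.I) \<Longrightarrow>
      \<exists>y\<in>KR. fil (l + 1) y \<and> x \<doteq> y" by (rule R_socle)
  show "\<And>y. y \<in> KR \<Longrightarrow> fil (l + 1) y \<Longrightarrow> \<exists>c. y \<doteq> (\<Sum>i\<in>verts RQ. c i \<bullet> omega i)"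
    unfolding returning_simps(1) by (rule R_top_span)
  fix i assume "i \<in> verts RQ"
  then have i: "i \<in> verts Q" by simp
  note oK = omega_closed[OF i]
  show "omega i \<in> KR" by (rule oK)
  show "\<exists>y\<in>KR. fil (l + 1) y \<and> omega i \<doteq> y" using oK omega_homog[OF i] by (intro bexI[of _ "omega i"]) auto
  show "omega i \<notin> R.I"
    using emb_alpha_I[OF pe_p_closed[OF i]] p_props(5)[OF i] unfolding omega_def by blast
  have kill: "arrow_elem RQ a \<circledast> omega i \<in> R.I \<and> omega i \<circledast> arrow_elem RQ a \<in> R.I" if a: "a \<in> arcs RQ" for a
  proof -
    have aK: "arrow_elem RQ a \<in> KR" using a RQ.paths_single by (intro kpaths_closed) blast
    have a1: "fil 1 (arrow_elem RQ a :: _ \<Rightarrow>\<^sub>0 'k)" by (auto simp: fil_def)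
    \<comment> \<open>From degree \<open>l + 2\<close> on everything vanishes, so
      \<open>omega i\<close> is killed by all arrows on both sides.\<close>
    have "fil (1 + (l + 1)) (arrow_elem RQ a \<circledast> omega i)" "fil ((l + 1) + 1) (omega i \<circledast> arrow_elem RQ a)"
      by (rule fil_pmul[OF a1 omega_homog[OF i]] fil_pmul[OF omega_homog[OF i] a1])+
    then have "fil (Suc (l + 1)) (arrow_elem RQ a \<circledast> omega i)" "fil (Suc (l + 1)) (omega i \<circledast> arrow_elem RQ a)"
      by (simp_all only: plus_1_eq_Suc Suc_eq_plus1)
    then show ?thesis
      using R.long_paths_vanish(1)[OF R_long] RQ.pmul_closed[OF aK oK] RQ.pmul_closed[OF oK aK] by blast
  qed
  have vl: "vertex_elem i \<circledast> omega i = omega i"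
  proof -
    have "emb (ve i \<star> pe (p i)) = emb (pe (p i))" using i p_props[OF i] by (simp add: vertex_mul)
    then have "vertex_elem i \<circledast> emb (pe (p i)) = emb (pe (p i))" by (simp add: embed_mul[of Q _ _ \<tau>])
    then show ?thesis unfolding omega_def pmul_assoc[symmetric] by simp
  qed
  have vr: "omega i \<circledast> vertex_elem i = omega i"
  proof -
    have "emb (pe (p i) \<star> ve (\<tau> i)) = emb (pe (p i))" using i p_props[OF i] by (simp add: mul_vertex)
    then have e: "emb (pe (p i)) \<circledast> vertex_elem (\<tau> i) = emb (pe (p i))" by (simp add: embed_mul[of Q _ _ \<tau>])
    have "omega i \<circledast> vertex_elem i = emb (pe (p i)) \<circledast> (alpha \<circledast> vertex_elem i)"
      unfolding omega_def by (rule pmul_assoc)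
    \<comment> \<open>\<open>alpha\<close> turns the vertex \<open>i\<close> into
      \<open>\<tau> i\<close>, where \<open>p i\<close> starts; here the start of the cycle is
      matched with its end.\<close>
    also have "alpha \<circledast> vertex_elem i = vertex_elem (\<tau> i) \<circledast> alpha" using i by (simp add: alpha_ve ve_alpha)
    also have "emb (pe (p i)) \<circledast> (vertex_elem (\<tau> i) \<circledast> alpha) = omega i"
      unfolding omega_def pmul_assoc[symmetric] e ..
    finally show ?thesis .
  qed
  fix x assume x: "x \<in> KR"
  show "x \<circledast> omega i \<doteq> x $$ (i, []) \<bullet> omega i"
    by (rule R.simple_action[OF oK _ _ _ x]) (use i vl kill in simp_all)
  show "omega i \<circledast> x \<doteq> x $$ (i, []) \<bullet> omega i"
    by (rule R.simple_action_right[OF oK _ _ _ x]) (use i vr kill in simp_all)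
qed

text \<open>An arbitrary presentation is compared with the returning quiver through the trivial
  extension. The comparison map starts at the returning quiver because the bound on path lengths is
  known there.\<close>

lemma bound_quiver_of_trivial_extension:
  fixes Q' :: "('w, 'b) pre_digraph"
  assumes "bound_quiver_of Q' \<rho>' TE"
  shows "stable_bound_quiver (l + 2) Q' \<rho>' id \<and> digraph_iso RQ Q'"
proof -
  have bq': "bq Q' \<rho>'" using assms by (intro bqI) (simp add: bound_quiver_of_def)
  interpret T: bq Q' \<rho>' by (rule bq')
  obtain h where h: "h \<in> alg_iso T.BA TE" using assms by (auto simp: bound_quiver_of_def)
  have hi: "inv_into (carrier T.BA) h \<in> alg_iso TE T.BA"
    by (rule alg_iso_inv[OF h T.ring_BA]) (auto simp: T.BA_smult elim!: T.cls_cases)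
  obtain F G where FG: "bq_iso RQ \<rho>R Q' \<rho>' F G"
    using ex_bq_iso[OF bq_R bq' alg_iso_comp[OF phi_alg_iso hi] R_long] by blast
  interpret FG: bq_iso RQ \<rho>R Q' \<rho>' F G by (rule FG)
  interpret ST: symmetric_top Q' \<rho>' "l + 1" "\<lambda>m. F (omega (FG.vertex_map m))"
    by (rule FG.symmetric_top_transport[OF R_symmetric_top])
  have "stable_bound_quiver ((l + 1) + 1) Q' \<rho>' id" by (rule ST.stable_id) simp
  then show ?thesis using FG.digraph_iso by simp
qed

end

theorem theorem2p4:
  fixes Q :: "('v, 'a) pre_digraph"
    and \<rho> :: "(('v, 'a) path \<Rightarrow>\<^sub>0 'k::field) set"
    and \<tau> :: "'v \<Rightarrow> 'v"
    and l :: nat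
  assumes "1 \<le> l"
    and "stable_bound_quiver (l + 1) Q \<rho> \<tau>"
    and "finite_dimensional (bound_algebra Q \<rho>)"
    and "self_injective (bound_algebra Q \<rho>)"
  shows "(\<forall>(Q' :: ('w, 'b) pre_digraph) \<rho>'.
           bound_quiver_of Q' \<rho>' (dual_extension (bound_algebra Q \<rho>)) \<longrightarrow>
             stable_bound_quiver (l + 2) Q' \<rho>' id \<and>
             digraph_iso (returning_quiver Q \<tau>) Q')
       \<and> (\<forall>p B.
           (\<forall>i\<in>verts Q. maximal_bound_path Q \<rho> (p i) \<and> path_from_to Q (\<tau> i) i (p i) \<and> p i \<in> B) \<and>
           bound_path_basis Q \<rho> B \<longrightarrow>
             bound_quiver_of (returning_quiver Q \<tau>) (returning_relations Q \<rho> \<tau> l p)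
               (dual_extension (bound_algebra Q \<rho>)) \<and>
             (\<exists>\<phi>\<in>alg_iso
                   (bound_algebra (returning_quiver Q \<tau>) (returning_relations Q \<rho> \<tau> l p))
                   (dual_extension (bound_algebra Q \<rho>)).
                (\<forall>i\<in>verts Q.
                   \<phi> (path_class (returning_quiver Q \<tau>) (returning_relations Q \<rho> \<tau> l p)
                        (vertex_elem i))
                   = (path_class Q \<rho> (vertex_elem i), \<zero>\<^bsub>dual_bimodule (bound_algebra Q \<rho>)\<^esub>)) \<and>
                (\<forall>\<beta>\<in>arcs Q.
                   \<phi> (path_class (returning_quiver Q \<tau>) (returning_relations Q \<rho> \<tau> l p)
                        (arrow_elem (returning_quiver Q \<tau>) (Inl \<beta>)))
                   = (path_class Q \<rho> (arrow_elem Q \<beta>), \<zero>\<^bsub>dual_bimodule (bound_algebra Q \<rho>)\<^esub>)) \<and>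
                (\<forall>i\<in>verts Q.
                   \<phi> (path_class (returning_quiver Q \<tau>) (returning_relations Q \<rho> \<tau> l p)
                        (arrow_elem (returning_quiver Q \<tau>) (Inr i)))
                   = (\<zero>\<^bsub>bound_algebra Q \<rho>\<^esub>, dual_basis_elem Q \<rho> B (p i)))))"
proof -
  have stable: "stable_bq Q \<rho> \<tau> l p"
    if "\<And>i. i \<in> verts Q \<Longrightarrow> maximal_bound_path Q \<rho> (p i) \<and> path_from_to Q (\<tau> i) i (p i)" for p
  proof (intro stable_bq.intro stable_bq_axioms.intro bqI assms that)
    show "homogeneous_bound_quiver Q \<rho>" using assms(2) unfolding stable_bound_quiver_def by (rule conjunct1)
  qed
  have "\<forall>i\<in>verts Q. \<exists>\<pi>. maximal_bound_path Q \<rho> \<pi> \<and> path_from_to Q (\<tau> i) i \<pi>"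
    using assms(2)[unfolded stable_bound_quiver_def] by blast
  \<comment> \<open>The first claim does not mention chosen paths, so any choice of maximal bound
    paths serves for it.\<close>
  from bchoice[OF this] obtain p where
    p: "\<forall>i\<in>verts Q. maximal_bound_path Q \<rho> (p i) \<and> path_from_to Q (\<tau> i) i (p i)" by (rule exE)
  have 1: "stable_bound_quiver (l + 2) Q' \<rho>' id \<and> digraph_iso (returning_quiver Q \<tau>) Q'"
    if "bound_quiver_of Q' \<rho>' (dual_extension (bound_algebra Q \<rho>))"
    for Q' :: "('w, 'b) pre_digraph" and \<rho>'
    by (rule stable_bq.bound_quiver_of_trivial_extension[OF stable[of p] that]) (use p in blast)
  have 2: "bound_quiver_of (returning_quiver Q \<tau>) (returning_relations Q \<rho> \<tau> l p)
      (dual_extension (bound_algebra Q \<rho>)) \<and>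
    (\<exists>\<phi>\<in>alg_iso (bound_algebra (returning_quiver Q \<tau>) (returning_relations Q \<rho> \<tau> l p))
        (dual_extension (bound_algebra Q \<rho>)).
      (\<forall>i\<in>verts Q. \<phi> (path_class (returning_quiver Q \<tau>) (returning_relations Q \<rho> \<tau> l p) (vertex_elem i))
        = (path_class Q \<rho> (vertex_elem i), \<zero>\<^bsub>dual_bimodule (bound_algebra Q \<rho>)\<^esub>)) \<and>
      (\<forall>\<beta>\<in>arcs Q. \<phi> (path_class (returning_quiver Q \<tau>) (returning_relations Q \<rho> \<tau> l p)
          (arrow_elem (returning_quiver Q \<tau>) (Inl \<beta>)))
        = (path_class Q \<rho> (arrow_elem Q \<beta>), \<zero>\<^bsub>dual_bimodule (bound_algebra Q \<rho>)\<^esub>)) \<and>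
      (\<forall>i\<in>verts Q. \<phi> (path_class (returning_quiver Q \<tau>) (returning_relations Q \<rho> \<tau> l p)
          (arrow_elem (returning_quiver Q \<tau>) (Inr i)))
        = (\<zero>\<^bsub>bound_algebra Q \<rho>\<^esub>, dual_basis_elem Q \<rho> B (p i))))"
    if pB: "(\<forall>i\<in>verts Q. maximal_bound_path Q \<rho> (p i) \<and> path_from_to Q (\<tau> i) i (p i) \<and> p i \<in> B) \<and>
      bound_path_basis Q \<rho> B" for p B
  proof -
    interpret S: stable_bq Q \<rho> \<tau> l p by (rule stable) (use pB in blast)
    have B: "bound_path_basis Q \<rho> B" "\<forall>i\<in>verts Q. p i \<in> B" using pB by blast+
    show ?thesis
      unfolding bound_quiver_of_def
      using S.R.hbq S.phi_alg_iso S.phi_values[OF B] by blast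
  qed
  show ?thesis
    by (rule conjI, (rule allI)+, rule impI, rule 1, assumption, (rule allI)+, rule impI, rule 2, assumption)
qed

end
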